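(* Let $(X,\|\cdot\|_X)$ be a $K$-convex complex Banach space. For every $p\in(1,\infty)$, there exist $c(p,X),C(p,X)\in(0,\infty)$ and $\eta(p,X)\in\big(\frac12,1\big]$ such that for every $n,d\in\mathbb{N}$ with $d\in\{1,\ldots,n\}$ and every function $f:\{-1,1\}^n\to X$ of degree at most $d$, we have $$\forall\,t\geq0,\qquad \|e^{-t\Delta}f\|_{L_p(\{-1,1\}^n;X)}\geq c(p,X)\,e^{-C(p,X)\,d\max\{t,\,t^{\eta(p,X)}\}}\,\|f\|_{L_p(\{-1,1\}^n;X)}.$$
   Context: $\mathbb{N}=\{1,2,\ldots\}$. For $p\in[1,\infty)$, $\|f\|_{L_p(\{-1,1\}^n;X)}=\big(2^{-n}\sum_{\varepsilon\in\{-1,1\}^n}\|f(\varepsilon)\|_X^p\big)^{1/p}$. For $A\subseteq\{1,\ldots,n\}$, the Walsh function is $w_A(\varepsilon)=\prod_{i\in A}\varepsilon_i$. Every $f:\{-1,1\}^n\to X$ has the expansion $f=\sum_{A}\widehat f(A)w_A$ with $\widehat f(A)=2^{-n}\sum_{\delta\in\{-1,1\}^n}f(\delta)w_A(\delta)\in X$. The discrete heat semigroup is $e^{-t\Delta}f=\sum_Ae^{-t|A|}\widehat f(A)w_A$. A function $f$ has degree at most $d$ if $\widehat f(A)=0$ whenever $|A|>d$. The Rademacher projection is $\mathsf{Rad}(f)(\varepsilon)=\sum_{i=1}^n\widehat f(\{i\})\varepsilon_i$. $X$ is $K$-convex if $\sup_{n\in\mathbb{N}}\|\mathsf{Rad}\|_{L_p(\{-1,1\}^n;X)\to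 L_p(\{-1,1\}^n;X)}<\infty$ for some (equivalently, for all) $p\in(1,\infty)$. *)

theory Defs
  imports "HOL-Analysis.Analysis"
begin

text \<open>Complex Banach spaces, as real Banach spaces carrying a compatible complex scaling.\<close>

class complex_banach = banach +
  fixes scaleC :: "complex \<Rightarrow> 'a \<Rightarrow> 'a"  (infixr \<open>*\<^sub>C\<close> 75)
  assumes scaleC_add_right: "a *\<^sub>C (x + y) = a *\<^sub>C x + a *\<^sub>C y"
    and scaleC_add_left: "(a + b) *\<^sub>C x = a *\<^sub>C x + b *\<^sub>C x"
    and scaleC_scaleC: "a *\<^sub>C b *\<^sub>C x = (a * b) *\<^sub>C x"
    and scaleC_of_real: "complex_of_real r *\<^sub>C x = r *\<^sub>R x"
    and norm_scaleC: "norm (a *\<^sub>C x) = cmod a * norm x"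

text \<open>
  Points of the cube are functions \<^typ>\<open>nat \<Rightarrow> real\<close> that are undefined outside \<open>{1..n}\<close>.
  A function on the cube is a total function on \<^typ>\<open>nat \<Rightarrow> real\<close>;
  only its values on the cube enter the definitions below.
\<close>

definition cube :: "nat \<Rightarrow> (nat \<Rightarrow> real) set" where
  "cube n = (\<Pi>\<^sub>E i\<in>{1..n}. {-1, 1})"

definition Lp_norm :: "nat \<Rightarrow> real \<Rightarrow> ((nat \<Rightarrow> real) \<Rightarrow> 'a::real_normed_vector) \<Rightarrow> real" where
  "Lp_norm n p f = ((\<Sum>\<epsilon>\<in>cube n. norm (f \<epsilon>) powr p) / 2 ^ n) powr (1 / p)"

definition walsh :: "nat set \<Rightarrow> (nat \<Rightarrow> real) \<Rightarrow> real" where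
  "walsh A \<epsilon> = (\<Prod>i\<in>A. \<epsilon> i)"

definition walsh_coeff ::
  "nat \<Rightarrow> ((nat \<Rightarrow> real) \<Rightarrow> 'a::real_vector) \<Rightarrow> nat set \<Rightarrow> 'a" where
  "walsh_coeff n f A = (1 / 2 ^ n) *\<^sub>R (\<Sum>\<delta>\<in>cube n. walsh A \<delta> *\<^sub>R f \<delta>)"

definition heat ::
  "nat \<Rightarrow> real \<Rightarrow> ((nat \<Rightarrow> real) \<Rightarrow> 'a::real_vector) \<Rightarrow> (nat \<Rightarrow> real) \<Rightarrow> 'a" where
  "heat n t f \<epsilon> =
     (\<Sum>A\<in>Pow {1..n}. exp (- t * real (card A)) *\<^sub>R walsh A \<epsilon> *\<^sub>R walsh_coeff n f A)"

definition degree_at_most ::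
  "nat \<Rightarrow> nat \<Rightarrow> ((nat \<Rightarrow> real) \<Rightarrow> 'a::real_vector) \<Rightarrow> bool" where
  "degree_at_most n d f \<longleftrightarrow> (\<forall>A\<subseteq>{1..n}. card A > d \<longrightarrow> walsh_coeff n f A = 0)"

definition Rad ::
  "nat \<Rightarrow> ((nat \<Rightarrow> real) \<Rightarrow> 'a::real_vector) \<Rightarrow> (nat \<Rightarrow> real) \<Rightarrow> 'a" where
  "Rad n f \<epsilon> = (\<Sum>i\<in>{1..n}. \<epsilon> i *\<^sub>R walsh_coeff n f {i})"

text \<open>
  The operator norm of the Rademacher projection is taken in \<^typ>\<open>ennreal\<close>, where suprema
  of unbounded sets are infinite.
\<close>

definition Rad_opnorm :: "'a::real_normed_vector itself \<Rightarrow> nat \<Rightarrow> real \<Rightarrow> ennreal" where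
  "Rad_opnorm X n p =
     (SUP f\<in>{f :: (nat \<Rightarrow> real) \<Rightarrow> 'a. Lp_norm n p f \<le> 1}. ennreal (Lp_norm n p (Rad n f)))"

definition K_convex :: "'a::real_normed_vector itself \<Rightarrow> bool" where
  "K_convex X \<longleftrightarrow> (\<exists>p>1. (SUP n\<in>{1..}. Rad_opnorm X n p) < \<infinity>)"

end

theory Submission
  imports Defs "HOL-Complex_Analysis.Complex_Analysis"
begin

text \<open>
  Let $T_t = e^{-t\Delta}$. The lower bound follows from the analyticity of the heat semigroup:
  if $\|T_z\| \le 2$ on a sector $|{\rm Im}\, z| \le \gamma\, {\rm Re}\, z$, with \<open>\<gamma>\<close>
  depending only on $p$ and $X$, then for $f$ of degree at most $d$ and a functional $\xi$
  the polynomial $P(w) = \sum_{k \le d} w^k e^{-tk} \xi(f_k)$, where $f_k$ is the part of $f$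
  that is homogeneous of degree $k$, satisfies $|P(e^{-z})| \le 2 \|\xi\| \|T_t f\|$ on
  that sector, and $P(e^t) = \xi(f)$. The closure of the image of the sector under $e^{-z}$ contains
  a lens with vertices 0 and 1 of half-angle \<open>\<theta> = arctan \<gamma>\<close>. The exterior of the lens is the
  image of a half-plane under an explicit conformal map, and the maximum principle there
  (Bernstein--Walsh) bounds $|P(e^t)|$ by the $d$-th power of a number of size
  $1 + O(t^\eta)$ with \<open>\<eta> = \<pi> / (2 (\<pi> - \<theta>))\<close>. The positive angle of the lens is what makes
  \<open>\<eta> > 1/2\<close>; a segment in place of the lens gives exactly \<open>1/2\<close>. This half of the
  proof is \<open>polynomial_growth_from_sector\<close>.

  That the semigroup is analytic is a theorem of Pisier, and the proof follows his idea.
  A Banach space in which, for every $N$, there are $N$ unit vectors all of whose signed sums have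
  norm almost $N$ contains almost isometric real copies of all spaces \<open>\<ell>\<^sub>1\<^sup>N\<close>. In
  $L_1(\{-1,1\}^m)$ the Rademacher projection maps a family of unit vectors to vectors of norm about
  \<open>\<surd>m\<close>, so \<open>K\<close>-convexity excludes this (\<open>K_convex_imp_sign_deficient\<close>). The resulting
  defect in signed sums passes from $X$ to $L_p(X)$, for every \<open>p > 1\<close>
  (\<open>sign_deficient_Lp\<close>). For commuting conditional expectations $E_1, \dots, E_N$ the
  product $\prod_j (I - E_j)$ is a signed sum of $2^N$ contractions. Were its norm
  close to $2^N$, every choice of signs would be nearly norm-additive on the vectors $E_j f$; hence
  the norm is at most $2^N - \delta$ (\<open>product_of_complements_gap\<close>). As $T_t$ is an average of
  conditional expectations, $\|(I - T_t)^N\| \le 2^N - \delta$ for all $t$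
  (\<open>heat_difference_gap\<close>).

  Finally, a theorem of Kato turns this gap into analyticity. It makes $I + T_t$ invertible with a
  uniform bound, which bounds the resolvent $(\lambda + \Delta)^{-1}$ by a multiple of
  $1/|\lambda|$ on the right half-plane. An inverse Laplace integral then gives
  $\|\Delta T_s\| \le C/s$, and Taylor expansion yields the sector
  (\<open>mult_bound_sector\<close>). Everything in that argument is a function of \<open>\<Delta>\<close>, so it takes
  place in the finite-dimensional span of the homogeneous parts of one function $f$; the
  only facts kept about $L_p(X)$ are that $a \mapsto \|\sum_k a_k f_k\|$ is a seminorm on
  sequences, and how it reacts to multipliers.
\<close>

section \<open>Norming functionals on finitely many coordinates\<close>

text \<open>
  The Hahn--Banach extension argument, one coordinate at a time. The multiple \<open>s\<close> of the vector
  \<open>b\<close> plays the part of the initial one-dimensional subspace, on which the functional is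
  \<open>s * p b\<close>.
\<close>

lemma sublinear_dominates_linear:
  fixes p :: "(nat \<Rightarrow> real) \<Rightarrow> real"
  assumes sub: "\<And>a b. p (\<lambda>k. a k + b k) \<le> p a + p b"
    and hom: "\<And>r a. 0 \<le> r \<Longrightarrow> p (\<lambda>k. r * a k) = r * p a"
  shows "\<exists>c. \<forall>s a. s * p b + (\<Sum>k<m. c k * a k) \<le> p (\<lambda>k. s * b k + (if k < m then a k else 0))"
proof (induction m)
  case 0
  have "s * p b \<le> p (\<lambda>k. s * b k)" for s
  proof (cases "s \<ge> 0")
    case False
    have "p (\<lambda>k. s * b k + (- s) * b k) \<le> p (\<lambda>k. s * b k) + p (\<lambda>k. (- s) * b k)"
      by (rule sub)
    moreover have "p (\<lambda>k. (- s) * b k) = (- s) * p b"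
      using False by (intro hom) simp
    moreover have "p (\<lambda>k. s * b k + (- s) * b k) = 0"
      using hom[of 0 b] by simp
    ultimately show ?thesis by simp
  qed (simp add: hom)
  then show ?case by simp
next
  case (Suc m)
  then obtain c where c: "\<And>s a. s * p b + (\<Sum>k<m. c k * a k)
      \<le> p (\<lambda>k. s * b k + (if k < m then a k else 0))" by blast
  define v where "v s a = (\<lambda>k. s * b k + (if k < m then a k else (0::real)))" for s a
  define e where "e = (\<lambda>k. if k = m then 1 else (0::real))"
  define l where "l s a = s * p b + (\<Sum>k<m. c k * a k)" for s a
  \<comment> \<open>Every lower bound for the value at the new coordinate is below every upper bound.\<close>
  have lower: "l s a - p (\<lambda>k. v s a k - e k) \<le> p (\<lambda>k. v s' a' k + e k) - l s' a'" for s a s' a'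
  proof -
    have "l s a + l s' a' = l (s + s') (\<lambda>k. a k + a' k)"
      by (simp add: l_def algebra_simps sum.distrib)
    also have "\<dots> \<le> p (v (s + s') (\<lambda>k. a k + a' k))"
      unfolding l_def v_def by (rule c)
    also have "v (s + s') (\<lambda>k. a k + a' k) = (\<lambda>k. (v s a k - e k) + (v s' a' k + e k))"
      by (auto simp: v_def fun_eq_iff algebra_simps)
    also have "p \<dots> \<le> p (\<lambda>k. v s a k - e k) + p (\<lambda>k. v s' a' k + e k)"
      by (rule sub)
    finally show ?thesis by simp
  qed
  define \<alpha> where "\<alpha> = (SUP x. l (fst x) (snd x) - p (\<lambda>k. v (fst x) (snd x) k - e k))"
  have bdd: "bdd_above (range (\<lambda>x. l (fst x) (snd x) - p (\<lambda>k. v (fst x) (snd x) k - e k)))"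
    by (rule bdd_aboveI2[where M = "p (\<lambda>k. v 0 (\<lambda>_. 0) k + e k) - l 0 (\<lambda>_. 0)"]) (rule lower)
  have \<alpha>1: "l s a - p (\<lambda>k. v s a k - e k) \<le> \<alpha>" for s a
    using cSUP_upper[OF _ bdd, of "(s, a)"] by (simp add: \<alpha>_def)
  have \<alpha>2: "\<alpha> \<le> p (\<lambda>k. v s a k + e k) - l s a" for s a
    unfolding \<alpha>_def by (rule cSUP_least) (auto intro: lower)
  have ext: "l s a + r * \<alpha> \<le> p (\<lambda>k. v s a k + r * e k)" for r s a
  proof (cases r "0 :: real" rule: linorder_cases)
    case equal
    then show ?thesis using c by (simp add: l_def v_def)
  next
    case greater
    have "l (s / r) (\<lambda>k. a k / r) + \<alpha> \<le> p (\<lambda>k. v (s / r) (\<lambda>k. a k / r) k + e k)"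
      using \<alpha>2[of "s / r" "\<lambda>k. a k / r"] by simp
    then have "r * (l (s / r) (\<lambda>k. a k / r) + \<alpha>) \<le> r * p (\<lambda>k. v (s / r) (\<lambda>k. a k / r) k + e k)"
      using greater by simp
    also have "\<dots> = p (\<lambda>k. r * (v (s / r) (\<lambda>k. a k / r) k + e k))"
      using greater by (simp add: hom)
    also have "(\<lambda>k. r * (v (s / r) (\<lambda>k. a k / r) k + e k)) = (\<lambda>k. v s a k + r * e k)"
      using greater by (auto simp: v_def fun_eq_iff field_simps)
    also have "r * (l (s / r) (\<lambda>k. a k / r) + \<alpha>) = l s a + r * \<alpha>"
      using greater by (simp add: l_def distrib_left sum_distrib_left)
    finally show ?thesis .
  next
    case less
    define u where "u = - r"
    have u: "u > 0" using less by (simp add: u_def)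
    have "l (s / u) (\<lambda>k. a k / u) - \<alpha> \<le> p (\<lambda>k. v (s / u) (\<lambda>k. a k / u) k - e k)"
      using \<alpha>1[of "s / u" "\<lambda>k. a k / u"] by simp
    then have "u * (l (s / u) (\<lambda>k. a k / u) - \<alpha>) \<le> u * p (\<lambda>k. v (s / u) (\<lambda>k. a k / u) k - e k)"
      using u by simp
    also have "\<dots> = p (\<lambda>k. u * (v (s / u) (\<lambda>k. a k / u) k - e k))"
      using u by (simp add: hom)
    also have "(\<lambda>k. u * (v (s / u) (\<lambda>k. a k / u) k - e k)) = (\<lambda>k. v s a k - u * e k)"
      using u by (auto simp: v_def fun_eq_iff field_simps)
    also have "u * (l (s / u) (\<lambda>k. a k / u) - \<alpha>) = l s a - u * \<alpha>"
      using u by (simp add: l_def distrib_left right_diff_distrib sum_distrib_left)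
    finally show ?thesis by (simp add: u_def)
  qed
  have "s * p b + (\<Sum>k<Suc m. (c(m := \<alpha>)) k * a k)
      \<le> p (\<lambda>k. s * b k + (if k < Suc m then a k else 0))" for s a
  proof -
    have "(\<Sum>k<m. (c(m := \<alpha>)) k * a k) = (\<Sum>k<m. c k * a k)" by (rule sum.cong) auto
    moreover have "(\<lambda>k. s * b k + (if k < Suc m then a k else 0)) = (\<lambda>k. v s a k + a m * e k)"
      by (auto simp: v_def e_def fun_eq_iff less_Suc_eq)
    ultimately show ?thesis using ext[of s a "a m"] by (simp add: l_def algebra_simps)
  qed
  then show ?case by blast
qed

lemma sum_even_odd: "(\<Sum>k<2 * m. g k) = (\<Sum>k<m. g (2 * k) + g (2 * k + 1))"
  for g :: "nat \<Rightarrow> 'b::comm_monoid_add"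
  by (induction m) (auto simp: algebra_simps)

text \<open>
  A complex sequence with $n + 1$ relevant entries is read as a real one with $2(n + 1)$ entries, the
  real parts at even and the imaginary parts at odd places. A complex linear functional
  whose real part is dominated by \<open>N\<close> is dominated in modulus, because its argument can be
  rotated.
\<close>

lemma norming_functional:
  fixes N :: "(nat \<Rightarrow> complex) \<Rightarrow> real"
  assumes sub: "\<And>a b. N (\<lambda>k. a k + b k) \<le> N a + N b"
    and hom: "\<And>z a. N (\<lambda>k. z * a k) = cmod z * N a"
    and fin: "\<And>a b. (\<And>k. k \<le> n \<Longrightarrow> a k = b k) \<Longrightarrow> N a = N b"
  obtains c where "\<And>a. cmod (\<Sum>k\<le>n. c k * a k) \<le> N a" "(\<Sum>k\<le>n. c k * b k) = complex_of_real (N b)"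
proof -
  define m where "m = Suc n"
  define p where "p a = N (\<lambda>k. Complex (a (2 * k)) (a (2 * k + 1)))" for a
  define r where "r a k = (if even k then Re (a (k div 2)) else Im (a (k div 2)))"
    for a :: "nat \<Rightarrow> complex" and k :: nat
  have p_r: "p (r a) = N a" for a by (simp add: p_def r_def)
  have p_fin: "p a = p b" if "\<And>k. k < 2 * m \<Longrightarrow> a k = b k" for a b
    unfolding p_def by (rule fin) (auto simp: that m_def)
  have "p (\<lambda>k. a k + b k) \<le> p a + p b" for a b
    unfolding p_def using sub[of "\<lambda>k. Complex (a (2 * k)) (a (2 * k + 1))"
        "\<lambda>k. Complex (b (2 * k)) (b (2 * k + 1))"] by (simp add: complex_add)
  moreover have "p (\<lambda>k. s * a k) = s * p a" if "0 \<le> s" for s a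
    unfolding p_def using hom[of "complex_of_real s" "\<lambda>k. Complex (a (2 * k)) (a (2 * k + 1))"] that
    by (simp add: complex_of_real_mult_Complex)
  ultimately obtain d where d: "\<And>s a. s * p (r b) + (\<Sum>k<2 * m. d k * a k)
      \<le> p (\<lambda>k. s * r b k + (if k < 2 * m then a k else 0))"
    using sublinear_dominates_linear[of p "r b" "2 * m"] by blast
  define c where "c k = Complex (d (2 * k)) (- d (2 * k + 1))" for k
  have c_d: "(\<Sum>k<2 * m. d k * r a k) = Re (\<Sum>k\<le>n. c k * a k)" for a
    unfolding sum_even_odd by (simp add: c_def r_def m_def lessThan_Suc_atMost)
  have le: "Re (\<Sum>k\<le>n. c k * a k) \<le> N a" for a
  proof -
    have "(\<Sum>k<2 * m. d k * r a k) \<le> p (\<lambda>k. if k < 2 * m then r a k else 0)"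
      using d[of 0 "r a"] by simp
    also have "\<dots> = p (r a)" by (rule p_fin) auto
    finally show ?thesis by (simp add: c_d p_r)
  qed
  have ge: "N b \<le> Re (\<Sum>k\<le>n. c k * b k)"
  proof -
    have "p (r b) + (\<Sum>k<2 * m. d k * - r b k)
        \<le> p (\<lambda>k. r b k + (if k < 2 * m then - r b k else 0))"
      using d[of 1 "\<lambda>k. - r b k"] by simp
    also have "\<dots> = p (\<lambda>k. 0)" by (rule p_fin) auto
    also have "\<dots> = 0" using hom[of 0 "\<lambda>_. 0"] by (simp add: p_def flip: zero_complex.code)
    finally show ?thesis by (simp add: p_r sum_negf c_d)
  qed
  have bound: "cmod (\<Sum>k\<le>n. c k * a k) \<le> N a" for a
  proof (cases "(\<Sum>k\<le>n. c k * a k) = 0")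
    case True
    have "0 \<le> N a"
      using le[of a] le[of "\<lambda>k. (-1) * a k"] hom[of "-1" a] True by (simp add: sum_negf)
    with True show ?thesis by simp
  next
    case False
    define S where "S = (\<Sum>k\<le>n. c k * a k)"
    define z where "z = cnj S / cmod S"
    have "S * cnj S = complex_of_real ((cmod S)\<^sup>2)"
      by (rule complex_norm_square[symmetric])
    then have "z * S = cmod S"
      using False by (simp add: z_def S_def[symmetric] mult.commute[of "cnj S"] power2_eq_square)
    then have "cmod S = Re (\<Sum>k\<le>n. c k * (z * a k))"
      by (simp add: S_def sum_distrib_left mult.left_commute)
    also have "\<dots> \<le> N (\<lambda>k. z * a k)" by (rule le)
    also have "\<dots> = cmod z * N a" by (rule hom)
    also have "\<dots> = N a" using False by (simp add: z_def S_def[symmetric] norm_divide)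
    finally show ?thesis by (simp add: S_def)
  qed
  moreover have "(\<Sum>k\<le>n. c k * b k) = complex_of_real (N b)"
  proof -
    have "cmod (\<Sum>k\<le>n. c k * b k) \<le> Re (\<Sum>k\<le>n. c k * b k)" using bound[of b] ge by simp
    then have "Im (\<Sum>k\<le>n. c k * b k) = 0" 
      by (smt (verit) abs_Re_le_cmod cmod_power2 power2_eq_square  mult_eq_0_iff)
    then show ?thesis using ge le[of b] by (simp add: complex_eq_iff)
  qed
  ultimately show thesis by (rule that)
qed

section \<open>Seminorms on sequences and their multipliers\<close>

text \<open>
  A single term of the exponential series at $j$.
\<close>

lemma power_div_fact_le_exp: "real j ^ j / fact j \<le> exp (real j)"
proof -
  have "(\<Sum>i\<in>{j}. real j ^ i /\<^sub>R fact i) \<le> (\<Sum>i. real j ^ i /\<^sub>R fact i)"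
    by (intro sum_le_suminf summable_exp_generic) auto
  then show ?thesis by (simp add: exp_def divide_inverse mult.commute)
qed

text \<open>
  The model is \<open>N a\<close> $= \|\sum_k a_k f_k\|$, where \<open>f\<^sub>0, \<dots>, f\<^sub>n\<close> are the homogeneous parts of a function.
  An operator acting on \<open>f\<^sub>k\<close> as the scalar \<open>m k\<close> is then a pointwise multiplication of the
  sequence.
\<close>

locale multiplier_seminorm =
  fixes N :: "(nat \<Rightarrow> complex) \<Rightarrow> real" and n :: nat
  assumes subadditive: "\<And>a b. N (\<lambda>k. a k + b k) \<le> N a + N b"
    and homogeneous: "\<And>z a. N (\<lambda>k. z * a k) = cmod z * N a"
    and finitely_determined: "\<And>a b. (\<And>k. k \<le> n \<Longrightarrow> a k = b k) \<Longrightarrow> N a = N b"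
begin

lemma N_zero [simp]: "N (\<lambda>_. 0) = 0"
  using homogeneous[of 0 "\<lambda>_. 0"] by simp

lemma N_uminus: "N (\<lambda>k. - a k) = N a"
  using homogeneous[of "-1" a] by simp

lemma N_nonneg: "0 \<le> N a"
  using subadditive[of a "\<lambda>k. - a k"] by (simp add: N_uminus)

lemma N_minus_ge: "N a - N b \<le> N (\<lambda>k. a k - b k)"
  using subadditive[of "\<lambda>k. a k - b k" b] by simp

lemma N_sum_le: "N (\<lambda>k. \<Sum>i\<in>I. a i k) \<le> (\<Sum>i\<in>I. N (a i))"
proof (induction I rule: infinite_finite_induct)
  case (insert x F)
  then show ?case using subadditive[of "a x" "\<lambda>k. \<Sum>i\<in>F. a i k"] by simp
qed auto

text \<open>
  The operator norm of the multiplier on the cyclic subspace spanned by the homogeneous parts is at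
  most \<open>C\<close>.
\<close>

definition mult_bound :: "(nat \<Rightarrow> complex) \<Rightarrow> real \<Rightarrow> bool" where
  "mult_bound m C \<longleftrightarrow> (\<forall>a. N (\<lambda>k. m k * a k) \<le> C * N a)"

lemma mult_boundD: "mult_bound m C \<Longrightarrow> N (\<lambda>k. m k * a k) \<le> C * N a"
  by (simp add: mult_bound_def)

lemma mult_bound_mono: "mult_bound m C \<Longrightarrow> C \<le> C' \<Longrightarrow> mult_bound m C'"
  unfolding mult_bound_def by (meson N_nonneg mult_right_mono order_trans)

lemma mult_bound_const: "cmod z \<le> C \<Longrightarrow> mult_bound (\<lambda>_. z) C"
  by (simp add: mult_bound_def homogeneous N_nonneg mult_right_mono)

lemma mult_bound_add:
  assumes "mult_bound m C" "mult_bound m' C'"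
  shows "mult_bound (\<lambda>k. m k + m' k) (C + C')"
  unfolding mult_bound_def
proof
  fix a
  show "N (\<lambda>k. (m k + m' k) * a k) \<le> (C + C') * N a"
    using subadditive[of "\<lambda>k. m k * a k" "\<lambda>k. m' k * a k"] mult_boundD[OF assms(1), of a]
      mult_boundD[OF assms(2), of a] by (simp add: distrib_right)
qed

lemma mult_bound_mult:
  assumes "mult_bound m C" "mult_bound m' C'" "0 \<le> C"
  shows "mult_bound (\<lambda>k. m k * m' k) (C * C')"
  unfolding mult_bound_def
proof
  fix a
  have "N (\<lambda>k. m k * (m' k * a k)) \<le> C * N (\<lambda>k. m' k * a k)" by (rule mult_boundD) fact
  also have "\<dots> \<le> C * (C' * N a)" using assms by (intro mult_left_mono mult_boundD)
  finally show "N (\<lambda>k. m k * m' k * a k) \<le> C * C' * N a" by (simp add: mult.assoc)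
qed

lemma mult_bound_scale: "mult_bound m C \<Longrightarrow> mult_bound (\<lambda>k. z * m k) (cmod z * C)"
  using mult_bound_mult[OF mult_bound_const[OF order_refl], of m C z] by simp

lemma mult_bound_power:
  assumes "mult_bound m C" "0 \<le> C"
  shows "mult_bound (\<lambda>k. m k ^ j) (C ^ j)"
  by (induction j) (auto intro!: mult_bound_mult mult_bound_const assms)

lemma mult_bound_sum:
  assumes "\<And>i. i \<in> I \<Longrightarrow> mult_bound (m i) (C i)"
  shows "mult_bound (\<lambda>k. \<Sum>i\<in>I. m i k) (\<Sum>i\<in>I. C i)"
  using assms
  by (induction I rule: infinite_finite_induct) (auto intro: mult_bound_add mult_bound_const)

text \<open>
  A lower bound for an operator bounds its inverse; a multiplier without zeros is surjective.
\<close>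

lemma mult_bound_divide:
  assumes "\<And>a. N a \<le> C * N (\<lambda>k. m k * a k)" "\<And>k. m k \<noteq> 0"
  shows "mult_bound (\<lambda>k. 1 / m k) C"
  unfolding mult_bound_def
proof
  fix a
  show "N (\<lambda>k. 1 / m k * a k) \<le> C * N a"
    using assms(1)[of "\<lambda>k. 1 / m k * a k"] assms(2) by simp
qed

lemma N_le_coordinates: "N a \<le> (\<Sum>k\<le>n. cmod (a k) * N (\<lambda>j. if j = k then 1 else 0))"
proof -
  have "N a = N (\<lambda>j. \<Sum>k\<le>n. a k * (if j = k then 1 else 0))"
    by (rule finitely_determined) (simp add: if_distrib cong: if_cong)
  also have "\<dots> \<le> (\<Sum>k\<le>n. N (\<lambda>j. a k * (if j = k then 1 else 0)))" by (rule N_sum_le)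
  finally show ?thesis by (simp only: homogeneous)
qed

lemma mult_bound_limit:
  assumes lim: "\<And>k. k \<le> n \<Longrightarrow> (\<lambda>i. m i k) \<longlonglongrightarrow> l k"
    and bound: "\<And>i. mult_bound (m i) C"
  shows "mult_bound l C"
  unfolding mult_bound_def
proof
  fix a
  have "N (\<lambda>k. l k * a k)
      \<le> C * N a + (\<Sum>k\<le>n. cmod ((l k - m i k) * a k) * N (\<lambda>j. if j = k then 1 else 0))" for i
    using subadditive[of "\<lambda>k. m i k * a k" "\<lambda>k. (l k - m i k) * a k"]
      N_le_coordinates[of "\<lambda>k. (l k - m i k) * a k"] mult_boundD[OF bound[of i], of a]
    by (simp add: algebra_simps)
  moreover have "(\<lambda>i. C * N a +
        (\<Sum>k\<le>n. cmod ((l k - m i k) * a k) * N (\<lambda>j. if j = k then 1 else 0)))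
      \<longlonglongrightarrow> C * N a + (\<Sum>k\<le>n. cmod ((l k - l k) * a k) * N (\<lambda>j. if j = k then 1 else 0))"
    by (intro tendsto_intros lim) auto
  ultimately show "N (\<lambda>k. l k * a k) \<le> C * N a"
    using LIMSEQ_le_const[of _ "C * N a"] by simp
qed

text \<open>
  Minkowski's inequality for integrals, obtained by testing against a norming functional, so that only
  integrals of scalar functions occur.
\<close>

lemma mult_bound_integral:
  fixes m :: "real \<Rightarrow> nat \<Rightarrow> complex"
  assumes int: "\<And>k. k \<le> n \<Longrightarrow> ((\<lambda>s. m s k) has_integral l k) S"
    and bound: "\<And>s. s \<in> S \<Longrightarrow> mult_bound (m s) (h s)"
    and h: "(h has_integral I) S"
  shows "mult_bound l I"
  unfolding mult_bound_def
proof
  fix a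
  obtain c where c: "\<And>a. cmod (\<Sum>k\<le>n. c k * a k) \<le> N a"
      "(\<Sum>k\<le>n. c k * (l k * a k)) = complex_of_real (N (\<lambda>k. l k * a k))"
    by (rule norming_functional[of N n "\<lambda>k. l k * a k"])
      (rule subadditive, rule homogeneous, rule finitely_determined, blast, blast)
  have "((\<lambda>s. \<Sum>k\<le>n. c k * (m s k * a k)) has_integral (\<Sum>k\<le>n. c k * (l k * a k))) S"
    by (intro has_integral_sum has_integral_mult_right has_integral_mult_left int) auto
  then have F: "((\<lambda>s. \<Sum>k\<le>n. c k * (m s k * a k)) has_integral complex_of_real (N (\<lambda>k. l k * a k))) S"
    by (simp only: c(2))
  have "norm (integral S (\<lambda>s. \<Sum>k\<le>n. c k * (m s k * a k))) \<le> integral S (\<lambda>s. h s * N a)"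
  proof (rule integral_norm_bound_integral)
    show "(\<lambda>s. \<Sum>k\<le>n. c k * (m s k * a k)) integrable_on S" using F by blast
    show "(\<lambda>s. h s * N a) integrable_on S"
      using has_integral_mult_left[OF h] by blast
    show "norm (\<Sum>k\<le>n. c k * (m s k * a k)) \<le> h s * N a" if "s \<in> S" for s
      using c(1)[of "\<lambda>k. m s k * a k"] mult_boundD[OF bound[OF that], of a] by linarith
  qed
  then show "N (\<lambda>k. l k * a k) \<le> I * N a"
    unfolding integral_unique[OF F] integral_unique[OF has_integral_mult_left[OF h, of "N a"]]
    using N_nonneg[of "\<lambda>k. l k * a k"] by (simp only: norm_of_real abs_of_nonneg)
qed

end

section \<open>Inversion of a Laplace transform on a vertical line\<close>

text \<open>
  The inverse Laplace transform of $1/(z+k)^3$ is \<open>s\<^sup>2 exp (- k s) / 2\<close>. Cauchy's formula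
  for the second derivative evaluates the integral over the circle of radius \<open>R\<close> about \<open>\<sigma>\<close>. To the
  right of the line ${\rm Re}\, z = \sigma$ the integrand has a primitive, so that part of the
  circle may be replaced by the segment; the part to the left contributes the error, since there the
  exponential is bounded and the denominator has cubic growth.
\<close>

lemma laplace_inversion_error:
  fixes \<sigma> s k R :: real
  assumes "0 < \<sigma>" "0 < s" "0 \<le> k" "\<sigma> + k < R"
  defines "f \<equiv> \<lambda>z :: complex. exp (z * complex_of_real s) / (z + complex_of_real k) ^ 3"
  shows "(\<lambda>\<tau>. f (Complex \<sigma> \<tau>)) integrable_on {-R..R}"
    and "cmod (integral {-R..R} (\<lambda>\<tau>. f (Complex \<sigma> \<tau>)) - pi * s\<^sup>2 * exp (- k * s))
      \<le> pi * (R * (exp (\<sigma> * s) / (R - (\<sigma> + k)) ^ 3))"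
proof -
  have R: "0 < R" using assms by linarith
  define H where "H = {z :: complex. - k < Re z}"
  have H: "convex H" "open H"
    using convex_halfspace_Re_gt[of "-k"] open_halfspace_Re_gt[of "-k"] by (simp_all add: H_def)
  have "f holomorphic_on H"
    unfolding f_def H_def
    by (intro holomorphic_intros) (auto simp: add_eq_0_iff2)
  then obtain F where F: "\<And>z. z \<in> H \<Longrightarrow> (F has_field_derivative f z) (at z within H)"
    using holomorphic_convex_primitive'[OF H] by blast
  then have F': "(F has_field_derivative f z) (at z within A)" if "z \<in> H" for z A
    using that H(2) by (metis at_within_open has_field_derivative_at_within)
  define arc where "arc \<phi> = complex_of_real \<sigma> + R * cis \<phi>" for \<phi>
  define G where "G \<phi> = f (arc \<phi>) * R * \<i> * cis \<phi>" for \<phi>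
  have arc_deriv: "(arc has_vector_derivative R * \<i> * cis \<phi>) (at \<phi> within A)" for \<phi> A
    unfolding arc_def cis_conv_exp
    by (auto intro!: derivative_eq_intros has_vector_derivative_real_field simp: mult_ac)
  have right: "(G has_integral (F (arc b) - F (arc a))) {a..b}"
    if "a \<le> b" "\<And>\<phi>. a \<le> \<phi> \<Longrightarrow> \<phi> \<le> b \<Longrightarrow> 0 \<le> cos \<phi>" for a b
  proof (rule fundamental_theorem_of_calculus)
    fix \<phi> assume "\<phi> \<in> {a..b}"
    then have "0 \<le> R * cos \<phi>" using that R by simp
    then have "arc \<phi> \<in> H" using assms(1,3) by (simp add: H_def arc_def)
    then show "((\<lambda>\<phi>. F (arc \<phi>)) has_vector_derivative G \<phi>) (at \<phi> within {a..b})"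
      using field_vector_diff_chain_within[OF arc_deriv F', of \<phi> "{a..b}"]
      by (simp add: G_def o_def mult_ac)
  qed (use that in auto)
  have q1: "(G has_integral (F (arc (pi/2)) - F (arc 0))) {0..pi/2}"
    by (rule right) (auto intro: cos_ge_zero)
  have q3: "(G has_integral (F (arc (2*pi)) - F (arc (3*pi/2)))) {3*pi/2..2*pi}"
  proof (rule right)
    fix \<phi> :: real assume "3*pi/2 \<le> \<phi>" "\<phi> \<le> 2*pi"
    then show "0 \<le> cos \<phi>" using cos_ge_zero[of "2*pi - \<phi>"] by (simp add: cos_diff)
  qed auto
  \<comment> \<open>The primitive is used on the two right quarter circles, the Cauchy formula on the whole circle.\<close>
  have two_pi: "0 < 2 * pi" by simp
  have whole: "(G has_integral (pi * \<i> * s\<^sup>2 * exp (- k * s))) {0..2*pi}"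
  proof -
    have "((\<lambda>u. exp (u * s) / (u - (- complex_of_real k)) ^ Suc 2) has_contour_integral
        (2 * pi * \<i> / fact 2) * (deriv ^^ 2) (\<lambda>u. exp (u * s)) (- complex_of_real k)) (circlepath \<sigma> R)"
    proof (rule Cauchy_has_contour_integral_higher_derivative_circlepath)
      have "dist (complex_of_real \<sigma>) (- complex_of_real k) = \<bar>\<sigma> + k\<bar>"
        by (simp add: dist_norm flip: of_real_add)
      then show "- complex_of_real k \<in> ball (complex_of_real \<sigma>) R"
        using assms by (simp add: mem_ball)
    qed (auto intro!: continuous_intros holomorphic_intros)
    moreover have "(deriv ^^ 2) (\<lambda>u. exp (u * complex_of_real s)) = (\<lambda>u::complex. s\<^sup>2 * exp (u * s))"
    proof -
      have "deriv (\<lambda>u. exp (u * complex_of_real s)) = (\<lambda>u::complex. s * exp (u * s))"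
        by (rule ext, rule DERIV_imp_deriv) (auto intro!: derivative_eq_intros)
      moreover have "deriv (\<lambda>u. s * exp (u * complex_of_real s)) = (\<lambda>u::complex. s\<^sup>2 * exp (u * s))"
        by (rule ext, rule DERIV_imp_deriv)
          (auto intro!: derivative_eq_intros simp: power2_eq_square)
      ultimately show ?thesis by (simp add: numeral_2_eq_2)
    qed
    ultimately have "(f has_contour_integral (pi * \<i> * s\<^sup>2 * exp (- k * s)))
        (part_circlepath \<sigma> R 0 (2*pi))"
      by (simp add: f_def circlepath_def numeral_3_eq_3 numeral_2_eq_2 mult.assoc flip: exp_of_real)
    from this[unfolded has_contour_integral_part_circlepath_iff[OF two_pi]]
    show ?thesis unfolding G_def arc_def .
  qed
  have left_int: "G integrable_on {pi/2..3*pi/2}"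
    by (rule integrable_on_subinterval[OF has_integral_integrable[OF whole]]) auto
  have split: "integral {0..2*pi} G = integral {0..pi/2} G + integral {pi/2..3*pi/2} G + integral {3*pi/2..2*pi} G"
  proof -
    have 1: "G integrable_on {0..2*pi}" using whole by blast
    have "integral {0..pi/2} G + integral {pi/2..2*pi} G = integral {0..2*pi} G"
      by (rule Henstock_Kurzweil_Integration.integral_combine) (auto intro: 1)
    moreover have "integral {pi/2..3*pi/2} G + integral {3*pi/2..2*pi} G = integral {pi/2..2*pi} G"
      by (rule Henstock_Kurzweil_Integration.integral_combine)
        (auto intro!: integrable_on_subinterval[OF 1])
    ultimately show ?thesis by (simp add: add.assoc)
  qed
  have line: "((\<lambda>\<tau>. \<i> * f (Complex \<sigma> \<tau>)) has_integral (F (Complex \<sigma> R) - F (Complex \<sigma> (-R)))) {-R..R}"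
  proof (rule fundamental_theorem_of_calculus)
    fix \<tau> assume "\<tau> \<in> {-R..R}"
    have d: "(Complex \<sigma> has_vector_derivative \<i>) (at \<tau> within {-R..R})"
      unfolding Complex_eq[abs_def] by (auto intro!: derivative_eq_intros)
    have "Complex \<sigma> \<tau> \<in> H" using assms by (simp add: H_def)
    from field_vector_diff_chain_within[OF d F'[OF this]]
    show "((\<lambda>\<tau>. F (Complex \<sigma> \<tau>)) has_vector_derivative \<i> * f (Complex \<sigma> \<tau>)) (at \<tau> within {-R..R})"
      by (simp add: o_def)
  qed (use R in auto)
  have "3 * pi / 2 = 2 * pi - pi / 2" by simp
  then have "cos (3 * pi / 2) = 0" "sin (3 * pi / 2) = -1"
    by (simp_all only: cos_2pi_minus sin_2pi_minus) simp_all
  then have arc_vals: "arc (pi/2) = Complex \<sigma> R" "arc (3*pi/2) = Complex \<sigma> (-R)" "arc (2*pi) = arc 0"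
    by (simp_all add: arc_def complex_eq_iff cis.code[symmetric])
  from has_integral_mult_right[OF line, of "-\<i>"]
  have line': "((\<lambda>\<tau>. f (Complex \<sigma> \<tau>)) has_integral - \<i> * (F (Complex \<sigma> R) - F (Complex \<sigma> (-R)))) {-R..R}"
    by (simp flip: mult.assoc)
  then show "(\<lambda>\<tau>. f (Complex \<sigma> \<tau>)) integrable_on {-R..R}" by blast
  have "norm (integral (cbox (pi/2) (3*pi/2)) G) \<le> (R * (exp (\<sigma> * s) / (R - (\<sigma> + k)) ^ 3)) * measure lborel (cbox (pi/2) (3*pi/2))"
  proof (rule integrable_bound)
    fix \<phi> assume "\<phi> \<in> cbox (pi/2) (3*pi/2)"
    then have "0 \<le> cos (\<phi> - pi)" by (intro cos_ge_zero) auto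
    then have c: "cos \<phi> \<le> 0" by (simp add: cos_diff)
    have "Re (arc \<phi>) \<le> \<sigma>" using c R by (simp add: arc_def mult_nonneg_nonpos)
    then have e: "cmod (exp (arc \<phi> * s)) \<le> exp (\<sigma> * s)"
      using assms by (simp add: norm_exp_eq_Re)
    have "cmod (complex_of_real (- (\<sigma> + k))) = \<sigma> + k"
      using assms by (subst norm_of_real) simp
    then have "R - (\<sigma> + k) = cmod (R * cis \<phi>) - cmod (complex_of_real (- (\<sigma> + k)))"
      using R by (simp add: norm_mult del: of_real_minus of_real_add)
    also have "\<dots> \<le> cmod (R * cis \<phi> - complex_of_real (- (\<sigma> + k)))" by (rule norm_triangle_ineq2)
    also have "\<dots> = cmod (arc \<phi> + k)" by (simp add: arc_def algebra_simps)
    finally have "(R - (\<sigma> + k)) ^ 3 \<le> cmod (arc \<phi> + k) ^ 3" using assms by (intro power_mono) auto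
    then have "cmod (f (arc \<phi>)) \<le> exp (\<sigma> * s) / (R - (\<sigma> + k)) ^ 3"
      unfolding f_def norm_divide norm_power using e assms by (intro frac_le) auto
    from mult_left_mono[OF this, of R] R
    show "norm (G \<phi>) \<le> R * (exp (\<sigma> * s) / (R - (\<sigma> + k)) ^ 3)"
      by (simp add: G_def norm_mult mult.commute)
  qed (use left_int R assms in auto)
  then have left: "norm (integral {pi/2..3*pi/2} G) \<le> pi * (R * (exp (\<sigma> * s) / (R - (\<sigma> + k)) ^ 3))"
    by (simp add: mult.commute)
  have "integral {-R..R} (\<lambda>\<tau>. f (Complex \<sigma> \<tau>)) - pi * s\<^sup>2 * exp (- k * s)
      = \<i> * integral {pi/2..3*pi/2} G"
    using arg_cong[OF split, of "(*) \<i>"]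
    unfolding integral_unique[OF whole] integral_unique[OF q1] integral_unique[OF q3]
      integral_unique[OF line'] arc_vals
    by (simp add: algebra_simps)
  with left show "cmod (integral {-R..R} (\<lambda>\<tau>. f (Complex \<sigma> \<tau>)) - pi * s\<^sup>2 * exp (- k * s))
      \<le> pi * (R * (exp (\<sigma> * s) / (R - (\<sigma> + k)) ^ 3))"
    by (simp add: norm_mult)
qed

section \<open>Semigroups with a gap are analytic\<close>

text \<open>
  The constants of the successive estimates for a semigroup with $\|(I - T_t)^m\| \le \rho$:
  a bound for $(I + T_t)^{-1}$, for $|\lambda| \|(\lambda + \Delta)^{-1}\|$, for
  $s \|\Delta T_s\|$, and the slope of the sector of analyticity. That they depend on \<open>m\<close> and \<open>\<rho>\<close>
  only makes the final estimate uniform in the dimension.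
\<close>

definition gap_const :: "nat \<Rightarrow> real \<Rightarrow> real" where
  "gap_const m \<rho> = real m * 2 ^ (m - 1) / (2 ^ m - \<rho>)"

definition resolvent_const :: "nat \<Rightarrow> real \<Rightarrow> real" where
  "resolvent_const m \<rho> = 2 + 3 * pi * gap_const m \<rho>"

definition derivative_const :: "nat \<Rightarrow> real \<Rightarrow> real" where
  "derivative_const m \<rho> = exp 1 * (1 + resolvent_const m \<rho>) * (resolvent_const m \<rho>)\<^sup>2"

definition sector_slope :: "nat \<Rightarrow> real \<Rightarrow> real" where
  "sector_slope m \<rho> = 1 / (2 * exp 1 * derivative_const m \<rho>)"

lemma gap_const_nonneg: "\<rho> < 2 ^ m \<Longrightarrow> 0 \<le> gap_const m \<rho>"
  by (simp add: gap_const_def)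

lemma resolvent_const_pos: "\<rho> < 2 ^ m \<Longrightarrow> 0 < resolvent_const m \<rho>"
  using gap_const_nonneg[of \<rho> m] by (simp add: resolvent_const_def add_pos_nonneg)

lemma derivative_const_pos: "\<rho> < 2 ^ m \<Longrightarrow> 0 < derivative_const m \<rho>"
  using resolvent_const_pos[of \<rho> m] by (simp add: derivative_const_def)

lemma sector_slope_pos: "\<rho> < 2 ^ m \<Longrightarrow> 0 < sector_slope m \<rho>"
  using derivative_const_pos[of \<rho> m] by (simp add: sector_slope_def)

lemma right_half_plane_add_nat:
  assumes "0 \<le> Re \<mu>" "\<mu> \<noteq> 0"
  shows "\<mu> + of_nat k \<noteq> 0"
proof
  assume h: "\<mu> + of_nat k = 0"
  from arg_cong[OF h, of Re] assms(1) have "k = 0" by simp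
  with h assms(2) show False by simp
qed

text \<open>
  The multiplier \<open>exp (- t k)\<close> represents a contraction semigroup $T_t$ with generator $-\Delta$, where \<open>\<Delta>\<close> is
  multiplication by \<open>k\<close>. Contractivity alone gives \<open>\<rho> = 2 ^ m\<close>; the strict inequality is the
  hypothesis of Kato's theorem.
\<close>

locale gapped_semigroup = multiplier_seminorm +
  fixes m :: nat and \<rho> :: real
  assumes contractive: "\<And>t. 0 \<le> t \<Longrightarrow> mult_bound (\<lambda>k. exp (- complex_of_real (t * real k))) 1"
    and gap: "\<And>t. 0 \<le> t \<Longrightarrow> mult_bound (\<lambda>k. (1 - exp (- complex_of_real (t * real k))) ^ m) \<rho>"
    and \<rho>: "\<rho> < 2 ^ m"
begin

abbreviation "gapC \<equiv> gap_const m \<rho>"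
abbreviation "resC \<equiv> resolvent_const m \<rho>"
abbreviation "derC \<equiv> derivative_const m \<rho>"

text \<open>
  The gap bounds $2^m - (I - T_t)^m$ from below, and this operator is $I + T_t$ times a polynomial in
  $I - T_t$ whose norm is at most $m 2^{m-1}$.
\<close>

lemma one_plus_semigroup_bounded_below:
  assumes "0 \<le> t"
  shows "N a \<le> gapC * N (\<lambda>k. (1 + exp (- complex_of_real (t * real k))) * a k)"
proof -
  define q where "q k = exp (- complex_of_real (t * real k))" for k
  define b where "b k = (1 + q k) * a k" for k
  have q: "mult_bound (\<lambda>k. 1 - q k) 2"
    using mult_bound_add[OF mult_bound_const[of 1 1] mult_bound_scale[OF contractive[OF assms], of "-1"]]
    by (simp add: q_def)
  have fac: "2 ^ m - (1 - q k) ^ m = (\<Sum>i<m. (1 - q k) ^ (m - Suc i) * 2 ^ i) * (1 + q k)" for k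
    by (subst power_diff_sumr2) simp
  have "mult_bound (\<lambda>k. \<Sum>i<m. (1 - q k) ^ (m - Suc i) * 2 ^ i) (\<Sum>i<m. 2 ^ (m - Suc i) * 2 ^ i)"
    by (intro mult_bound_sum mult_bound_mult mult_bound_power q mult_bound_const)
      (auto simp: norm_power)
  also have "(\<Sum>i<m. 2 ^ (m - Suc i) * 2 ^ i) = (\<Sum>i<m. 2 ^ (m - 1) :: real)"
    by (intro sum.cong) (auto simp flip: power_add)
  finally have Q: "N (\<lambda>k. (\<Sum>i<m. (1 - q k) ^ (m - Suc i) * 2 ^ i) * b k) \<le> real m * 2 ^ (m - 1) * N b"
    using mult_boundD by fastforce
  have "2 ^ m * N a = N (\<lambda>k. 2 ^ m * a k)"
    by (simp add: homogeneous norm_power)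
  also have "\<dots> \<le> N (\<lambda>k. 2 ^ m * a k - (1 - q k) ^ m * a k) + N (\<lambda>k. (1 - q k) ^ m * a k)"
    using N_minus_ge[of "\<lambda>k. 2 ^ m * a k" "\<lambda>k. (1 - q k) ^ m * a k"] by simp
  also have "(\<lambda>k. 2 ^ m * a k - (1 - q k) ^ m * a k)
      = (\<lambda>k. (\<Sum>i<m. (1 - q k) ^ (m - Suc i) * 2 ^ i) * b k)"
    using fac by (simp add: b_def fun_eq_iff flip: mult.assoc left_diff_distrib)
  also have "N \<dots> + N (\<lambda>k. (1 - q k) ^ m * a k) \<le> real m * 2 ^ (m - 1) * N b + \<rho> * N a"
    using Q mult_boundD[OF gap[OF assms], of a] by (simp add: q_def)
  finally have "(2 ^ m - \<rho>) * N a \<le> real m * 2 ^ (m - 1) * N b" by (simp add: algebra_simps)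
  then have "N a \<le> gapC * N b" using \<rho> by (simp add: gap_const_def field_simps)
  then show ?thesis unfolding b_def q_def .
qed

text \<open>
  Apply Minkowski's inequality to
  $e^{\mu t} - T_t = (\mu + \Delta) \int_0^t e^{\mu (t - s)} T_s\, ds$. With $\mu$ on the imaginary axis and $t$ a
  half period it links the resolvent to $I + T_t$.
\<close>

lemma resolvent_volterra:
  fixes \<mu> :: complex
  assumes "\<mu> \<noteq> 0" "0 \<le> Re \<mu>" "0 \<le> t"
  shows "N (\<lambda>k. (exp (\<mu> * t) - exp (- complex_of_real (t * real k))) * a k)
    \<le> t * exp (Re \<mu> * t) * N (\<lambda>k. (\<mu> + k) * a k)"
proof -
  note nz = right_half_plane_add_nat[OF assms(2,1)]
  have "mult_bound (\<lambda>k. (exp (\<mu> * t) - exp (- complex_of_real (t * real k))) / (\<mu> + k))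
      (t * exp (Re \<mu> * t))"
  proof (rule mult_bound_integral)
    fix k :: nat
    define c where "c = \<mu> + complex_of_nat k"
    have c: "c \<noteq> 0" using nz by (simp add: c_def)
    define A where "A z = - exp (\<mu> * t - c * z) / c" for z
    have A: "(A has_field_derivative exp (\<mu> * t - c * z)) (at z within S)" for z S
      unfolding A_def using c by (auto intro!: derivative_eq_intros)
    have "((\<lambda>s. exp (\<mu> * t - c * complex_of_real s)) has_integral
        (A (complex_of_real t) - A (complex_of_real 0))) {0..t}"
      by (intro fundamental_theorem_of_calculus has_vector_derivative_real_field A assms(3))
    also have "(\<lambda>s. exp (\<mu> * t - c * complex_of_real s))
        = (\<lambda>s. exp (\<mu> * (t - s)) * exp (- complex_of_real (s * real k)))"
      by (simp add: fun_eq_iff c_def algebra_simps flip: exp_add)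
    also have "A (complex_of_real t) - A (complex_of_real 0)
        = (exp (\<mu> * t) - exp (\<mu> * t - c * t)) / c"
      by (simp add: A_def diff_divide_distrib)
    also have "\<mu> * t - c * t = - complex_of_real (t * real k)"
      by (simp add: c_def algebra_simps)
    finally show "((\<lambda>s. exp (\<mu> * (t - s)) * exp (- complex_of_real (s * real k))) has_integral
        (exp (\<mu> * t) - exp (- complex_of_real (t * real k))) / (\<mu> + k)) {0..t}"
      by (simp only: c_def)
  next
    fix s assume s: "s \<in> {0..t}"
    have "mult_bound (\<lambda>k. exp (\<mu> * (t - s)) * exp (- complex_of_real (s * real k))) (exp (Re \<mu> * t) * 1)"
    proof (intro mult_bound_mult mult_bound_const contractive)
      show "cmod (exp (\<mu> * (t - s))) \<le> exp (Re \<mu> * t)"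
        using s assms(2) by (auto simp: norm_exp_eq_Re intro!: mult_left_mono)
    qed (use s in auto)
    then show "mult_bound (\<lambda>k. exp (\<mu> * (t - s)) * exp (- complex_of_real (s * real k))) (exp (Re \<mu> * t))"
      by simp
  next
    show "((\<lambda>s. exp (Re \<mu> * t)) has_integral t * exp (Re \<mu> * t)) {0..t}"
      using has_integral_const_real[of "exp (Re \<mu> * t)" 0 t] assms(3) by simp
  qed
  from mult_boundD[OF this, of "\<lambda>k. (\<mu> + k) * a k"] show ?thesis using nz by simp
qed

text \<open>
  The Hille--Yosida estimate for contraction semigroups, up to the factor 2 that comes from using the
  finite time \<open>1 / Re \<mu>\<close> in place of a limit.
\<close>

lemma resolvent_right:
  fixes \<mu> :: complex
  assumes "0 < Re \<mu>"
  shows "Re \<mu> * N a \<le> 2 * N (\<lambda>k. (\<mu> + k) * a k)"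
proof -
  define \<sigma> where "\<sigma> = Re \<mu>"
  define t where "t = 1 / \<sigma>"
  define b where "b = N (\<lambda>k. (\<mu> + k) * a k)"
  have \<sigma>: "\<sigma> > 0" "\<sigma> * t = 1" "t > 0" using assms by (auto simp: \<sigma>_def t_def)
  have "\<mu> \<noteq> 0" using assms by auto
  have "exp 1 * N a = N (\<lambda>k. exp (\<mu> * t) * a k)"
    using \<sigma> by (simp add: homogeneous norm_exp_eq_Re \<sigma>_def)
  also have "\<dots> \<le> N (\<lambda>k. exp (\<mu> * t) * a k - exp (- complex_of_real (t * real k)) * a k)
      + N (\<lambda>k. exp (- complex_of_real (t * real k)) * a k)"
    using N_minus_ge[of "\<lambda>k. exp (\<mu> * t) * a k" "\<lambda>k. exp (- complex_of_real (t * real k)) * a k"] by simp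
  also have "\<dots> \<le> t * exp 1 * b + 1 * N a"
    using resolvent_volterra[OF \<open>\<mu> \<noteq> 0\<close>, of t a] \<sigma> mult_boundD[OF contractive, of t a]
    by (intro add_mono) (auto simp: left_diff_distrib \<sigma>_def b_def)
  finally have *: "(exp 1 - 1) * N a \<le> t * exp 1 * b" by (simp add: algebra_simps)
  define E where "E = exp (1 :: real)"
  have E: "2 \<le> E" using exp_ge_add_one_self[of "1 :: real"] by (simp add: E_def)
  have "(E / 2) * N a \<le> (E - 1) * N a" using E by (intro mult_right_mono N_nonneg) auto
  also have "\<dots> \<le> t * E * b" using * by (simp add: E_def)
  finally have "N a \<le> 2 * t * b" using E by (simp add: field_simps)
  then have "\<sigma> * N a \<le> \<sigma> * (2 * t * b)" using \<sigma> by (intro mult_left_mono) auto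
  also have "\<dots> = 2 * b" using \<sigma>(2) by (simp add: algebra_simps)
  finally show ?thesis by (simp add: \<sigma>_def b_def)
qed

lemma resolvent_imaginary:
  assumes "\<tau> \<noteq> 0"
  shows "\<bar>\<tau>\<bar> * N a \<le> pi * gapC * N (\<lambda>k. (\<i> * \<tau> + k) * a k)"
proof -
  \<comment> \<open>A half period, so that \<open>exp (\<i> * \<tau> * t) = -1\<close>.\<close>
  define t where "t = pi / \<bar>\<tau>\<bar>"
  have t: "t > 0" using assms by (simp add: t_def)
  have e: "exp (\<i> * \<tau> * t) = -1"
  proof (cases "\<tau> > 0")
    case True
    then have "\<i> * \<tau> * t = \<i> * pi" by (simp add: t_def)
    then show ?thesis by (simp only: exp_pi_i')
  next
    case False
    then have "\<i> * \<tau> * t = - (\<i> * pi)" using assms by (simp add: t_def)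
    then show ?thesis by (simp only: exp_minus exp_pi_i') simp
  qed
  have "N a \<le> gapC * N (\<lambda>k. (1 + exp (- complex_of_real (t * real k))) * a k)"
    using t by (intro one_plus_semigroup_bounded_below) simp
  also have "N (\<lambda>k. (1 + exp (- complex_of_real (t * real k))) * a k)
      = N (\<lambda>k. (exp (\<i> * \<tau> * t) - exp (- complex_of_real (t * real k))) * a k)"
    using N_uminus[of "\<lambda>k. (1 + exp (- complex_of_real (t * real k))) * a k"]
    by (simp only: e) (simp add: algebra_simps)
  also have "\<dots> \<le> t * N (\<lambda>k. (\<i> * \<tau> + k) * a k)"
    using resolvent_volterra[of "\<i> * \<tau>" t a] assms t by simp
  finally have "N a \<le> gapC * (t * N (\<lambda>k. (\<i> * \<tau> + k) * a k))"
    using gap_const_nonneg[OF \<rho>] by (simp add: mult_left_mono)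
  then have "\<bar>\<tau>\<bar> * N a \<le> \<bar>\<tau>\<bar> * (gapC * (t * N (\<lambda>k. (\<i> * \<tau> + k) * a k)))"
    by (intro mult_left_mono) auto
  also have "\<dots> = (\<bar>\<tau>\<bar> * t) * gapC * N (\<lambda>k. (\<i> * \<tau> + k) * a k)" by simp
  also have "\<bar>\<tau>\<bar> * t = pi" using assms by (simp add: t_def)
  finally show ?thesis .
qed

text \<open>
  The two preceding estimates control the real and the imaginary part of \<open>\<mu>\<close>; the second one is moved off
  the imaginary axis at the cost of a term that the first one absorbs.
\<close>

lemma resolvent_half_plane:
  fixes \<mu> :: complex
  assumes "0 < Re \<mu>"
  shows "cmod \<mu> * N a \<le> resC * N (\<lambda>k. (\<mu> + k) * a k)"
proof -
  define b where "b = N (\<lambda>k. (\<mu> + k) * a k)"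
  have R: "Re \<mu> * N a \<le> 2 * b" unfolding b_def by (rule resolvent_right) fact
  have b0: "b \<ge> 0" by (simp add: b_def N_nonneg)
  have "\<bar>Im \<mu>\<bar> * N a \<le> pi * gapC * (3 * b)"
  proof (cases "Im \<mu> = 0")
    case False
    have "\<bar>Im \<mu>\<bar> * N a \<le> pi * gapC * N (\<lambda>k. (\<i> * Im \<mu> + k) * a k)"
      by (rule resolvent_imaginary) fact
    also have "N (\<lambda>k. (\<i> * Im \<mu> + k) * a k) \<le> b + Re \<mu> * N a"
    proof -
      have "(\<lambda>k. (\<i> * Im \<mu> + k) * a k) = (\<lambda>k. (\<mu> + k) * a k + (- complex_of_real (Re \<mu>)) * a k)"
        by (auto simp: fun_eq_iff complex_eq_iff algebra_simps)
      then show ?thesis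
        using subadditive[of "\<lambda>k. (\<mu> + k) * a k" "\<lambda>k. (- complex_of_real (Re \<mu>)) * a k"] assms
        by (simp add: b_def homogeneous[of "complex_of_real (Re \<mu>)"] N_uminus)
    qed
    also have "b + Re \<mu> * N a \<le> 3 * b" using R by simp
    finally show ?thesis using gap_const_nonneg[OF \<rho>] by (simp add: mult_left_mono)
  qed (use b0 gap_const_nonneg[OF \<rho>] in simp)
  moreover have "cmod \<mu> * N a \<le> (Re \<mu> + \<bar>Im \<mu>\<bar>) * N a"
    using cmod_le[of \<mu>] assms by (intro mult_right_mono N_nonneg) auto
  ultimately show ?thesis using R by (simp add: resolvent_const_def b_def algebra_simps)
qed

lemma mult_bound_resolvent:
  fixes \<mu> :: complex
  assumes "0 < Re \<mu>"
  shows "mult_bound (\<lambda>k. 1 / (\<mu> + k)) (resC / cmod \<mu>)"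
proof (rule mult_bound_divide)
  have "\<mu> \<noteq> 0" using assms by auto
  then show "N a \<le> resC / cmod \<mu> * N (\<lambda>k. (\<mu> + k) * a k)" for a
    using resolvent_half_plane[OF assms, of a] by (simp add: field_simps)
  show "\<mu> + of_nat k \<noteq> 0" for k
    using right_half_plane_add_nat[of \<mu> k] assms by force
qed

text \<open>
  In $\Delta (\mu + \Delta)^{-3}$ one resolvent factor is spent on \<open>\<Delta>\<close>, by
  $\Delta (\mu + \Delta)^{-1} = 1 - \mu (\mu + \Delta)^{-1}$. The remaining decay
  $|\mu|^{-2}$ is integrable along a vertical line.
\<close>

lemma mult_bound_cubed_resolvent:
  fixes \<mu> :: complex
  assumes "0 < Re \<mu>"
  shows "mult_bound (\<lambda>k. k / (\<mu> + k) ^ 3) ((1 + resC) * resC\<^sup>2 / (cmod \<mu>)\<^sup>2)"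
proof -
  have nz: "\<mu> + of_nat k \<noteq> 0" for k
    using right_half_plane_add_nat[of \<mu> k] assms by force
  have "\<mu> \<noteq> 0" using assms by auto
  note r = resolvent_const_pos[OF \<rho>]
  have "mult_bound (\<lambda>k. (1 + (- \<mu>) * (1 / (\<mu> + k))) * ((1 / (\<mu> + k)) ^ 2))
      ((1 + cmod (- \<mu>) * (resC / cmod \<mu>)) * (resC / cmod \<mu>) ^ 2)"
    using r by (intro mult_bound_mult mult_bound_add mult_bound_scale mult_bound_power mult_bound_resolvent assms mult_bound_const)
       auto
  also have "(\<lambda>k. (1 + (- \<mu>) * (1 / (\<mu> + k))) * ((1 / (\<mu> + k)) ^ 2)) = (\<lambda>k :: nat. k / (\<mu> + k) ^ 3)"
  proof
    fix k :: nat
    show "(1 + (- \<mu>) * (1 / (\<mu> + k))) * ((1 / (\<mu> + k)) ^ 2) = k / (\<mu> + k) ^ 3"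
      using nz[of k] by (simp add: divide_simps power2_eq_square power3_eq_cube)
  qed
  finally show ?thesis using \<open>\<mu> \<noteq> 0\<close> by (simp add: power_divide)
qed

text \<open>
  The bound $\|\Delta T_s\| \le C/s$ that characterizes analytic semigroups. It is obtained by
  integrating $e^{\lambda s} \Delta (\lambda + \Delta)^{-3}$ over the line ${\rm Re}\, \lambda = 1/s$; the choice of the line balances the
  exponential against the integral of $|\lambda|^{-2}$.
\<close>

lemma mult_bound_generator:
  assumes s: "0 < s"
  shows "mult_bound (\<lambda>k. k * exp (- complex_of_real (s * real k))) (derC / s)"
proof -
  define \<sigma> where "\<sigma> = 1 / s"
  have \<sigma>: "\<sigma> > 0" "\<sigma> * s = 1" using s by (auto simp: \<sigma>_def)
  define B where "B = exp 1 * ((1 + resC) * resC\<^sup>2)"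
  have B: "B > 0" using resolvent_const_pos[OF \<rho>] by (simp add: B_def)
  define J where "J R k = integral {-R..R} (\<lambda>\<tau>. exp (Complex \<sigma> \<tau> * s) / (Complex \<sigma> \<tau> + complex_of_real (real k)) ^ 3)" for R k
  \<comment> \<open>Radii that admit all the poles \<open>- k\<close>, \<open>k \<le> n\<close>, at once.\<close>
  define r where "r i = \<sigma> + real n + real (Suc i)" for i
  have r: "\<sigma> + real k < r i" "0 < r i" if "k \<le> n" for i k using that \<sigma> by (auto simp: r_def)
  have "mult_bound (\<lambda>k. pi * s\<^sup>2 * (k * exp (- complex_of_real (s * real k)))) (B * pi * s)"
  proof (rule mult_bound_limit)
    fix k assume k: "k \<le> n"
    have E: "complex_of_real (exp (- (real k * s))) = exp (- complex_of_real (s * real k))"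
      by (subst exp_of_real[symmetric]) (simp add: mult.commute)
    have "(\<lambda>i. J (r i) k) \<longlonglongrightarrow> pi * s\<^sup>2 * exp (- (real k * s))"
    proof (subst LIM_zero_iff[symmetric], rule Lim_null_comparison)
      show "\<forall>\<^sub>F i in sequentially. cmod (J (r i) k - pi * s\<^sup>2 * exp (- (real k * s)))
          \<le> pi * (r i * (exp (\<sigma> * s) / (r i - (\<sigma> + real k)) ^ 3))"
        using laplace_inversion_error(2)[OF \<sigma>(1) s _ r(1)[OF k]] by (simp add: J_def)
      have "((\<lambda>x. pi * (x * (exp (\<sigma> * s) / (x - (\<sigma> + real k)) ^ 3))) \<longlongrightarrow> 0) at_top"
        by real_asymp
      moreover have "filterlim r at_top sequentially" unfolding r_def by real_asymp
      ultimately show "(\<lambda>i. pi * (r i * (exp (\<sigma> * s) / (r i - (\<sigma> + real k)) ^ 3))) \<longlonglongrightarrow> 0"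
        by (rule filterlim_compose)
    qed
    also have "complex_of_real (pi * s\<^sup>2 * exp (- (real k * s)))
        = pi * s\<^sup>2 * exp (- complex_of_real (s * real k))"
      by (simp only: of_real_mult of_real_power E)
    finally have "(\<lambda>i. J (r i) k) \<longlonglongrightarrow> pi * s\<^sup>2 * exp (- complex_of_real (s * real k))" .
    from tendsto_mult_left[OF this, of "of_nat k"]
    show "(\<lambda>i. of_nat k * J (r i) k) \<longlonglongrightarrow> pi * s\<^sup>2 * (k * exp (- complex_of_real (s * real k)))"
      by (simp add: mult_ac)
  next
    fix i
    have "mult_bound (\<lambda>k. of_nat k * J (r i) k) (B / \<sigma> * arctan (r i / \<sigma>) - B / \<sigma> * arctan (- r i / \<sigma>))"
    proof (rule mult_bound_integral)
      fix k assume k: "k \<le> n"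
      show "((\<lambda>\<tau>. of_nat k * (exp (Complex \<sigma> \<tau> * s) / (Complex \<sigma> \<tau> + complex_of_real (real k)) ^ 3))
          has_integral of_nat k * J (r i) k) {- r i..r i}"
        unfolding J_def using laplace_inversion_error(1)[OF \<sigma>(1) s _ r(1)[OF k]]
        by (intro has_integral_mult_right integrable_integral) simp
    next
      fix \<tau> assume "\<tau> \<in> {- r i..r i}"
      have "mult_bound (\<lambda>k. exp (Complex \<sigma> \<tau> * s) * (k / (Complex \<sigma> \<tau> + k) ^ 3))
          (cmod (exp (Complex \<sigma> \<tau> * s)) * ((1 + resC) * resC\<^sup>2 / (cmod (Complex \<sigma> \<tau>))\<^sup>2))"
        using \<sigma> by (intro mult_bound_scale mult_bound_cubed_resolvent) simp
      then show "mult_bound (\<lambda>k. of_nat k * (exp (Complex \<sigma> \<tau> * s) / (Complex \<sigma> \<tau> + complex_of_real (real k)) ^ 3))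
          (B / (\<sigma>\<^sup>2 + \<tau>\<^sup>2))"
        using \<sigma> by (simp add: norm_exp_eq_Re cmod_power2 B_def mult_ac)
    next
      show "((\<lambda>\<tau>. B / (\<sigma>\<^sup>2 + \<tau>\<^sup>2)) has_integral
          B / \<sigma> * arctan (r i / \<sigma>) - B / \<sigma> * arctan (- r i / \<sigma>)) {- r i..r i}"
      proof (rule fundamental_theorem_of_calculus)
        fix \<tau>
        have "\<sigma>\<^sup>2 + \<tau>\<^sup>2 \<noteq> 0" "\<sigma> \<noteq> 0" using \<sigma> by (auto simp: sum_power2_eq_zero_iff)
        then have "((\<lambda>\<tau>. B / \<sigma> * arctan (\<tau> / \<sigma>)) has_real_derivative B / (\<sigma>\<^sup>2 + \<tau>\<^sup>2)) (at \<tau> within {- r i..r i})"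
          by (auto intro!: derivative_eq_intros simp: divide_simps power2_eq_square)
        then show "((\<lambda>\<tau>. B / \<sigma> * arctan (\<tau> / \<sigma>)) has_vector_derivative B / (\<sigma>\<^sup>2 + \<tau>\<^sup>2)) (at \<tau> within {- r i..r i})"
          by (simp add: has_real_derivative_iff_has_vector_derivative)
      qed (use r(2)[of 0 i] in simp)
    qed
    moreover have "B / \<sigma> * arctan (r i / \<sigma>) - B / \<sigma> * arctan (- r i / \<sigma>) \<le> B * pi * s"
    proof -
      have "B / \<sigma> * arctan (r i / \<sigma>) - B / \<sigma> * arctan (- r i / \<sigma>) = (B * s) * (2 * arctan (r i / \<sigma>))"
        by (simp add: arctan_minus \<sigma>_def)
      also have "\<dots> \<le> (B * s) * pi"
        using B s arctan_ubound[of "r i / \<sigma>"] by (intro mult_left_mono) auto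
      finally show ?thesis by (simp add: mult_ac)
    qed
    ultimately show "mult_bound (\<lambda>k. of_nat k * J (r i) k) (B * pi * s)" by (rule mult_bound_mono)
  qed
  from mult_bound_scale[OF this, of "1 / (pi * s\<^sup>2)"] show ?thesis
    using s by (simp add: norm_divide norm_mult norm_power B_def derivative_const_def power2_eq_square mult_ac)
qed

lemma mult_bound_generator_power:
  assumes s: "0 < s"
  shows "mult_bound (\<lambda>k. k ^ j * exp (- complex_of_real (s * real k))) ((derC * real j / s) ^ j)"
proof (cases "j = 0")
  case True
  then show ?thesis using contractive[of s] s by simp
next
  case False
  \<comment> \<open>The semigroup law splits $T_s$ into \<open>j\<close> equal factors, one for each power of the generator.\<close>
  have "mult_bound (\<lambda>k. (k * exp (- complex_of_real (s / j * real k))) ^ j) ((derC / (s / j)) ^ j)"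
    using s False derivative_const_pos[OF \<rho>] by (intro mult_bound_power mult_bound_generator) auto
  moreover have "(k * exp (- complex_of_real (s / j * real k))) ^ j = k ^ j * exp (- complex_of_real (s * real k))" for k :: nat
    using False by (simp add: power_mult_distrib flip: exp_of_nat_mult)
  ultimately show ?thesis by simp
qed

text \<open>
  Taylor's formula in the imaginary direction. By the preceding bound the $j$-th term is at most
  $(|y| C j / x)^j / j! \le (e C |y| / x)^j$, and the slope of the sector is such that this is at most $2^{-j}$.
\<close>

lemma mult_bound_sector:
  assumes "\<bar>Im z\<bar> \<le> sector_slope m \<rho> * Re z"
  shows "mult_bound (\<lambda>k. exp (- z * k)) 2"
proof (cases "Re z = 0")
  case True
  with assms have "z = 0" by (auto simp: complex_eq_iff)
  then show ?thesis using mult_bound_const[of 1 2] by simp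
next
  case False
  define x y where "x = Re z" and "y = Im z"
  note D = derivative_const_pos[OF \<rho>]
  have x: "x > 0"
    using assms False sector_slope_pos[OF \<rho>] by (smt (verit) mult_neg_pos mult.commute x_def)
  have "\<bar>y\<bar> * (2 * exp 1 * derC) \<le> x"
    using assms D by (simp add: sector_slope_def x_def y_def field_simps)
  then have y: "\<bar>y\<bar> * (exp 1 * derC) / x \<le> 1 / 2" using x by (simp add: field_simps)
  define u where "u = - \<i> * complex_of_real y"
  define T where "T J k = (\<Sum>j<J. (u ^ j / fact j) * (k ^ j * exp (- complex_of_real (x * real k))))" for J and k :: nat
  show ?thesis
  proof (rule mult_bound_limit)
    fix k
    have "(\<lambda>j. ((u * k) ^ j /\<^sub>R fact j) * exp (- complex_of_real (x * real k))) sums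
        (exp (u * k) * exp (- complex_of_real (x * real k)))"
      by (intro sums_mult2 exp_converges)
    also have "exp (u * k) * exp (- complex_of_real (x * real k)) = exp (- z * k)"
      unfolding exp_add[symmetric] by (rule arg_cong[of _ _ exp]) (simp add: complex_eq_iff x_def y_def u_def)
    also have "(\<lambda>j. ((u * k) ^ j /\<^sub>R fact j) * exp (- complex_of_real (x * real k)))
        = (\<lambda>j. (u ^ j / fact j) * (k ^ j * exp (- complex_of_real (x * real k))))"
      by (simp add: fun_eq_iff power_mult_distrib scaleR_conv_of_real divide_inverse mult_ac)
    finally show "(\<lambda>J. T J k) \<longlonglongrightarrow> exp (- z * k)" by (simp add: sums_def T_def)
  next
    fix J
    have "mult_bound (T J) (\<Sum>j<J. cmod (u ^ j / fact j) * (derC * real j / x) ^ j)"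
      unfolding T_def by (intro mult_bound_sum mult_bound_scale mult_bound_generator_power x)
    moreover have "(\<Sum>j<J. cmod (u ^ j / fact j) * (derC * real j / x) ^ j) \<le> 2"
    proof -
      have "cmod (u ^ j / fact j) * (derC * real j / x) ^ j \<le> (1 / 2) ^ j" for j
      proof -
        have "cmod (u ^ j / fact j) * (derC * real j / x) ^ j
            = (\<bar>y\<bar> * derC / x) ^ j * (real j ^ j / fact j)"
          by (simp add: u_def norm_divide norm_power norm_mult power_mult_distrib power_divide mult_ac)
        also have "\<dots> \<le> (\<bar>y\<bar> * derC / x) ^ j * exp (real j)"
          using D x by (intro mult_left_mono power_div_fact_le_exp) auto
        also have "\<dots> = (\<bar>y\<bar> * (exp 1 * derC) / x) ^ j"
          using exp_of_nat_mult[of j "1::real"] by (simp add: power_mult_distrib power_divide mult_ac)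
        also have "\<dots> \<le> (1 / 2) ^ j" using y D x by (intro power_mono) auto
        finally show ?thesis .
      qed
      then have "(\<Sum>j<J. cmod (u ^ j / fact j) * (derC * real j / x) ^ j) \<le> (\<Sum>j<J. (1 / 2) ^ j)"
        by (rule sum_mono)
      also have "\<dots> \<le> (\<Sum>j. (1 / 2 :: real) ^ j)" by (rule sum_le_suminf) (auto simp: summable_geometric)
      also have "\<dots> = 2" by (simp add: suminf_geometric)
      finally show ?thesis .
    qed
    ultimately show "mult_bound (T J) 2" by (rule mult_bound_mono)
  qed
qed

end

section \<open>Growth of polynomials bounded on the image of a sector\<close>

text \<open>
  The image of a sector under $u \mapsto 1/(1+u)$ is a lens with vertices 0 and 1. This lemma places the lens, up to the vertex 0,
  inside the image of the same sector under $z \mapsto e^{-z}$.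
\<close>

lemma Ln_one_plus_in_sector:
  assumes "\<bar>Im u\<bar> \<le> \<gamma> * Re u" "0 < Re u" "0 < \<gamma>"
  shows "\<bar>Im (Ln (1 + u))\<bar> \<le> \<gamma> * Re (Ln (1 + u))"
proof -
  have re: "0 < Re (1 + u)" using assms by simp
  then have nz: "1 + u \<noteq> 0" by (metis less_irrefl zero_complex.sel(1))
  have "Im (Ln (1 + u)) = arctan (Im (1 + u) / Re (1 + u))"
    using Im_Ln_eq[OF nz] re by (simp add: Im_Ln_eq)
  then have "\<bar>Im (Ln (1 + u))\<bar> = arctan \<bar>Im u / (1 + Re u)\<bar>"
    by (simp add: abs_if arctan_minus)
  also have "\<dots> \<le> \<bar>Im u\<bar> / (1 + Re u)"
    using arctan_le_self[of "\<bar>Im u / (1 + Re u)\<bar>"] assms by (simp add: abs_divide)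
  also have "\<dots> \<le> \<gamma> * (Re u / (1 + Re u))"
    using assms by (simp add: divide_right_mono)
  also have "\<dots> \<le> \<gamma> * ln (1 + Re u)"
  proof -
    have "ln (1 / (1 + Re u)) \<le> 1 / (1 + Re u) - 1"
      using assms by (intro ln_le_minus_one) simp
    then have "Re u / (1 + Re u) \<le> ln (1 + Re u)"
      using assms by (simp add: ln_div field_simps)
    then show ?thesis using mult_left_mono[OF _ less_imp_le[OF assms(3)]] by blast
  qed
  also have "\<dots> \<le> \<gamma> * ln (cmod (1 + u))"
    using assms complex_Re_le_cmod[of "1 + u"] by (intro mult_left_mono ln_mono) auto
  finally show ?thesis using nz by (simp add: Re_Ln)
qed

text \<open>
  A Bernstein--Walsh inequality with an explicit conformal map. For \<open>v\<close> in the right half-plane put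
  \<open>\<omega> = v powr \<beta>\<close> with \<open>\<beta> = 2 (\<pi> - \<theta>) / \<pi>\<close> and $w = \omega/(\omega - 1)$. Then \<open>v\<close> runs over the
  exterior of the lens of half-angle \<open>\<theta>\<close>, with $w = \infty$ at \<open>v = 1\<close>, and the imaginary axis is
  mapped to the boundary of the lens, where $|P| \le M$. The pole of order \<open>d\<close> of $P(w)$ at \<open>v = 1\<close> is
  cancelled by $((v - 1)/(v + 1))^d$, which has modulus 1 on the imaginary axis. The
  maximum principle bounds the product by \<open>M\<close>, and the value at $w = e^t$, that is at
  \<open>v = 1/q\<close>, is the assertion.
\<close>

lemma polynomial_growth_from_sector:
  fixes a :: "nat \<Rightarrow> complex" and d :: nat and M \<gamma> t :: real
  assumes \<gamma>: "0 < \<gamma>" and t: "0 < t"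
    and bound: "\<And>z. \<bar>Im z\<bar> \<le> \<gamma> * Re z \<Longrightarrow> cmod (\<Sum>k\<le>d. a k * exp (- z * k)) \<le> M"
  defines "q \<equiv> (1 - exp (- t)) powr (pi / (2 * (pi - arctan \<gamma>)))"
  shows "cmod (\<Sum>k\<le>d. a k * exp (complex_of_real t * k)) \<le> M * ((1 + q) / (1 - q)) ^ d"
proof -
  define P where "P w = (\<Sum>k\<le>d. a k * w ^ k)" for w
  have P_sector: "cmod (P (1 / (1 + u))) \<le> M" if "\<bar>Im u\<bar> \<le> \<gamma> * Re u" for u
  proof (cases "u = 0")
    case True
    then show ?thesis using bound[of 0] by (simp add: P_def)
  next
    case False
    have "Re u > 0"
      using that False \<gamma> by (smt (verit) complex_eq_iff mult_nonneg_nonpos zero_complex.sel mult_pos_neg)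
    then have "1 + u \<noteq> 0" by (auto simp: complex_eq_iff)
    then have "exp (- Ln (1 + u) * k) = (1 / (1 + u)) ^ k" for k :: nat
      by (simp add: exp_minus exp_of_nat2_mult divide_inverse power_inverse)
    then show ?thesis
      using bound[OF Ln_one_plus_in_sector[OF that \<open>Re u > 0\<close> \<gamma>]] by (simp add: P_def)
  qed
  have P_cont: "isCont P w" for w unfolding P_def by (intro continuous_intros)
  have P0: "cmod (P 0) \<le> M"
  proof -
    have "(\<lambda>n. P (1 / (1 + of_nat n))) \<longlonglongrightarrow> P 0"
      by (intro isCont_tendsto_compose[OF P_cont] lim_inverse_n'[THEN LIMSEQ_Suc, simplified])
        (use lim_inverse_n[THEN LIMSEQ_Suc] in \<open>simp add: divide_inverse add.commute\<close>)
    then have "(\<lambda>n. cmod (P (1 / (1 + of_nat n)))) \<longlonglongrightarrow> cmod (P 0)" by (rule tendsto_norm)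
    then show ?thesis
      by (rule LIMSEQ_le_const2) (use \<gamma> in \<open>auto intro!: exI[of _ 0] P_sector\<close>)
  qed
  have P1: "cmod (P 1) \<le> M" using P_sector[of 0] by simp

  \<comment> \<open>The half-angle of the lens; \<open>\<beta>\<close> opens the half-plane to the sector \<open>|arg \<omega>| < \<pi> - \<theta>\<close>, whose image under $w$ is the exterior of the lens.\<close>
  define \<theta> where "\<theta> = arctan \<gamma>"
  have \<theta>: "0 < \<theta>" "\<theta> < pi / 2" using \<gamma> arctan_ubound[of \<gamma>] by (auto simp: \<theta>_def)
  have tan_\<theta>: "sin \<theta> = \<gamma> * cos \<theta>" "cos \<theta> > 0"
    using tan_arctan[of \<gamma>] \<theta> cos_gt_zero[OF \<theta>] by (auto simp: \<theta>_def tan_def field_simps)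
  define \<beta> where "\<beta> = 2 * (pi - \<theta>) / pi"
  have \<beta>: "1 < \<beta>" "\<beta> < 2" using \<theta> by (auto simp: \<beta>_def field_simps)
  have \<beta>_pi: "\<beta> * (pi / 2) = pi - \<theta>" by (simp add: \<beta>_def)
  define \<omega> where "\<omega> v = v powr complex_of_real \<beta>" for v
  have \<omega>_1 [simp]: "\<omega> 1 = 1" and \<omega>_0 [simp]: "\<omega> 0 = 0" by (simp_all add: \<omega>_def)
  have \<omega>_norm: "cmod (\<omega> v) = cmod v powr \<beta>" for v
    by (simp add: \<omega>_def norm_powr_real_powr')
  have \<omega>_eq_1: "v = 1" if "\<omega> v = 1" "0 \<le> Re v" for v
  proof -
    have v: "v \<noteq> 0" using that by auto
    have "\<bar>Im (Ln v)\<bar> \<le> pi / 2" using Re_Ln_pos_le[OF v] that by blast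
    then have "\<bar>\<beta> * Im (Ln v)\<bar> \<le> \<beta> * (pi / 2)" using \<beta> by (simp add: abs_mult)
    then have "\<bar>Im (complex_of_real \<beta> * Ln v)\<bar> < pi" using \<theta> \<beta>_pi by simp
    then have "Ln (exp (complex_of_real \<beta> * Ln v)) = complex_of_real \<beta> * Ln v"
      by (intro Ln_exp) auto
    moreover have "exp (complex_of_real \<beta> * Ln v) = 1"
      using that v by (simp add: \<omega>_def powr_def)
    ultimately have "Ln v = 0" using \<beta> by simp
    then show ?thesis using v by (metis exp_Ln exp_zero)
  qed
  define S where "S = {v. 0 < Re v}"
  have S: "open S" "1 \<in> S" by (simp_all add: S_def open_halfspace_Re_gt)
  have \<omega>_holo: "\<omega> holomorphic_on S"
    unfolding \<omega>_def S_def by (intro holomorphic_intros) (auto simp: complex_nonpos_Reals_iff)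
  have \<omega>_cont: "continuous_on {v. 0 \<le> Re v} \<omega>"
    unfolding \<omega>_def using \<beta> by (intro continuous_intros) auto
  have \<omega>_deriv: "deriv \<omega> 1 = \<beta>"
    unfolding \<omega>_def by (rule DERIV_imp_deriv) (auto intro!: derivative_eq_intros simp: complex_nonpos_Reals_iff)
  \<comment> \<open>Both $w$ and the compensating factor degenerate at \<open>v = 1\<close>; splitting off the difference quotient \<open>D\<close> of \<open>\<omega>\<close> makes the regularity of the product visible.\<close>
  define D where "D v = (if v = 1 then deriv \<omega> 1 else (\<omega> v - \<omega> 1) / (v - 1))" for v
  have D_holo: "D holomorphic_on S"
    unfolding D_def[abs_def] by (rule pole_lemma_open[OF \<omega>_holo S(1)])
  have D_nz: "D v \<noteq> 0" if "0 \<le> Re v" for v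
    using \<omega>_eq_1[OF _ that] \<beta> by (auto simp: D_def \<omega>_deriv)
  define Q where "Q w = (\<Sum>k\<le>d. a k * (w ^ k * (w - 1) ^ (d - k)))" for w
  define H where "H v = Q (\<omega> v) * (1 / ((v + 1) * D v)) ^ d" for v
  have H_eq: "H v = P (\<omega> v / (\<omega> v - 1)) * ((v - 1) / (v + 1)) ^ d" if "v \<noteq> 1" "0 \<le> Re v" for v
  proof -
    have nz: "\<omega> v - 1 \<noteq> 0" using \<omega>_eq_1 that by auto
    have "Q (\<omega> v) = P (\<omega> v / (\<omega> v - 1)) * (\<omega> v - 1) ^ d"
      unfolding Q_def P_def sum_distrib_right
      using nz by (intro sum.cong) (auto simp: power_divide field_simps simp flip: power_add)
    then show ?thesis
      using that nz by (simp add: H_def D_def power_divide power_mult_distrib)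
  qed
  have plus_nz: "v + 1 \<noteq> 0" if "0 \<le> Re v" for v :: complex
    using that by (auto simp: complex_eq_iff)
  have H_holo: "H holomorphic_on S"
    unfolding H_def Q_def using D_nz plus_nz
    by (intro holomorphic_intros \<omega>_holo D_holo) (auto simp: S_def)
  have H_cont: "continuous_on {v. 0 \<le> Re v} H"
  proof -
    have "continuous (at v within {v. 0 \<le> Re v}) D" if v: "0 \<le> Re v" for v
    proof (cases "v = 1")
      case True
      then have "isCont D v"
        using D_holo S by (meson continuous_on_eq_continuous_at holomorphic_on_imp_continuous_on)
      then show ?thesis by (rule continuous_at_imp_continuous_at_within)
    next
      case False
      have "continuous (at v within {v. 0 \<le> Re v}) (\<lambda>v. (\<omega> v - \<omega> 1) / (v - 1))"
        using \<omega>_cont v False by (intro continuous_intros) (auto simp: continuous_on_eq_continuous_within)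
      then show ?thesis
        by (rule continuous_transform_within[where \<delta> = "dist v 1"])
          (use v False in \<open>auto simp: D_def dist_commute\<close>)
    qed
    then have "continuous_on {v. 0 \<le> Re v} D" by (simp add: continuous_on_eq_continuous_within)
    then show ?thesis
      unfolding H_def Q_def using D_nz plus_nz by (intro continuous_intros \<omega>_cont) auto
  qed
  have quot_le: "cmod ((v - 1) / (v + 1)) \<le> 1" if "0 \<le> Re v" for v
  proof -
    have "(cmod (v - 1))\<^sup>2 \<le> (cmod (v + 1))\<^sup>2"
      using that unfolding cmod_power2 by (simp add: power2_eq_square algebra_simps)
    then show ?thesis using plus_nz[OF that] by (simp add: norm_divide)
  qed
  have H_le: "cmod (H v) \<le> cmod (P (\<omega> v / (\<omega> v - 1)))" if "v \<noteq> 1" "0 \<le> Re v" for v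
  proof -
    have "cmod (H v) = cmod (P (\<omega> v / (\<omega> v - 1))) * cmod ((v - 1) / (v + 1)) ^ d"
      by (simp add: H_eq[OF that] norm_mult norm_power)
    also have "\<dots> \<le> cmod (P (\<omega> v / (\<omega> v - 1))) * 1"
      using quot_le[OF that(2)] by (intro mult_left_mono power_le_one) auto
    finally show ?thesis by simp
  qed
  have H_axis: "cmod (H v) \<le> M" if "Re v = 0" for v
  proof (cases "v = 0")
    case True
    then show ?thesis using H_le[of 0] P0 by simp
  next
    case False
    define y where "y = Im v"
    have v: "v = \<i> * y" and y: "y \<noteq> 0" using that False by (auto simp: y_def complex_eq_iff)
    define r where "r = exp (- \<beta> * ln \<bar>y\<bar>)"
    have r: "r > 0" by (simp add: r_def)
    \<comment> \<open>On the imaginary axis $w = 1/(1 + u)$ with \<open>u\<close> on the boundary of the sector.\<close>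
    define u where "u = - (1 / \<omega> v)"
    have "\<omega> v \<noteq> 0" using False by (simp add: \<omega>_def)
    have Lnv: "Ln v = Complex (ln \<bar>y\<bar>) (if y > 0 then pi / 2 else - (pi / 2))"
    proof (cases "y > 0")
      case True
      then show ?thesis using Ln_of_real[of y] by (simp add: v Ln_times_ii complex_eq_iff mult.commute)
    next
      case False
      then have "y < 0" using y by simp
      moreover have "- (pi / 2) \<le> pi" using pi_gt_zero by linarith
      ultimately show ?thesis
        by (intro Ln_unique) (auto simp: v complex_eq_iff Re_exp Im_exp)
    qed
    have "u = - exp (- complex_of_real \<beta> * Ln v)"
      using False by (simp add: u_def \<omega>_def powr_def exp_minus divide_inverse)
    then have "Re u = - (r * cos (\<beta> * (pi / 2)))" "\<bar>Im u\<bar> = \<bar>r * sin (\<beta> * (pi / 2))\<bar>"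
      by (auto simp: Lnv Re_exp Im_exp r_def)
    then have "Re u = r * cos \<theta>" "\<bar>Im u\<bar> = r * sin \<theta>"
      using r tan_\<theta> \<gamma> unfolding \<beta>_pi by (auto simp: abs_mult)
    then have "\<bar>Im u\<bar> \<le> \<gamma> * Re u" using tan_\<theta> by simp
    then have "cmod (P (1 / (1 + u))) \<le> M" by (rule P_sector)
    also have "1 / (1 + u) = \<omega> v / (\<omega> v - 1)"
      using \<open>\<omega> v \<noteq> 0\<close> \<omega>_eq_1[of v] that by (auto simp: u_def divide_simps)
    finally show ?thesis using H_le[of v] that by (auto simp: complex_eq_iff)
  qed

  define v0 where "v0 = 1 / q"
  have e: "0 < 1 - exp (- t)" "1 - exp (- t) < 1" using t by auto
  have "arctan \<gamma> < pi" using \<theta>(2) pi_gt_zero unfolding \<theta>_def by linarith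
  then have \<kappa>: "0 < pi / (2 * (pi - arctan \<gamma>))" by (intro divide_pos_pos) auto
  have q: "0 < q" "q < 1"
    using e powr_less_mono2[OF \<kappa>, of "1 - exp (- t)" 1] by (auto simp: q_def)
  have v0: "1 < v0" using q by (simp add: v0_def)
  have qexp: "pi / (2 * (pi - arctan \<gamma>)) * \<beta> = 1"
    using \<theta> \<open>arctan \<gamma> < pi\<close> by (simp add: \<beta>_def \<theta>_def)
  have "q powr \<beta> = 1 - exp (- t)" unfolding q_def powr_powr qexp using e by simp
  then have "v0 powr \<beta> = 1 / (1 - exp (- t))" using q by (simp add: v0_def powr_divide)
  then have \<omega>v0: "\<omega> (complex_of_real v0) = complex_of_real (1 / (1 - exp (- t)))"
    unfolding \<omega>_def using v0 by (simp add: powr_of_real)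
  have wv0: "\<omega> v0 / (\<omega> v0 - 1) = exp (complex_of_real t)"
  proof -
    have "1 / (1 - exp (- t)) / (1 / (1 - exp (- t)) - 1) = exp t"
      using e by (simp add: field_simps exp_minus)
    from arg_cong[OF this, of complex_of_real] show ?thesis
      unfolding \<omega>v0 exp_of_real by (simp only: of_real_divide of_real_diff of_real_1)
  qed
  \<comment> \<open>As \<open>v\<close> tends to infinity $w$ tends to 1, where \<open>P\<close> is bounded by \<open>M\<close>; hence half-discs suffice for the maximum principle.\<close>
  have "cmod (H v0) \<le> M + \<epsilon>" if \<epsilon>: "\<epsilon> > 0" for \<epsilon>
  proof -
    obtain \<delta> where \<delta>: "\<delta> > 0" "\<And>w. dist w 1 < \<delta> \<Longrightarrow> dist (P w) (P 1) < \<epsilon>"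
      using P_cont[of 1] \<epsilon> unfolding continuous_at_eps_delta by blast
    define R where "R = v0 + 2 + 1 / \<delta>"
    have R: "R > v0" "R > 1" using \<delta> v0 by (auto simp: R_def add_pos_pos)
    have R\<beta>: "R powr \<beta> - 1 > 1 / \<delta>" "R powr \<beta> > 1"
    proof -
      have "R powr 1 \<le> R powr \<beta>" using R \<beta> by (intro powr_mono) auto
      moreover have "R - 1 > 1 / \<delta>" using v0 by (simp add: R_def)
      ultimately show "R powr \<beta> - 1 > 1 / \<delta>" "R powr \<beta> > 1" using R by auto
    qed
    define T where "T = {v. 0 \<le> Re v} \<inter> cball 0 R"
    have T_closed: "closed T" unfolding T_def by (intro closed_Int closed_halfspace_Re_ge closed_cball)
    have "cmod (H v0) \<le> M + \<epsilon>"
    proof (rule maximum_modulus_frontier[of H T])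
      have "interior T \<subseteq> S"
        unfolding T_def S_def using interior_halfspace_ge[of "1 :: complex" 0]
        by (auto simp: interior_Int inner_complex_def)
      then show "H holomorphic_on interior T" using H_holo holomorphic_on_subset by blast
      show "continuous_on (closure T) H"
        using H_cont T_closed by (auto simp: T_def intro: continuous_on_subset)
      show "bounded T" unfolding T_def by (simp add: bounded_Int)
      show "complex_of_real v0 \<in> T" using R v0 by (auto simp: T_def)
    next
      fix v assume v: "v \<in> frontier T"
      have "frontier T \<subseteq> T" using T_closed by (simp add: frontier_subset_closed)
      then have vT: "0 \<le> Re v" "cmod v \<le> R" using v by (auto simp: T_def)
      have "v \<in> frontier {v. 0 \<le> Re v} \<or> v \<in> frontier (cball 0 R)"
        using v frontier_Int_subset[of "{v. 0 \<le> Re v}" "cball 0 R"] by (auto simp: T_def)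
      moreover have "frontier {v. 0 \<le> Re v} = {v. Re v = 0}"
        using frontier_halfspace_ge[of "1 :: complex" 0] by (simp add: inner_complex_def)
      ultimately consider "Re v = 0" | "cmod v = R" by (auto simp: frontier_cball)
      then show "cmod (H v) \<le> M + \<epsilon>"
      proof cases
        case 1
        then show ?thesis using H_axis[of v] \<epsilon> by simp
      next
        case 2
        have "v \<noteq> 1" using 2 R by auto
        have n1: "R powr \<beta> - 1 \<le> cmod (\<omega> v - 1)"
          using norm_triangle_ineq2[of "\<omega> v" 1] by (simp add: \<omega>_norm 2)
        then have nz: "\<omega> v - 1 \<noteq> 0" using R\<beta> by auto
        have "\<omega> v / (\<omega> v - 1) - 1 = 1 / (\<omega> v - 1)" using nz by (simp add: divide_simps)
        then have "dist (\<omega> v / (\<omega> v - 1)) 1 = 1 / cmod (\<omega> v - 1)"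
          by (simp add: dist_norm norm_divide)
        also have "\<dots> < \<delta>"
        proof -
          have "1 / \<delta> < cmod (\<omega> v - 1)" using n1 R\<beta> by linarith
          then show ?thesis using \<delta>(1) nz by (simp add: field_simps)
        qed
        finally have "dist (P (\<omega> v / (\<omega> v - 1))) (P 1) < \<epsilon>" by (rule \<delta>(2))
        then have "cmod (P (\<omega> v / (\<omega> v - 1))) \<le> M + \<epsilon>"
          using P1 norm_triangle_ineq2[of "P (\<omega> v / (\<omega> v - 1))" "P 1"] by (simp add: dist_norm)
        then show ?thesis using H_le[OF \<open>v \<noteq> 1\<close> vT(1)] by simp
      qed
    qed
    then show ?thesis .
  qed
  then have "cmod (H v0) \<le> M" by (rule field_le_epsilon)
  moreover have "H v0 = P (exp (complex_of_real t)) * complex_of_real ((1 - q) / (1 + q)) ^ d"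
  proof -
    have "(complex_of_real v0 - 1) / (complex_of_real v0 + 1) = complex_of_real ((v0 - 1) / (v0 + 1))" by simp
    also have "(v0 - 1) / (v0 + 1) = (1 - q) / (1 + q)" using q by (simp add: v0_def divide_simps)
    finally show ?thesis using H_eq[of v0] wv0 v0 by (simp only: Re_complex_of_real of_real_eq_1_iff)
  qed
  ultimately have "cmod (P (exp (complex_of_real t))) * ((1 - q) / (1 + q)) ^ d \<le> M"
    using q by (simp only: norm_mult norm_power norm_of_real) simp
  then have "cmod (P (exp (complex_of_real t))) \<le> M * ((1 + q) / (1 - q)) ^ d"
    using q by (simp add: power_divide divide_simps mult_ac)
  then show ?thesis by (simp add: P_def exp_of_nat2_mult)
qed

text \<open>
  For small $t$ the number $q$ is of size \<open>t powr \<kappa>\<close> and stays away from 1; for large $t$ the gap \<open>1 - q\<close> is of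
  size $e^{-t}$. Young's inequality gives the lower bound \<open>\<kappa> exp (- t)\<close> for the gap in both
  ranges.
\<close>

lemma growth_factor_le:
  fixes t \<kappa> :: real
  assumes t: "0 < t" and \<kappa>: "0 < \<kappa>" "\<kappa> \<le> 1"
  defines "q \<equiv> (1 - exp (- t)) powr \<kappa>"
  shows "(1 + q) / (1 - q) \<le> exp (2 * exp 1 / \<kappa> * max t (t powr \<kappa>))"
proof -
  define x where "x = exp (- t)"
  have x: "0 < x" "x < 1" using t by (auto simp: x_def)
  have "(1 - x) powr \<kappa> * 1 powr (1 - \<kappa>) \<le> \<kappa> * (1 - x) + (1 - \<kappa>) * 1"
    using x \<kappa> by (intro Youngs_inequality_0) auto
  then have q_gap: "\<kappa> * x \<le> 1 - q" by (simp add: q_def x_def algebra_simps)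
  have \<kappa>x: "0 < \<kappa> * x" using \<kappa> x by simp
  have q0: "0 \<le> q" "q < 1" using q_gap \<kappa>x by (auto simp: q_def)
  have e1: "(2::real) \<le> exp 1" using exp_ge_add_one_self[of "1::real"] by simp
  show ?thesis
  proof (cases "t \<le> 1")
    case True
    have "1 - x \<le> t" using exp_ge_add_one_self[of "- t"] by (simp add: x_def)
    then have q_le: "q \<le> t powr \<kappa>" using x \<kappa> unfolding q_def x_def by (intro powr_mono2) auto
    have "exp (- 1) \<le> x" using True by (simp add: x_def)
    then have "\<kappa> * exp (- 1) \<le> 1 - q" using q_gap \<kappa> by (smt (verit) mult_left_mono)
    then have "q / (1 - q) \<le> t powr \<kappa> / (\<kappa> * exp (- 1))"
      using q_le q0 \<kappa> by (intro frac_le) auto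
    then have "(1 + q) / (1 - q) \<le> 1 + 2 * exp 1 / \<kappa> * t powr \<kappa>"
      using q0 \<kappa> by (simp add: exp_minus field_simps)
    also have "\<dots> \<le> exp (2 * exp 1 / \<kappa> * t powr \<kappa>)" by (rule exp_ge_add_one_self)
    also have "\<dots> \<le> exp (2 * exp 1 / \<kappa> * max t (t powr \<kappa>))"
      using \<kappa> by (simp add: mult_left_mono divide_right_mono)
    finally show ?thesis .
  next
    case False
    have "(1 + q) / (1 - q) \<le> 2 / (\<kappa> * x)"
      using q0 q_gap \<kappa>x by (intro frac_le) auto
    also have "\<dots> = (2 / \<kappa>) * exp t" by (simp add: x_def exp_minus divide_inverse)
    also have "\<dots> \<le> exp (2 / \<kappa>) * exp t"
      using exp_ge_add_one_self[of "2 / \<kappa>"] by (intro mult_right_mono) (linarith, simp)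
    also have "\<dots> = exp (2 / \<kappa> + t)" by (simp add: exp_add)
    also have "\<dots> \<le> exp (2 * exp 1 / \<kappa> * t)"
    proof -
      have "2 / \<kappa> + t \<le> 2 / \<kappa> * t + t * (2 / \<kappa>)"
      proof (rule add_mono)
        show "2 / \<kappa> \<le> 2 / \<kappa> * t" using False \<kappa> by (simp add: field_simps)
        show "t \<le> t * (2 / \<kappa>)" using \<kappa> t by (simp add: field_simps)
      qed
      also have "\<dots> = 2 * 2 / \<kappa> * t" by simp
      also have "\<dots> \<le> 2 * exp 1 / \<kappa> * t"
        using e1 \<kappa> t by (intro mult_right_mono divide_right_mono mult_left_mono) auto
      finally show ?thesis by simp
    qed
    also have "\<dots> \<le> exp (2 * exp 1 / \<kappa> * max t (t powr \<kappa>))"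
      using \<kappa> by (simp add: mult_left_mono divide_right_mono)
    finally show ?thesis .
  qed
qed

section \<open>Powers, the cube and the \<open>L\<^sub>p\<close> norm\<close>

lemma bernoulli_powr_strict:
  fixes x p :: real
  assumes "0 \<le> x" "x \<noteq> 1" "1 < p"
  shows "1 + p * (x - 1) < x powr p"
proof (cases "x = 0")
  case False
  then have x: "0 < x" using assms by simp
  have d: "((\<lambda>x. x powr p) has_real_derivative p * z powr (p - 1)) (at z)" if "0 < z" for z
    using that by (auto intro!: derivative_eq_intros simp: powr_diff)
  show ?thesis
  proof (cases "x < 1")
    case True
    obtain z where z: "x < z" "z < 1" "1 powr p - x powr p = (1 - x) * (p * z powr (p - 1))"
      using MVT2[OF True, of "\<lambda>x. x powr p" "\<lambda>z. p * z powr (p - 1)"] d x by force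
    have "z powr (p - 1) < 1" using z x assms powr_less_mono2[of "p - 1" z 1] by simp
    then have "(1 - x) * (p * z powr (p - 1)) < (1 - x) * (p * 1)"
      using True assms by (intro mult_strict_left_mono) auto
    then show ?thesis using z by (simp add: algebra_simps)
  next
    case False
    then have "1 < x" using assms by simp
    then obtain z where z: "1 < z" "z < x" "x powr p - 1 powr p = (x - 1) * (p * z powr (p - 1))"
      using MVT2[of 1 x "\<lambda>x. x powr p" "\<lambda>z. p * z powr (p - 1)"] d by force
    have "1 < z powr (p - 1)" using z assms by (simp add: gr_one_powr)
    then have "(x - 1) * (p * 1) < (x - 1) * (p * z powr (p - 1))"
      using \<open>1 < x\<close> assms by (intro mult_strict_left_mono) auto
    then show ?thesis using z by (simp add: algebra_simps)
  qed
qed (use assms in auto)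

lemma powr_above_tangent_strict:
  fixes x y p :: real
  assumes "0 \<le> x" "0 < y" "x \<noteq> y" "1 < p"
  shows "y powr p + p * y powr (p - 1) * (x - y) < x powr p"
proof -
  have "1 + p * (x / y - 1) < (x / y) powr p"
    using assms by (intro bernoulli_powr_strict) auto
  then have "y powr p * (1 + p * (x / y - 1)) < y powr p * (x / y) powr p"
    using assms by (intro mult_strict_left_mono) auto
  also have "\<dots> = x powr p" using assms by (simp add: powr_divide)
  also have "y powr p * (1 + p * (x / y - 1)) = y powr p + p * (y powr p / y) * (x - y)"
    using assms by (simp add: field_simps)
  finally show ?thesis using assms by (simp add: powr_diff)
qed

lemma powr_above_tangent:
  fixes x y p :: real
  assumes "0 \<le> x" "0 \<le> y" "1 < p"
  shows "y powr p + p * y powr (p - 1) * (x - y) \<le> x powr p"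
  using powr_above_tangent_strict[of x y p] assms by (cases "y = 0"; cases "x = y") auto

text \<open>
  Jensen's inequality: sum the tangent inequality at the mean.
\<close>

lemma powr_weighted_mean_le:
  fixes w x :: "'i \<Rightarrow> real" and p :: real
  assumes "1 < p" "\<And>i. i \<in> I \<Longrightarrow> 0 \<le> w i" "\<And>i. i \<in> I \<Longrightarrow> 0 \<le> x i" "(\<Sum>i\<in>I. w i) = 1"
  shows "(\<Sum>i\<in>I. w i * x i) powr p \<le> (\<Sum>i\<in>I. w i * x i powr p)"
proof -
  define y where "y = (\<Sum>i\<in>I. w i * x i)"
  have y: "0 \<le> y" unfolding y_def using assms by (intro sum_nonneg) auto
  have "(\<Sum>i\<in>I. w i * (y powr p + p * y powr (p - 1) * (x i - y))) \<le> (\<Sum>i\<in>I. w i * x i powr p)"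
    using assms y by (intro sum_mono mult_left_mono powr_above_tangent) auto
  also have "(\<Sum>i\<in>I. w i * (y powr p + p * y powr (p - 1) * (x i - y)))
      = (\<Sum>i\<in>I. w i) * y powr p + p * y powr (p - 1) * ((\<Sum>i\<in>I. w i * x i) - y * (\<Sum>i\<in>I. w i))"
    by (simp add: sum_distrib_left sum_distrib_right sum.distrib sum_subtractf algebra_simps)
  also have "\<dots> = y powr p" using assms(4) by (simp add: y_def)
  finally show ?thesis by (simp add: y_def)
qed

lemma finite_cube [simp]: "finite (cube n)"
  by (simp add: cube_def finite_PiE)

lemma card_cube: "card (cube n) = 2 ^ n"
  by (simp add: cube_def card_PiE numeral_2_eq_2)

lemma cube_nonempty [simp]: "cube n \<noteq> {}"
  using card_cube[of n] by (metis card.empty power_not_zero zero_neq_numeral)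

lemma cubeD: "\<epsilon> \<in> cube n \<Longrightarrow> i \<in> {1..n} \<Longrightarrow> \<epsilon> i = -1 \<or> \<epsilon> i = 1"
  by (auto simp: cube_def PiE_iff)

lemma cube_square: "\<epsilon> \<in> cube n \<Longrightarrow> i \<in> {1..n} \<Longrightarrow> \<epsilon> i * \<epsilon> i = 1"
  using cubeD by fastforce

lemma cube_abs: "\<epsilon> \<in> cube n \<Longrightarrow> i \<in> {1..n} \<Longrightarrow> \<bar>\<epsilon> i\<bar> = 1"
  using cubeD by fastforce

text \<open>
  Independence of the coordinates; orthogonality of the Walsh functions and the moment computations
  below are instances.
\<close>

lemma sum_cube_prod:
  fixes g :: "nat \<Rightarrow> real \<Rightarrow> 'b :: comm_semiring_1"
  shows "(\<Sum>\<epsilon>\<in>cube n. \<Prod>i\<in>{1..n}. g i (\<epsilon> i)) = (\<Prod>i\<in>{1..n}. g i (-1) + g i 1)"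
  unfolding cube_def by (subst prod_sum_PiE[symmetric]) auto

lemma walsh_eq_prod:
  assumes "A \<subseteq> {1..n}"
  shows "walsh A \<epsilon> = (\<Prod>i\<in>{1..n}. if i \<in> A then \<epsilon> i else 1)"
  unfolding walsh_def using assms by (simp add: prod.If_cases Int_absorb1)

lemma sum_walsh_mult:
  assumes "A \<subseteq> {1..n}" "B \<subseteq> {1..n}"
  shows "(\<Sum>\<epsilon>\<in>cube n. walsh A \<epsilon> * walsh B \<epsilon>) = (if A = B then 2 ^ n else 0)"
proof -
  define g where "g i x = (if i \<in> A then x else 1) * (if i \<in> B then x else (1::real))" for i x
  have "(\<Sum>\<epsilon>\<in>cube n. walsh A \<epsilon> * walsh B \<epsilon>) = (\<Sum>\<epsilon>\<in>cube n. \<Prod>i\<in>{1..n}. g i (\<epsilon> i))"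
    unfolding walsh_eq_prod[OF assms(1)] walsh_eq_prod[OF assms(2)] g_def prod.distrib ..
  also have "\<dots> = (\<Prod>i\<in>{1..n}. g i (-1) + g i 1)" by (rule sum_cube_prod)
  also have "\<dots> = (if A = B then 2 ^ n else 0)"
  proof (cases "A = B")
    case True
    then have "g i (-1) + g i 1 = 2" for i by (simp add: g_def)
    then show ?thesis using True by simp
  next
    case False
    then obtain i where i: "i \<in> {1..n}" "(i \<in> A) \<noteq> (i \<in> B)" using assms by blast
    then have "g i (-1) + g i 1 = 0" by (auto simp: g_def)
    then show ?thesis using False i(1) by (auto simp: prod_zero_iff)
  qed
  finally show ?thesis .
qed

lemma sum_walsh:
  assumes "A \<subseteq> {1..n}"
  shows "(\<Sum>\<epsilon>\<in>cube n. walsh A \<epsilon>) = (if A = {} then 2 ^ n else 0)"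
  using sum_walsh_mult[OF assms, of "{}"] by (simp add: walsh_def)

lemma sum_walsh_walsh:
  assumes "\<epsilon> \<in> cube n" "\<delta> \<in> cube n"
  shows "(\<Sum>A\<in>Pow {1..n}. walsh A \<epsilon> * walsh A \<delta>) = (if \<epsilon> = \<delta> then 2 ^ n else 0)"
proof -
  have "(\<Sum>A\<in>Pow {1..n}. walsh A \<epsilon> * walsh A \<delta>) = (\<Prod>i\<in>{1..n}. \<epsilon> i * \<delta> i + 1)"
    by (subst prod_add) (simp_all add: walsh_def prod.distrib)
  also have "\<dots> = (if \<epsilon> = \<delta> then 2 ^ n else 0)"
  proof (cases "\<epsilon> = \<delta>")
    case True
    then have "(\<Prod>i\<in>{1..n}. \<epsilon> i * \<delta> i + 1) = (\<Prod>i\<in>{1..n}. 2)"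
      using assms by (intro prod.cong) (auto simp: cube_square)
    then show ?thesis using True by simp
  next
    case False
    then obtain i where i: "i \<in> {1..n}" "\<epsilon> i \<noteq> \<delta> i"
      using assms unfolding cube_def by (metis PiE_ext)
    then have "\<epsilon> i * \<delta> i + 1 = 0" using cubeD[OF assms(1)] cubeD[OF assms(2)] by fastforce
    then show ?thesis using i(1) False by (auto simp: prod_zero_iff)
  qed
  finally show ?thesis .
qed

lemma walsh_expansion:
  fixes f :: "(nat \<Rightarrow> real) \<Rightarrow> 'a::real_vector"
  assumes "\<epsilon> \<in> cube n"
  shows "(\<Sum>A\<in>Pow {1..n}. walsh A \<epsilon> *\<^sub>R walsh_coeff n f A) = f \<epsilon>"
proof -
  have "(\<Sum>A\<in>Pow {1..n}. walsh A \<epsilon> *\<^sub>R walsh_coeff n f A)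
      = (\<Sum>\<delta>\<in>cube n. ((1 / 2 ^ n) * (\<Sum>A\<in>Pow {1..n}. walsh A \<epsilon> * walsh A \<delta>)) *\<^sub>R f \<delta>)"
    unfolding walsh_coeff_def scaleR_sum_right scaleR_scaleR sum_distrib_left scaleR_sum_left
    by (subst sum.swap) (simp add: mult_ac)
  also have "\<dots> = (\<Sum>\<delta>\<in>cube n. if \<epsilon> = \<delta> then f \<delta> else 0)"
    by (intro sum.cong) (auto simp: sum_walsh_walsh assms simp del: One_nat_def)
  also have "\<dots> = f \<epsilon>" using assms by (simp add: sum.delta)
  finally show ?thesis .
qed

lemma Lp_norm_nonneg: "0 \<le> Lp_norm n p f"
  by (simp add: Lp_norm_def)

lemma Lp_norm_cong: "(\<And>\<epsilon>. \<epsilon> \<in> cube n \<Longrightarrow> norm (f \<epsilon>) = norm (g \<epsilon>)) \<Longrightarrow> Lp_norm n p f = Lp_norm n p g"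
  by (simp add: Lp_norm_def)

lemma Lp_norm_powr:
  assumes "1 < p"
  shows "Lp_norm n p f powr p = (\<Sum>\<epsilon>\<in>cube n. norm (f \<epsilon>) powr p) / 2 ^ n"
proof -
  have "0 \<le> (\<Sum>\<epsilon>\<in>cube n. norm (f \<epsilon>) powr p) / 2 ^ n" by (intro divide_nonneg_pos sum_nonneg) auto
  then show ?thesis unfolding Lp_norm_def powr_powr using assms by (simp add: sum_nonneg)
qed

lemma Lp_norm_le_iff:
  assumes "1 < p" "0 \<le> C"
  shows "Lp_norm n p f \<le> C \<longleftrightarrow> (\<Sum>\<epsilon>\<in>cube n. norm (f \<epsilon>) powr p) / 2 ^ n \<le> C powr p"
  unfolding Lp_norm_powr[OF assms(1), symmetric]
  using assms Lp_norm_nonneg[of n p f]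
  by (meson powr_mono2 powr_less_mono2 less_imp_le not_less zero_less_one order.strict_trans)

lemma Lp_norm_const: "1 < p \<Longrightarrow> 0 \<le> c \<Longrightarrow> Lp_norm n p (\<lambda>_. c :: real) = c"
  by (simp add: Lp_norm_def card_cube powr_powr)

lemma Lp_norm_mono:
  assumes "1 < p" "\<And>\<epsilon>. \<epsilon> \<in> cube n \<Longrightarrow> norm (f \<epsilon>) \<le> norm (g \<epsilon>)"
  shows "Lp_norm n p f \<le> Lp_norm n p g"
  unfolding Lp_norm_le_iff[OF assms(1) Lp_norm_nonneg] Lp_norm_powr[OF assms(1)]
  using assms by (intro divide_right_mono sum_mono powr_mono2) auto

lemma Lp_norm_scale:
  assumes "1 < p" "0 \<le> c" "\<And>\<epsilon>. \<epsilon> \<in> cube n \<Longrightarrow> norm (g \<epsilon>) = c * norm (f \<epsilon>)"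
  shows "Lp_norm n p g = c * Lp_norm n p f"
proof -
  have "(\<Sum>\<epsilon>\<in>cube n. norm (g \<epsilon>) powr p) = c powr p * (\<Sum>\<epsilon>\<in>cube n. norm (f \<epsilon>) powr p)"
    using assms by (simp add: powr_mult sum_distrib_left)
  moreover have "(c powr p) powr (1 / p) = c" using assms by (simp add: powr_powr)
  ultimately show ?thesis
    using assms unfolding Lp_norm_def
    by (simp add: powr_mult sum_nonneg flip: times_divide_eq_right)
qed

lemma Lp_norm_eq_0:
  assumes "1 < p" "Lp_norm n p f = 0" "\<epsilon> \<in> cube n"
  shows "f \<epsilon> = 0"
proof -
  have "(\<Sum>\<epsilon>\<in>cube n. norm (f \<epsilon>) powr p) = 0" using assms(1,2) by (simp add: Lp_norm_def)
  then have "norm (f \<epsilon>) powr p = 0" using assms(3) by (subst (asm) sum_nonneg_eq_0_iff) auto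
  then show ?thesis by simp
qed

text \<open>
  Minkowski's inequality, in the form that the unit ball is convex: apply Jensen's inequality to
  the normalized functions, weighted by their norms.
\<close>

lemma Lp_norm_triangle:
  assumes p: "1 < p"
  shows "Lp_norm n p (\<lambda>\<epsilon>. f \<epsilon> + g \<epsilon>) \<le> Lp_norm n p f + Lp_norm n p g"
proof -
  define F G where "F = Lp_norm n p f" and "G = Lp_norm n p g"
  have FG: "0 \<le> F" "0 \<le> G" by (simp_all add: F_def G_def Lp_norm_nonneg)
  consider "F = 0" | "G = 0" | "0 < F" "0 < G" using FG by linarith
  then show ?thesis
  proof cases
    case 1
    then have "Lp_norm n p (\<lambda>\<epsilon>. f \<epsilon> + g \<epsilon>) = G"
      using Lp_norm_eq_0[OF p, of n f] unfolding F_def G_def by (intro Lp_norm_cong) simp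
    then show ?thesis using FG by (simp add: F_def G_def)
  next
    case 2
    then have "Lp_norm n p (\<lambda>\<epsilon>. f \<epsilon> + g \<epsilon>) = F"
      using Lp_norm_eq_0[OF p, of n g] unfolding F_def G_def by (intro Lp_norm_cong) simp
    then show ?thesis using FG by (simp add: F_def G_def)
  next
    case 3
    define S where "S = F + G"
    have S: "0 < S" using 3 by (simp add: S_def)
    have pt: "norm (f \<epsilon> + g \<epsilon>) powr p
        \<le> S powr p * (F / S * (norm (f \<epsilon>) powr p / F powr p) + G / S * (norm (g \<epsilon>) powr p / G powr p))" for \<epsilon>
    proof -
      define w x where "w i = (if i then F / S else G / S)"
        and "x i = (if i then norm (f \<epsilon>) / F else norm (g \<epsilon>) / G)" for i
      have "S * (\<Sum>i\<in>UNIV. w i * x i) = norm (f \<epsilon>) + norm (g \<epsilon>)"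
        using 3 S by (simp add: UNIV_bool w_def x_def distrib_left)
      then have "norm (f \<epsilon> + g \<epsilon>) \<le> S * (\<Sum>i\<in>UNIV. w i * x i)"
        using norm_triangle_ineq[of "f \<epsilon>" "g \<epsilon>"] by simp
      then have "norm (f \<epsilon> + g \<epsilon>) powr p \<le> (S * (\<Sum>i\<in>UNIV. w i * x i)) powr p"
        using p by (intro powr_mono2) auto
      also have "\<dots> = S powr p * (\<Sum>i\<in>UNIV. w i * x i) powr p"
        by (rule powr_mult)
      also have "(\<Sum>i\<in>UNIV. w i * x i) powr p \<le> (\<Sum>i\<in>UNIV. w i * x i powr p)"
        using 3 S p by (intro powr_weighted_mean_le)
          (auto simp: w_def x_def UNIV_bool S_def simp flip: add_divide_distrib)
      also have "\<dots> = F / S * (norm (f \<epsilon>) powr p / F powr p) + G / S * (norm (g \<epsilon>) powr p / G powr p)"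
        using 3 by (simp add: w_def x_def UNIV_bool powr_divide)
      finally show ?thesis using S by simp
    qed
    have "(\<Sum>\<epsilon>\<in>cube n. norm (f \<epsilon> + g \<epsilon>) powr p) / 2 ^ n
        \<le> (\<Sum>\<epsilon>\<in>cube n. S powr p * (F / S * (norm (f \<epsilon>) powr p / F powr p) + G / S * (norm (g \<epsilon>) powr p / G powr p))) / 2 ^ n"
      by (intro divide_right_mono sum_mono pt) auto
    also have "\<dots> = S powr p * (F / S * (((\<Sum>\<epsilon>\<in>cube n. norm (f \<epsilon>) powr p) / 2 ^ n) / F powr p)
        + G / S * (((\<Sum>\<epsilon>\<in>cube n. norm (g \<epsilon>) powr p) / 2 ^ n) / G powr p))"
      by (simp add: sum_distrib_left sum_divide_distrib sum.distrib add_divide_distrib distrib_left mult_ac)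
    also have "\<dots> = S powr p"
      using 3 S unfolding Lp_norm_powr[OF p, symmetric] F_def[symmetric] G_def[symmetric]
      by (simp add: S_def flip: add_divide_distrib)
    finally show ?thesis
      using S by (subst Lp_norm_le_iff[OF p]) (auto simp: S_def F_def G_def)
  qed
qed

lemma Lp_norm_sum_le:
  assumes p: "1 < p"
  shows "Lp_norm n p (\<lambda>\<epsilon>. \<Sum>i\<in>I. f i \<epsilon>) \<le> (\<Sum>i\<in>I. Lp_norm n p (f i))"
proof (induction I rule: infinite_finite_induct)
  case (insert x F)
  then show ?case using Lp_norm_triangle[OF p, of n "f x" "\<lambda>\<epsilon>. \<Sum>i\<in>F. f i \<epsilon>"] by simp
qed (auto simp: Lp_norm_def)

section \<open>\<open>K\<close>-convexity and signed sums\<close>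

text \<open>
  Among the signed sums of any $N$ vectors of the unit ball one is shorter than $N$ by a fixed
  proportion. The existence of such $N$ and \<open>\<delta>\<close> is Beck's convexity condition, equivalent to
  the absence of uniform copies of the spaces \<open>\<ell>\<^sub>1\<^sup>N\<close>.
\<close>

definition sign_deficient :: "'a::real_normed_vector itself \<Rightarrow> nat \<Rightarrow> real \<Rightarrow> bool" where
  "sign_deficient X N \<delta> \<longleftrightarrow> (\<forall>x :: nat \<Rightarrow> 'a. (\<forall>i\<in>{1..N}. norm (x i) \<le> 1) \<longrightarrow>
     (\<exists>s\<in>cube N. norm (\<Sum>i\<in>{1..N}. s i *\<^sub>R x i) \<le> real N * (1 - \<delta>)))"

text \<open>
  The same property of the spaces $L_p(\{-1,1\}^n; X)$, uniformly in \<open>n\<close> and in homogeneous form.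
\<close>

definition Lp_sign_deficient :: "'a::real_normed_vector itself \<Rightarrow> real \<Rightarrow> nat \<Rightarrow> real \<Rightarrow> bool" where
  "Lp_sign_deficient X p N \<delta> \<longleftrightarrow>
     (\<forall>n F. \<forall>f :: nat \<Rightarrow> (nat \<Rightarrow> real) \<Rightarrow> 'a. (\<forall>i\<in>{1..N}. Lp_norm n p (f i) \<le> F) \<longrightarrow>
       (\<exists>s\<in>cube N. Lp_norm n p (\<lambda>\<epsilon>. \<Sum>i\<in>{1..N}. s i *\<^sub>R f i \<epsilon>) \<le> real N * (1 - \<delta>) * F))"

text \<open>
  Khinchine's inequality in $L_1$, with a Riesz product as test function. The product
  $R(\delta) = \prod_k (1 + i \epsilon_k \delta_k / \surd m)$ is bounded in modulus by $(1 + 1/m)^{m/2} \le 2$, and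
  its correlation with each \<open>\<epsilon>\<^sub>i \<delta>\<^sub>i\<close> is $i / \surd m$, so that its correlation with their sum has modulus
  \<open>\<surd>m\<close>.
\<close>

lemma sum_abs_rademacher_ge:
  assumes "1 \<le> m" "\<epsilon> \<in> cube m"
  shows "2 ^ m * sqrt m / 2 \<le> (\<Sum>\<delta>\<in>cube m. \<bar>\<Sum>i\<in>{1..m}. \<epsilon> i * \<delta> i\<bar>)"
proof -
  define z where "z = \<i> / sqrt m"
  define R where "R \<delta> = (\<Prod>k\<in>{1..m}. 1 + z * (\<epsilon> k * \<delta> k))" for \<delta> :: "nat \<Rightarrow> real"
  have m: "0 < sqrt m" using assms by simp
  have R_norm: "cmod (R \<delta>) \<le> 2" if "\<delta> \<in> cube m" for \<delta>
  proof -
    have "(cmod (1 + z * complex_of_real (\<epsilon> k * \<delta> k)))\<^sup>2 = 1 + 1 / m" if k: "k \<in> {1..m}" for k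
    proof -
      have "(\<epsilon> k * \<delta> k)\<^sup>2 = 1"
        using cubeD[OF assms(2) k] cubeD[OF \<open>\<delta> \<in> cube m\<close> k] by (auto simp: power2_eq_square)
      then show ?thesis by (simp add: cmod_power2 z_def power_divide flip: of_real_mult)
    qed
    then have "(\<Prod>k\<in>{1..m}. (cmod (1 + z * complex_of_real (\<epsilon> k * \<delta> k)))\<^sup>2) = (\<Prod>k\<in>{1..m}. 1 + 1 / m)"
      by (rule prod.cong[OF refl])
    then have "(cmod (R \<delta>))\<^sup>2 = (1 + 1 / m) ^ m"
      unfolding R_def prod_norm[symmetric] prod_power_distrib by simp
    also have "\<dots> \<le> exp (1 / m) ^ m"
      by (intro power_mono exp_ge_add_one_self) auto
    also have "\<dots> = exp 1" using assms(1) by (simp flip: exp_of_nat_mult)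
    also have "\<dots> \<le> 2\<^sup>2" using exp_le by simp
    finally show ?thesis by (rule power2_le_imp_le) simp
  qed
  have one: "(\<Sum>\<delta>\<in>cube m. complex_of_real (\<epsilon> i * \<delta> i) * R \<delta>) = 2 ^ m * z" if i: "i \<in> {1..m}" for i
  proof -
    define g where "g k x = (if k = i then complex_of_real (\<epsilon> k * x) else 1) * (1 + z * complex_of_real (\<epsilon> k * x))"
      for k and x :: real
    have "complex_of_real (\<epsilon> i * \<delta> i) * R \<delta> = (\<Prod>k\<in>{1..m}. g k (\<delta> k))" for \<delta>
      unfolding g_def R_def prod.distrib using i by (simp add: prod.delta)
    then have "(\<Sum>\<delta>\<in>cube m. complex_of_real (\<epsilon> i * \<delta> i) * R \<delta>) = (\<Prod>k\<in>{1..m}. g k (-1) + g k 1)"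
      by (simp only: sum_cube_prod)
    also have "\<dots> = (\<Prod>k\<in>{1..m}. 2 * (if k = i then z else 1))"
    proof (rule prod.cong)
      fix k assume k: "k \<in> {1..m}"
      show "g k (-1) + g k 1 = 2 * (if k = i then z else 1)"
        using cubeD[OF assms(2) k] by (auto simp: g_def algebra_simps)
    qed simp
    also have "\<dots> = 2 ^ m * z" using i by (simp add: prod.distrib prod.delta)
    finally show ?thesis .
  qed
  have "complex_of_real (2 ^ m * sqrt m) * \<i> = (\<Sum>i\<in>{1..m}. 2 ^ m * z)"
  proof -
    have "complex_of_real (sqrt m) * complex_of_real (sqrt m) = of_nat m"
      by (simp flip: of_real_mult)
    then show ?thesis using m by (simp add: z_def field_simps)
  qed
  also have "\<dots> = (\<Sum>i\<in>{1..m}. \<Sum>\<delta>\<in>cube m. complex_of_real (\<epsilon> i * \<delta> i) * R \<delta>)"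
    using one by (intro sum.cong) auto
  also have "\<dots> = (\<Sum>\<delta>\<in>cube m. complex_of_real (\<Sum>i\<in>{1..m}. \<epsilon> i * \<delta> i) * R \<delta>)"
    by (subst sum.swap) (simp add: sum_distrib_right)
  finally have "2 ^ m * sqrt m = cmod (\<Sum>\<delta>\<in>cube m. complex_of_real (\<Sum>i\<in>{1..m}. \<epsilon> i * \<delta> i) * R \<delta>)"
    using m by (metis abs_of_nonneg less_eq_real_def mult.right_neutral norm_ii norm_mult norm_of_real zero_le_mult_iff zero_le_numeral zero_le_power)
  also have "\<dots> \<le> (\<Sum>\<delta>\<in>cube m. \<bar>\<Sum>i\<in>{1..m}. \<epsilon> i * \<delta> i\<bar> * 2)"
    by (intro sum_norm_le) (auto simp: norm_mult simp del: of_real_sum intro!: mult_left_mono R_norm)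
  finally show ?thesis by (simp flip: sum_distrib_right)
qed

text \<open>
  If all signed sums are nearly as long as possible, then so are all real combinations: compare the
  combination with \<open>C\<close> times the signed sum that has the signs of its coefficients.
\<close>

lemma norm_sum_ge_of_signs:
  fixes y :: "'i \<Rightarrow> 'a::real_normed_vector" and a :: "'i \<Rightarrow> real"
  assumes fin: "finite I" and y: "\<And>i. i \<in> I \<Longrightarrow> norm (y i) \<le> 1"
    and signs: "\<And>s. (\<And>i. i \<in> I \<Longrightarrow> s i = -1 \<or> s i = 1) \<Longrightarrow> L \<le> norm (\<Sum>i\<in>I. s i *\<^sub>R y i)"
    and a: "\<And>i. i \<in> I \<Longrightarrow> \<bar>a i\<bar> \<le> C" and C: "0 \<le> C"
  shows "C * L - C * card I + (\<Sum>i\<in>I. \<bar>a i\<bar>) \<le> norm (\<Sum>i\<in>I. a i *\<^sub>R y i)"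
proof -
  define s where "s i = (if a i \<ge> 0 then 1 else (-1::real))" for i
  have "C * L \<le> C * norm (\<Sum>i\<in>I. s i *\<^sub>R y i)"
    using C by (intro mult_left_mono signs) (auto simp: s_def)
  also have "\<dots> = norm (\<Sum>i\<in>I. (C * s i) *\<^sub>R y i)"
    using C by (simp add: scaleR_sum_right[symmetric] flip: scaleR_scaleR)
  also have "(\<Sum>i\<in>I. (C * s i) *\<^sub>R y i) = (\<Sum>i\<in>I. a i *\<^sub>R y i) + (\<Sum>i\<in>I. (C * s i - a i) *\<^sub>R y i)"
    by (simp add: sum.distrib[symmetric] flip: scaleR_add_left)
  also have "norm \<dots> \<le> norm (\<Sum>i\<in>I. a i *\<^sub>R y i) + (\<Sum>i\<in>I. C - \<bar>a i\<bar>)"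
  proof (intro order_trans[OF norm_triangle_ineq] add_left_mono sum_norm_le)
    fix i assume i: "i \<in> I"
    have "norm ((C * s i - a i) *\<^sub>R y i) \<le> \<bar>C * s i - a i\<bar> * 1"
      unfolding norm_scaleR using y[OF i] by (intro mult_left_mono) auto
    also have "\<dots> = C - \<bar>a i\<bar>" using a[OF i] by (auto simp: s_def)
    finally show "norm ((C * s i - a i) *\<^sub>R y i) \<le> C - \<bar>a i\<bar>" .
  qed
  finally show ?thesis by (simp add: sum_subtractf mult.commute)
qed

text \<open>
  If no signed sum of the vectors \<open>y \<delta>\<close>, $\delta \in \{-1,1\}^m$, is short, they span an almost isometric copy of
  $L_1(\{-1,1\}^m)$ up to scaling. The function $y$ has norm at most 1, while
  ${\rm Rad}(y)(\epsilon) = 2^{-m} \sum_\delta (\sum_i \epsilon_i \delta_i) y(\delta)$ has norm at least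
  \<open>\<surd>m/2 - 1\<close> at every point. For large \<open>m\<close> this contradicts \<open>K\<close>-convexity, with whatever
  exponent it is given.
\<close>

lemma K_convex_imp_sign_deficient:
  assumes "K_convex TYPE('a::real_normed_vector)"
  obtains N \<delta> where "1 \<le> N" "0 < \<delta>" "\<delta> < 1" "sign_deficient TYPE('a) N \<delta>"
proof -
  obtain p0 where p0: "1 < p0" and "(SUP n\<in>{1..}. Rad_opnorm TYPE('a) n p0) < \<infinity>"
    using assms unfolding K_convex_def by blast
  then obtain K where K: "0 \<le> K" "(SUP n\<in>{1..}. Rad_opnorm TYPE('a) n p0) = ennreal K"
    by (metis less_top_ennreal infinity_ennreal_def)
  have Rad_le: "Lp_norm n p0 (Rad n f) \<le> K" if "1 \<le> n" "Lp_norm n p0 f \<le> 1" for n and f :: "(nat \<Rightarrow> real) \<Rightarrow> 'a"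
  proof -
    have "ennreal (Lp_norm n p0 (Rad n f)) \<le> Rad_opnorm TYPE('a) n p0"
      unfolding Rad_opnorm_def using that by (intro SUP_upper) auto
    also have "\<dots> \<le> ennreal K" unfolding K(2)[symmetric] using that by (intro SUP_upper) auto
    finally show ?thesis using K(1) by simp
  qed
  \<comment> \<open>Large enough for \<open>sqrt m / 2 - 1\<close> to exceed the norm \<open>K\<close> of the Rademacher projection.\<close>
  obtain m :: nat where m: "(2 * K + 4)\<^sup>2 < m" using reals_Archimedean2 by blast
  have sq: "2 * K + 4 < sqrt m" using m K(1) by (intro real_less_rsqrt) auto
  have "16 \<le> (2 * K + 4)\<^sup>2" using K(1) power_mono[of 4 "2 * K + 4" 2] by simp
  then have m1: "1 \<le> m" "1 < m" using m by linarith+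
  have "sign_deficient TYPE('a) (2 ^ m) (1 / m)"
  proof (rule ccontr)
    assume "\<not> sign_deficient TYPE('a) (2 ^ m) (1 / m)"
    then obtain x :: "nat \<Rightarrow> 'a" where x: "\<forall>i\<in>{1..2 ^ m}. norm (x i) \<le> 1"
      and xs: "\<forall>s\<in>cube (2 ^ m). real (2 ^ m) * (1 - 1 / m) < norm (\<Sum>i\<in>{1..2 ^ m}. s i *\<^sub>R x i)"
      unfolding sign_deficient_def by (meson not_le)
    \<comment> \<open>The vectors are indexed by the points of the cube from here on.\<close>
    obtain h :: "nat \<Rightarrow> nat \<Rightarrow> real" where h: "bij_betw h {1..2 ^ m} (cube m)"
      using ex_bij_betw_nat_finite_1[of "cube m"] card_cube[of m] by auto
    define y where "y \<delta> = x (inv_into {1..2 ^ m} h \<delta>)" for \<delta>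
    have y_h: "y (h i) = x i" if "i \<in> {1..2 ^ m}" for i
      using that h by (simp add: y_def bij_betw_def)
    have h_im: "cube m = h ` {1..2 ^ m}" using h by (simp add: bij_betw_def)
    have y: "norm (y \<delta>) \<le> 1" if "\<delta> \<in> cube m" for \<delta>
      using that x y_h unfolding h_im by auto
    have signs: "real (2 ^ m) * (1 - 1 / m) \<le> norm (\<Sum>\<delta>\<in>cube m. s \<delta> *\<^sub>R y \<delta>)"
      if s: "\<And>\<delta>. \<delta> \<in> cube m \<Longrightarrow> s \<delta> = -1 \<or> s \<delta> = 1" for s :: "(nat \<Rightarrow> real) \<Rightarrow> real"
    proof -
      define s' where "s' = (\<lambda>i\<in>{1..2 ^ m}. s (h i))"
      have "s' \<in> cube (2 ^ m)" unfolding cube_def s'_def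
        using s h bij_betwE[OF h] by (auto intro!: restrict_PiE)
      then have "real (2 ^ m) * (1 - 1 / m) < norm (\<Sum>i\<in>{1..2 ^ m}. s' i *\<^sub>R x i)" using xs by blast
      also have "(\<Sum>i\<in>{1..2 ^ m}. s' i *\<^sub>R x i) = (\<Sum>i\<in>{1..2 ^ m}. s (h i) *\<^sub>R y (h i))"
        by (intro sum.cong) (auto simp: s'_def y_h)
      also have "\<dots> = (\<Sum>\<delta>\<in>cube m. s \<delta> *\<^sub>R y \<delta>)" by (rule sum.reindex_bij_betw[OF h])
      finally show ?thesis by simp
    qed
    have "Lp_norm m p0 y \<le> Lp_norm m p0 (\<lambda>_. 1 :: real)"
      using y by (intro Lp_norm_mono p0) auto
    also have "\<dots> = 1" using p0 by (simp add: Lp_norm_const)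
    finally have "Lp_norm m p0 (Rad m y) \<le> K" by (intro Rad_le m1)
    moreover have "K + 1 \<le> norm (Rad m y \<epsilon>)" if \<epsilon>: "\<epsilon> \<in> cube m" for \<epsilon>
    proof -
      define a where "a \<delta> = (\<Sum>i\<in>{1..m}. \<epsilon> i * \<delta> i)" for \<delta>
      have "Rad m y \<epsilon> = (1 / 2 ^ m) *\<^sub>R (\<Sum>\<delta>\<in>cube m. a \<delta> *\<^sub>R y \<delta>)"
        unfolding Rad_def walsh_coeff_def a_def walsh_def scaleR_sum_right scaleR_sum_left scaleR_scaleR
        by (subst sum.swap) (simp add: mult_ac)
      then have Rad_norm: "norm (Rad m y \<epsilon>) = norm (\<Sum>\<delta>\<in>cube m. a \<delta> *\<^sub>R y \<delta>) / 2 ^ m" by simp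
      have "real m * (real (2 ^ m) * (1 - 1 / m)) - real m * card (cube m) + (\<Sum>\<delta>\<in>cube m. \<bar>a \<delta>\<bar>)
          \<le> norm (\<Sum>\<delta>\<in>cube m. a \<delta> *\<^sub>R y \<delta>)"
      proof (rule norm_sum_ge_of_signs)
        fix \<delta> assume \<delta>: "\<delta> \<in> cube m"
        have "\<bar>a \<delta>\<bar> \<le> (\<Sum>i\<in>{1..m}. \<bar>\<epsilon> i * \<delta> i\<bar>)" unfolding a_def by (rule sum_abs)
        also have "\<dots> = (\<Sum>i\<in>{1..m}. 1)"
          by (intro sum.cong) (auto simp: abs_mult cube_abs[OF \<epsilon>] cube_abs[OF \<delta>])
        finally show "\<bar>a \<delta>\<bar> \<le> real m" by simp
      qed (use y signs in auto)
      also have "real m * (real (2 ^ m) * (1 - 1 / m)) - real m * card (cube m) = - (2 ^ m)"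
        using m1 by (simp add: card_cube field_simps)
      finally have "- (2 ^ m) + 2 ^ m * sqrt m / 2 \<le> norm (\<Sum>\<delta>\<in>cube m. a \<delta> *\<^sub>R y \<delta>)"
        using sum_abs_rademacher_ge[OF m1(1) \<epsilon>] by (simp add: a_def)
      then have "sqrt m / 2 - 1 \<le> norm (Rad m y \<epsilon>)"
        unfolding Rad_norm by (simp add: field_simps)
      then show ?thesis using sq by simp
    qed
    then have "Lp_norm m p0 (\<lambda>_. K + 1) \<le> Lp_norm m p0 (Rad m y)"
      using K(1) by (intro Lp_norm_mono p0) auto
    ultimately show False using K(1) p0 by (simp add: Lp_norm_const)
  qed
  then show thesis using that[of "2 ^ m" "1 / m"] m1 by simp
qed

text \<open>
  Strict convexity of the power, made uniform by compactness.
\<close>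

lemma midpoint_powr_gap:
  fixes p \<eta> :: real
  assumes p: "1 < p" and \<eta>: "0 < \<eta>" "\<eta> < 1"
  obtains c where "0 < c" "c \<le> 1"
    "\<And>s. 0 \<le> s \<Longrightarrow> s \<le> 1 - \<eta> \<Longrightarrow> 2 * ((1 + s) / 2) powr p \<le> (1 - c) * (1 + s powr p)"
proof -
  define \<phi> where "\<phi> s = 2 * ((1 + s) / 2) powr p / (1 + s powr p)" for s :: real
  have pos: "0 < 1 + s powr p" for s :: real by (simp add: add_pos_nonneg)
  have "1 + s powr p \<noteq> 0" for s :: real using pos[of s] by simp
  then have "continuous_on {0..1 - \<eta>} \<phi>"
    unfolding \<phi>_def using p
    by (intro continuous_on_divide continuous_on_mult continuous_on_add continuous_on_powr'
        continuous_on_const continuous_on_id) auto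
  then obtain s0 where s0: "s0 \<in> {0..1 - \<eta>}" "\<And>s. s \<in> {0..1 - \<eta>} \<Longrightarrow> \<phi> s \<le> \<phi> s0"
    using continuous_attains_sup[of "{0..1 - \<eta>}" \<phi>] \<eta> by auto
  define y where "y = (1 + s0) / 2"
  have y: "0 < y" "y \<noteq> 1" "s0 \<noteq> y" "0 \<le> s0" using s0(1) \<eta> by (auto simp: y_def field_simps)
  have "y powr p + p * y powr (p - 1) * (1 - y) < 1 powr p"
    using y p by (intro powr_above_tangent_strict) auto
  moreover have "y powr p + p * y powr (p - 1) * (s0 - y) < s0 powr p"
    using y p by (intro powr_above_tangent_strict) auto
  moreover have "p * y powr (p - 1) * (1 - y) + p * y powr (p - 1) * (s0 - y) = 0"
    unfolding distrib_left[symmetric] by (simp add: y_def field_simps)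
  ultimately have "2 * y powr p < 1 + s0 powr p" by simp
  then have lt: "\<phi> s0 < 1" using pos[of s0] by (simp add: \<phi>_def y_def)
  show thesis
  proof (rule that[of "1 - \<phi> s0"])
    show "1 - \<phi> s0 \<le> 1" using pos[of s0] by (simp add: \<phi>_def)
    fix s assume "0 \<le> s" "s \<le> 1 - \<eta>"
    then have "\<phi> s \<le> \<phi> s0" by (intro s0(2)) auto
    then show "2 * ((1 + s) / 2) powr p \<le> (1 - (1 - \<phi> s0)) * (1 + s powr p)"
      using pos[of s] by (simp add: \<phi>_def[of s] field_simps)
  qed (use lt in simp)
qed

text \<open>
  Replacing the two distant values \<open>r i\<close> and \<open>r j\<close> by their mean does not change the arithmetic mean and
  lowers the mean of the powers by a definite amount.
\<close>

lemma power_mean_gap: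
  fixes p \<eta> :: real and N :: nat
  assumes p: "1 < p" and \<eta>: "0 < \<eta>" "\<eta> < 1" and N: "1 \<le> N"
  obtains c where "0 < c" "c \<le> 1"
    "\<And>r i j. (\<And>k. k \<in> {1..N} \<Longrightarrow> 0 \<le> r k \<and> r k \<le> 1) \<Longrightarrow> i \<in> {1..N} \<Longrightarrow> j \<in> {1..N} \<Longrightarrow>
      r i = 1 \<Longrightarrow> r j \<le> 1 - \<eta> \<Longrightarrow>
      ((\<Sum>k\<in>{1..N}. r k) / N) powr p \<le> (1 - c) * ((\<Sum>k\<in>{1..N}. r k powr p) / N)"
proof -
  obtain c where c: "0 < c" "c \<le> 1"
    and gap: "\<And>s. 0 \<le> s \<Longrightarrow> s \<le> 1 - \<eta> \<Longrightarrow> 2 * ((1 + s) / 2) powr p \<le> (1 - c) * (1 + s powr p)"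
    using midpoint_powr_gap[OF p \<eta>] by blast
  have main: "((\<Sum>k\<in>{1..N}. r k) / N) powr p \<le> (1 - c / N) * ((\<Sum>k\<in>{1..N}. r k powr p) / N)"
    if r: "\<And>k. k \<in> {1..N} \<Longrightarrow> 0 \<le> r k \<and> r k \<le> 1" and i: "i \<in> {1..N}" and j: "j \<in> {1..N}"
      and ri: "r i = 1" and rj: "r j \<le> 1 - \<eta>" for r i j
  proof -
    have ij: "i \<noteq> j" using ri rj \<eta> by auto
    define y where "y k = (if k = i \<or> k = j then (1 + r j) / 2 else r k)" for k
    have y0: "0 \<le> y k" if "k \<in> {1..N}" for k using r that j by (auto simp: y_def)
    have shift: "(\<Sum>k\<in>{1..N}. g (y k)) = (\<Sum>k\<in>{1..N}. g (r k)) + (2 * g ((1 + r j) / 2) - g 1 - g (r j))"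
      for g :: "real \<Rightarrow> real"
    proof -
      have "(\<Sum>k\<in>{1..N}. g (y k)) = (\<Sum>k\<in>{1..N}. g (r k) + (if k = i then g ((1 + r j) / 2) - g 1 else 0)
          + (if k = j then g ((1 + r j) / 2) - g (r j) else 0))"
        using ij ri by (intro sum.cong) (auto simp: y_def)
      then show ?thesis
        using i j by (simp only: sum.distrib sum.delta[OF finite_atLeastAtMost] if_True)
    qed
    have "(\<Sum>k\<in>{1..N}. r k) = (\<Sum>k\<in>{1..N}. y k)" using shift[of "\<lambda>x. x"] by (simp add: field_simps)
    then have "((\<Sum>k\<in>{1..N}. r k) / N) powr p = (\<Sum>k\<in>{1..N}. 1 / N * y k) powr p"
      by (simp add: sum_divide_distrib)
    also have "\<dots> \<le> (\<Sum>k\<in>{1..N}. 1 / N * y k powr p)"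
      using p y0 N by (intro powr_weighted_mean_le) auto
    also have "\<dots> = (\<Sum>k\<in>{1..N}. y k powr p) / N" by (simp add: sum_divide_distrib)
    also have "(\<Sum>k\<in>{1..N}. y k powr p)
        = (\<Sum>k\<in>{1..N}. r k powr p) + (2 * ((1 + r j) / 2) powr p - 1 - r j powr p)"
      using shift[of "\<lambda>x. x powr p"] by simp
    also have "\<dots> \<le> (\<Sum>k\<in>{1..N}. r k powr p) - c"
    proof -
      have "0 \<le> c * r j powr p" using c by simp
      then show ?thesis using gap[of "r j"] r[OF j] rj by (simp add: algebra_simps)
    qed
    also have "\<dots> \<le> (1 - c / N) * (\<Sum>k\<in>{1..N}. r k powr p)"
    proof -
      have "(\<Sum>k\<in>{1..N}. r k powr p) \<le> (\<Sum>k\<in>{1..N}. 1)"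
        using r p by (intro sum_mono powr_le1) auto
      then have "c / N * (\<Sum>k\<in>{1..N}. r k powr p) \<le> c / N * N"
        using c by (intro mult_left_mono) auto
      then show ?thesis using N by (simp add: algebra_simps)
    qed
    finally show ?thesis using N by (simp add: divide_right_mono)
  qed
  show thesis
  proof (rule that[of "c / N"])
    show "0 < c / N" "c / N \<le> 1" using c N by (auto simp: field_simps)
  qed (use main in blast)
qed

lemma norm_signed_sum_le:
  fixes x :: "nat \<Rightarrow> 'a::real_normed_vector"
  assumes "s \<in> cube N"
  shows "norm (\<Sum>i\<in>{1..N}. s i *\<^sub>R x i) \<le> (\<Sum>i\<in>{1..N}. norm (x i))"
  by (intro sum_norm_le) (simp add: cube_abs[OF assms])

text \<open>
  Normalize the largest norm to 1. If all norms are close to 1, the one deficient choice of signs, which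
  has weight $2^{-N}$ in the average, gains a fixed factor. Otherwise two norms are
  far apart and the triangle inequality followed by strict convexity of the power gains. A bound
  on the average over all signs, unlike one for a single choice, can be integrated over the cube.
\<close>

lemma sign_deficient_average:
  assumes def: "sign_deficient TYPE('a::real_normed_vector) N \<delta>"
    and N: "1 \<le> N" and \<delta>: "0 < \<delta>" "\<delta> < 1" and p: "1 < p"
  obtains c where "0 < c" "c \<le> 1"
    "\<And>x :: nat \<Rightarrow> 'a. (\<Sum>s\<in>cube N. norm (\<Sum>i\<in>{1..N}. s i *\<^sub>R x i) powr p) / 2 ^ N
      \<le> N powr p * (1 - c) * ((\<Sum>i\<in>{1..N}. norm (x i) powr p) / N)"
proof -
  \<comment> \<open>The gain when all norms are comparable; it is shared equally between the threshold \<open>\<eta>\<close> and the conclusion.\<close>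
  define A where "A = 1 - (1 - (1 - \<delta>) powr p) / 2 ^ N"
  have d: "0 < (1 - \<delta>) powr p" "(1 - \<delta>) powr p < 1"
    using \<delta> p powr_less_mono2[of p "1 - \<delta>" 1] by auto
  have "(1 - (1 - \<delta>) powr p) / 2 ^ N \<le> (1 - (1 - \<delta>) powr p) / 1"
    using d by (intro divide_left_mono) auto
  moreover have "0 < (1 - (1 - \<delta>) powr p) / 2 ^ N" using d by simp
  ultimately have "0 < A" using d unfolding A_def div_by_1 by linarith
  have "A < 1" using \<open>0 < (1 - (1 - \<delta>) powr p) / 2 ^ N\<close> unfolding A_def by linarith
  note A = \<open>0 < A\<close> \<open>A < 1\<close>
  define \<eta> where "\<eta> = 1 - A powr (1 / (2 * p))"
  have "A powr (1 / (2 * p)) < 1" using A p powr_less_mono2[of "1 / (2 * p)" A 1] by simp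
  then have \<eta>: "0 < \<eta>" "\<eta> < 1" using A by (auto simp: \<eta>_def)
  have \<eta>_powr: "(1 - \<eta>) powr p = sqrt A" using p A by (simp add: \<eta>_def powr_powr powr_half_sqrt)
  obtain c where c: "0 < c" "c \<le> 1"
    "\<And>r i j. (\<And>k. k \<in> {1..N} \<Longrightarrow> 0 \<le> r k \<and> r k \<le> 1) \<Longrightarrow> i \<in> {1..N} \<Longrightarrow> j \<in> {1..N} \<Longrightarrow>
      r i = 1 \<Longrightarrow> r j \<le> 1 - \<eta> \<Longrightarrow>
      ((\<Sum>k\<in>{1..N}. r k) / N) powr p \<le> (1 - c) * ((\<Sum>k\<in>{1..N}. r k powr p) / N)"
    using power_mean_gap[OF p \<eta> N] by blast
  define c' where "c' = min c (1 - sqrt A)"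
  have "0 < c'" "c' \<le> 1" using c A by (auto simp: c'_def)
  define E where "E x = (\<Sum>s\<in>cube N. norm (\<Sum>i\<in>{1..N}. s i *\<^sub>R x i) powr p) / 2 ^ N" for x :: "nat \<Rightarrow> 'a"
  define B where "B x = (\<Sum>i\<in>{1..N}. norm (x i) powr p) / N" for x :: "nat \<Rightarrow> 'a"
  have normalized: "E x \<le> N powr p * (1 - c') * B x"
    if x: "\<And>i. i \<in> {1..N} \<Longrightarrow> norm (x i) \<le> 1" and i: "i \<in> {1..N}" "norm (x i) = 1" for x :: "nat \<Rightarrow> 'a" and i
  proof (cases "\<exists>j\<in>{1..N}. norm (x j) \<le> 1 - \<eta>")
    case True
    then obtain j where j: "j \<in> {1..N}" "norm (x j) \<le> 1 - \<eta>" by blast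
    have "E x \<le> (\<Sum>s\<in>cube N. (\<Sum>i\<in>{1..N}. norm (x i)) powr p) / 2 ^ N"
      unfolding E_def using p norm_signed_sum_le by (intro divide_right_mono sum_mono powr_mono2) auto
    also have "\<dots> = (N * ((\<Sum>i\<in>{1..N}. norm (x i)) / N)) powr p" using N by (simp add: card_cube)
    also have "\<dots> = N powr p * ((\<Sum>i\<in>{1..N}. norm (x i)) / N) powr p"
      by (rule powr_mult)
    also have "\<dots> \<le> N powr p * ((1 - c) * B x)"
      unfolding B_def using x i j by (intro mult_left_mono c(3)[of "\<lambda>i. norm (x i)" i j]) auto
    also have "\<dots> \<le> N powr p * ((1 - c') * B x)"
      by (intro mult_left_mono mult_right_mono) (auto simp: c'_def B_def sum_nonneg)
    finally show ?thesis by (simp add: mult.assoc)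
  next
    case False
    obtain s0 where s0: "s0 \<in> cube N" "norm (\<Sum>i\<in>{1..N}. s0 i *\<^sub>R x i) \<le> real N * (1 - \<delta>)"
      using def x unfolding sign_deficient_def by blast
    have le: "norm (\<Sum>i\<in>{1..N}. s i *\<^sub>R x i) \<le> real N" if "s \<in> cube N" for s
    proof -
      have "(\<Sum>i\<in>{1..N}. norm (x i)) \<le> (\<Sum>i\<in>{1..N}. 1)" using x by (intro sum_mono) auto
      then show ?thesis using norm_signed_sum_le[OF that, of x] by simp
    qed
    have "(\<Sum>s\<in>cube N. norm (\<Sum>i\<in>{1..N}. s i *\<^sub>R x i) powr p)
        \<le> (real N * (1 - \<delta>)) powr p + (\<Sum>s\<in>cube N - {s0}. real N powr p)"
      unfolding sum.remove[OF finite_cube s0(1)] using s0 le p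
      by (intro add_mono sum_mono powr_mono2) auto
    also have "\<dots> = N powr p * ((1 - \<delta>) powr p + (2 ^ N - 1))"
      unfolding powr_mult[of "real N"] using s0(1)
      by (simp add: card_Diff_subset card_cube of_nat_diff algebra_simps)
    also have "\<dots> = N powr p * (2 ^ N * A)" by (simp add: A_def field_simps)
    finally have "E x \<le> N powr p * A" by (simp add: E_def field_simps)
    also have "\<dots> = N powr p * (sqrt A * sqrt A)" using A by simp
    also have "sqrt A * sqrt A \<le> (1 - c') * B x"
    proof (rule mult_mono)
      have "sqrt A = (\<Sum>i\<in>{1..N}. (1 - \<eta>) powr p) / N" using N by (simp add: \<eta>_powr)
      also have "\<dots> \<le> B x" unfolding B_def
        using False \<eta> p by (intro divide_right_mono sum_mono powr_mono2) (auto simp: not_le intro: less_imp_le)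
      finally show "sqrt A \<le> B x" .
    qed (use A \<open>c' \<le> 1\<close> in \<open>auto simp: c'_def\<close>)
    finally show ?thesis by (simp add: mult.assoc mult_left_mono)
  qed
  have "E x \<le> N powr p * (1 - c') * B x" for x :: "nat \<Rightarrow> 'a"
  proof -
    define R where "R = Max ((\<lambda>i. norm (x i)) ` {1..N})"
    have ne: "(\<lambda>i. norm (x i)) ` {1..N} \<noteq> {}" using N by simp
    have R: "norm (x i) \<le> R" if "i \<in> {1..N}" for i
      unfolding R_def using that by (intro Max_ge) auto
    have "R \<in> (\<lambda>i. norm (x i)) ` {1..N}" unfolding R_def by (intro Max_in ne) simp
    then obtain i where i: "i \<in> {1..N}" "R = norm (x i)" by blast
    show ?thesis
    proof (cases "R = 0")
      case True
      then have "norm (x i) = 0" if "i \<in> {1..N}" for i using R[OF that] by simp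
      then have "x i = 0" if "i \<in> {1..N}" for i using that by simp
      then show ?thesis by (simp add: E_def B_def)
    next
      case False
      then have R0: "0 < R" using i by simp
      define x' where "x' i = (1 / R) *\<^sub>R x i" for i
      have x: "x = (\<lambda>i. R *\<^sub>R x' i)" using R0 by (simp add: x'_def fun_eq_iff)
      have "E x' \<le> N powr p * (1 - c') * B x'"
        by (rule normalized[of x' i]) (use R R0 i in \<open>auto simp: x'_def\<close>)
      moreover have "E x = R powr p * E x'"
      proof -
        have "norm (\<Sum>i\<in>{1..N}. s i *\<^sub>R x i) = R * norm (\<Sum>i\<in>{1..N}. s i *\<^sub>R x' i)" for s
        proof -
          have "(\<Sum>i\<in>{1..N}. s i *\<^sub>R x i) = R *\<^sub>R (\<Sum>i\<in>{1..N}. s i *\<^sub>R x' i)"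
            unfolding x scaleR_sum_right by (simp add: mult.commute)
          then show ?thesis using R0 by simp
        qed
        then show ?thesis using R0 by (simp add: E_def powr_mult sum_distrib_left)
      qed
      moreover have "B x = R powr p * B x'"
        unfolding x using R0 by (simp add: B_def powr_mult sum_distrib_left)
      ultimately show ?thesis using R0 by (simp add: mult_left_mono mult.left_commute)
    qed
  qed
  then show thesis using that[of c'] \<open>0 < c'\<close> \<open>c' \<le> 1\<close> by (simp add: E_def B_def)
qed

text \<open>
  Integrating the pointwise bound over the cube bounds the average over signs of the $p$-th powers of the
  $L_p$ norms; some choice of signs is at most average.
\<close>

lemma sign_deficient_Lp:
  assumes def: "sign_deficient TYPE('a::real_normed_vector) N \<delta>"
    and N: "1 \<le> N" and \<delta>: "0 < \<delta>" "\<delta> < 1" and p: "1 < p"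
  obtains \<delta>' where "0 < \<delta>'" "Lp_sign_deficient TYPE('a) p N \<delta>'"
proof -
  obtain c where c: "0 < c" "c \<le> 1"
    and avg: "\<And>x :: nat \<Rightarrow> 'a. (\<Sum>s\<in>cube N. norm (\<Sum>i\<in>{1..N}. s i *\<^sub>R x i) powr p) / 2 ^ N
      \<le> N powr p * (1 - c) * ((\<Sum>i\<in>{1..N}. norm (x i) powr p) / N)"
    using sign_deficient_average[OF assms] by blast
  define b where "b = (1 - c) powr (1 / p)"
  have b: "0 \<le> b" "b < 1" "b powr p = 1 - c"
    using c p powr_less_mono2[of "1 / p" "1 - c" 1] by (auto simp: b_def powr_powr)
  have "\<exists>s\<in>cube N. Lp_norm n p (\<lambda>\<epsilon>. \<Sum>i\<in>{1..N}. s i *\<^sub>R f i \<epsilon>) \<le> N * b * F"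
    if f: "\<And>i. i \<in> {1..N} \<Longrightarrow> Lp_norm n p (f i) \<le> F" for n F and f :: "nat \<Rightarrow> (nat \<Rightarrow> real) \<Rightarrow> 'a"
  proof (rule ccontr)
    assume neg: "\<not> ?thesis"
    define S where "S s = Lp_norm n p (\<lambda>\<epsilon>. \<Sum>i\<in>{1..N}. s i *\<^sub>R f i \<epsilon>)" for s
    have F: "0 \<le> F" using f[of 1] N Lp_norm_nonneg[of n p "f 1"] by simp
    have "N * b * F < S s" if "s \<in> cube N" for s using neg that by (auto simp: S_def not_le)
    then have "(\<Sum>s\<in>cube N. (N * b * F) powr p) < (\<Sum>s\<in>cube N. S s powr p)"
      using F b p by (intro sum_strict_mono powr_less_mono2) auto
    also have "\<dots> = (\<Sum>s\<in>cube N. \<Sum>\<epsilon>\<in>cube n. norm (\<Sum>i\<in>{1..N}. s i *\<^sub>R f i \<epsilon>) powr p / 2 ^ n)"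
      unfolding S_def Lp_norm_powr[OF p] sum_divide_distrib ..
    also have "\<dots> = 2 ^ N / 2 ^ n * (\<Sum>\<epsilon>\<in>cube n. (\<Sum>s\<in>cube N. norm (\<Sum>i\<in>{1..N}. s i *\<^sub>R f i \<epsilon>) powr p) / 2 ^ N)"
      by (subst sum.swap) (simp add: sum_distrib_left sum_divide_distrib)
    also have "\<dots> \<le> 2 ^ N / 2 ^ n * (\<Sum>\<epsilon>\<in>cube n. N powr p * (1 - c) * ((\<Sum>i\<in>{1..N}. norm (f i \<epsilon>) powr p) / N))"
      by (intro mult_left_mono sum_mono avg) auto
    also have "\<dots> = 2 ^ N * (N powr p * (1 - c) * ((\<Sum>i\<in>{1..N}. (\<Sum>\<epsilon>\<in>cube n. norm (f i \<epsilon>) powr p) / 2 ^ n) / N))"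
      by (simp add: sum_distrib_left sum_divide_distrib sum.swap[of _ "{1..N}" "cube n"] mult_ac
        del: One_nat_def)
    also have "\<dots> \<le> 2 ^ N * (N powr p * (1 - c) * ((\<Sum>i\<in>{1..N}. F powr p) / N))"
      unfolding Lp_norm_powr[OF p, symmetric] using f p c
      by (intro mult_left_mono divide_right_mono sum_mono powr_mono2) (auto simp: Lp_norm_nonneg)
    also have "\<dots> = 2 ^ N * (N * b * F) powr p"
      using N F b by (simp add: powr_mult)
    finally show False by (simp add: card_cube)
  qed
  then have "Lp_sign_deficient TYPE('a) p N (1 - b)" by (simp add: Lp_sign_deficient_def)
  then show thesis using that[of "1 - b"] b by simp
qed

section \<open>Walsh multipliers and conditional expectations\<close>

lemma scaleC_scaleR: "a *\<^sub>C (r *\<^sub>R x) = r *\<^sub>R (a *\<^sub>C (x :: 'a::complex_banach))"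
  unfolding scaleC_of_real[symmetric] scaleC_scaleC by (simp add: mult.commute)

lemma scaleC_zero_right [simp]: "a *\<^sub>C (0 :: 'a::complex_banach) = 0"
  using norm_scaleC[of a "0 :: 'a"] by simp

lemma scaleC_zero_left [simp]: "0 *\<^sub>C (x :: 'a::complex_banach) = 0"
  using norm_scaleC[of 0 x] by simp

lemma scaleC_one [simp]: "1 *\<^sub>C (x :: 'a::complex_banach) = x"
  using scaleC_of_real[of 1 x] by simp

lemma scaleC_sum_right: "a *\<^sub>C (\<Sum>i\<in>I. f i) = (\<Sum>i\<in>I. a *\<^sub>C (f i :: 'a::complex_banach))"
  by (induction I rule: infinite_finite_induct) (auto simp: scaleC_add_right)

lemma scaleC_sum_left: "(\<Sum>i\<in>I. f i) *\<^sub>C (x :: 'a::complex_banach) = (\<Sum>i\<in>I. f i *\<^sub>C x)"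
  by (induction I rule: infinite_finite_induct) (auto simp: scaleC_add_left)

definition walsh_multiplier ::
  "nat \<Rightarrow> (nat set \<Rightarrow> complex) \<Rightarrow> ((nat \<Rightarrow> real) \<Rightarrow> 'a::complex_banach) \<Rightarrow> (nat \<Rightarrow> real) \<Rightarrow> 'a" where
  "walsh_multiplier n \<mu> f \<epsilon> = (\<Sum>A\<in>Pow {1..n}. \<mu> A *\<^sub>C walsh A \<epsilon> *\<^sub>R walsh_coeff n f A)"

lemma walsh_multiplier_cong:
  assumes "\<And>A. A \<subseteq> {1..n} \<Longrightarrow> \<mu> A = \<nu> A"
  shows "walsh_multiplier n \<mu> f = walsh_multiplier n \<nu> f"
  unfolding walsh_multiplier_def by (intro ext sum.cong) (auto simp: assms)

lemma walsh_multiplier_one: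
  assumes "\<epsilon> \<in> cube n"
  shows "walsh_multiplier n (\<lambda>_. 1) f \<epsilon> = f \<epsilon>"
  unfolding walsh_multiplier_def by (simp add: walsh_expansion[OF assms] del: One_nat_def)

lemma walsh_multiplier_add:
  "walsh_multiplier n (\<lambda>A. \<mu> A + \<nu> A) f \<epsilon> = walsh_multiplier n \<mu> f \<epsilon> + walsh_multiplier n \<nu> f \<epsilon>"
  by (simp add: walsh_multiplier_def scaleC_add_left sum.distrib)

lemma walsh_multiplier_scale:
  "walsh_multiplier n (\<lambda>A. c * \<mu> A) f \<epsilon> = c *\<^sub>C walsh_multiplier n \<mu> f \<epsilon>"
  by (simp add: walsh_multiplier_def scaleC_sum_right scaleC_scaleC)

lemma walsh_multiplier_sum:
  "walsh_multiplier n (\<lambda>A. \<Sum>i\<in>I. \<mu> i A) f \<epsilon> = (\<Sum>i\<in>I. walsh_multiplier n (\<mu> i) f \<epsilon>)"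
  unfolding walsh_multiplier_def scaleC_sum_left by (rule sum.swap)

lemma walsh_coeff_walsh_multiplier:
  assumes A: "A \<subseteq> {1..n}"
  shows "walsh_coeff n (walsh_multiplier n \<mu> f) A = \<mu> A *\<^sub>C walsh_coeff n f A"
proof -
  have "walsh_coeff n (walsh_multiplier n \<mu> f) A
      = (1 / 2 ^ n) *\<^sub>R (\<Sum>B\<in>Pow {1..n}. (\<Sum>\<delta>\<in>cube n. walsh A \<delta> * walsh B \<delta>) *\<^sub>R (\<mu> B *\<^sub>C walsh_coeff n f B))"
    unfolding walsh_coeff_def[of n "walsh_multiplier n \<mu> f"] walsh_multiplier_def scaleR_sum_right scaleR_sum_left
    by (subst sum.swap) (simp add: scaleC_scaleR)
  also have "(\<Sum>B\<in>Pow {1..n}. (\<Sum>\<delta>\<in>cube n. walsh A \<delta> * walsh B \<delta>) *\<^sub>R (\<mu> B *\<^sub>C walsh_coeff n f B))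
      = (\<Sum>B\<in>Pow {1..n}. if A = B then 2 ^ n *\<^sub>R (\<mu> B *\<^sub>C walsh_coeff n f B) else 0)"
    using A by (intro sum.cong) (auto simp: sum_walsh_mult simp del: One_nat_def)
  also have "\<dots> = 2 ^ n *\<^sub>R (\<mu> A *\<^sub>C walsh_coeff n f A)" using A by (simp add: sum.delta)
  finally show ?thesis by simp
qed

lemma walsh_multiplier_compose:
  "walsh_multiplier n \<mu> (walsh_multiplier n \<nu> f) = walsh_multiplier n (\<lambda>A. \<mu> A * \<nu> A) f"
  unfolding walsh_multiplier_def[of n \<mu>] walsh_multiplier_def[of n "\<lambda>A. \<mu> A * \<nu> A"]
  by (intro ext sum.cong) (auto simp: walsh_coeff_walsh_multiplier scaleC_scaleC[symmetric] scaleC_scaleR)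

lemma heat_eq_walsh_multiplier:
  "heat n t f = walsh_multiplier n (\<lambda>A. exp (- complex_of_real (t * real (card A)))) f"
  unfolding heat_def walsh_multiplier_def scaleC_of_real[symmetric]
  by (intro ext sum.cong) (auto simp flip: exp_of_real)

lemma Lp_norm_walsh_multiplier_scale:
  assumes "1 < p"
  shows "Lp_norm n p (walsh_multiplier n (\<lambda>A. c * \<mu> A) f) = cmod c * Lp_norm n p (walsh_multiplier n \<mu> f)"
  by (intro Lp_norm_scale assms) (simp_all add: walsh_multiplier_scale norm_scaleC)

lemma Lp_norm_walsh_multiplier_sum_le:
  assumes "1 < p"
  shows "Lp_norm n p (walsh_multiplier n (\<lambda>A. \<Sum>i\<in>I. c i * \<mu> i A) f)
    \<le> (\<Sum>i\<in>I. cmod (c i) * Lp_norm n p (walsh_multiplier n (\<mu> i) f))"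
proof -
  have "Lp_norm n p (walsh_multiplier n (\<lambda>A. \<Sum>i\<in>I. c i * \<mu> i A) f)
      = Lp_norm n p (\<lambda>\<epsilon>. \<Sum>i\<in>I. walsh_multiplier n (\<lambda>A. c i * \<mu> i A) f \<epsilon>)"
    by (intro Lp_norm_cong) (simp add: walsh_multiplier_sum)
  also have "\<dots> \<le> (\<Sum>i\<in>I. Lp_norm n p (walsh_multiplier n (\<lambda>A. c i * \<mu> i A) f))"
    by (rule Lp_norm_sum_le[OF assms])
  finally show ?thesis by (simp add: Lp_norm_walsh_multiplier_scale[OF assms])
qed

text \<open>
  The multiplier of the conditional expectation that averages over the coordinates in \<open>U\<close>: it keeps
  exactly the Walsh functions that do not depend on them.
\<close>

definition avoids :: "nat set \<Rightarrow> nat set \<Rightarrow> complex" where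
  "avoids U A = (if A \<inter> U = {} then 1 else 0)"

definition flip :: "nat set \<Rightarrow> (nat \<Rightarrow> real) \<Rightarrow> (nat \<Rightarrow> real) \<Rightarrow> nat \<Rightarrow> real" where
  "flip U \<tau> \<epsilon> i = (if i \<in> U then \<tau> i * \<epsilon> i else \<epsilon> i)"

lemma flip_bij:
  assumes "U \<subseteq> {1..n}" "\<tau> \<in> cube n"
  shows "bij_betw (flip U \<tau>) (cube n) (cube n)"
proof (rule bij_betwI[where g = "flip U \<tau>"])
  have mem: "flip U \<tau> \<epsilon> \<in> cube n" if "\<epsilon> \<in> cube n" for \<epsilon>
  proof -
    have "flip U \<tau> \<epsilon> i \<in> {-1, 1}" if "i \<in> {1..n}" for i
      using cubeD[OF assms(2) that] cubeD[OF \<open>\<epsilon> \<in> cube n\<close> that] by (auto simp: flip_def)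
    moreover have "flip U \<tau> \<epsilon> i = undefined" if "i \<notin> {1..n}" for i
      using that assms(1) \<open>\<epsilon> \<in> cube n\<close> by (auto simp: flip_def cube_def PiE_iff extensional_def)
    ultimately show ?thesis by (auto simp: cube_def PiE_iff extensional_def)
  qed
  then show "flip U \<tau> \<in> cube n \<rightarrow> cube n" "flip U \<tau> \<in> cube n \<rightarrow> cube n" by auto
  have "flip U \<tau> (flip U \<tau> \<epsilon>) = \<epsilon>" for \<epsilon>
    using assms cube_square[OF assms(2)] by (auto simp: flip_def fun_eq_iff subset_iff simp flip: mult.assoc)
  then show "\<And>x. x \<in> cube n \<Longrightarrow> flip U \<tau> (flip U \<tau> x) = x"
    "\<And>x. x \<in> cube n \<Longrightarrow> flip U \<tau> (flip U \<tau> x) = x" by auto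
qed

lemma walsh_flip: "finite A \<Longrightarrow> walsh A (flip U \<tau> \<epsilon>) = walsh (A \<inter> U) \<tau> * walsh A \<epsilon>"
proof -
  assume fin: "finite A"
  have "walsh A (flip U \<tau> \<epsilon>) = (\<Prod>i\<in>A. (if i \<in> U then \<tau> i else 1) * \<epsilon> i)"
    unfolding walsh_def by (intro prod.cong) (auto simp: flip_def)
  then show ?thesis using fin by (simp add: walsh_def prod.distrib prod.inter_restrict)
qed

lemma Lp_norm_flip:
  assumes "U \<subseteq> {1..n}" "\<tau> \<in> cube n"
  shows "Lp_norm n p (\<lambda>\<epsilon>. f (flip U \<tau> \<epsilon>)) = Lp_norm n p f"
  unfolding Lp_norm_def by (subst sum.reindex_bij_betw[OF flip_bij[OF assms], of "\<lambda>\<epsilon>. norm (f \<epsilon>) powr p"]) rule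

text \<open>
  The conditional expectation is the average, over random signs, of the isometries that multiply the
  coordinates in \<open>U\<close> by these signs.
\<close>

lemma conditional_expectation_contractive:
  fixes f :: "(nat \<Rightarrow> real) \<Rightarrow> 'a::complex_banach"
  assumes U: "U \<subseteq> {1..n}" and p: "1 < p"
  shows "Lp_norm n p (walsh_multiplier n (avoids U) f) \<le> Lp_norm n p f"
proof -
  have eq: "walsh_multiplier n (avoids U) f \<epsilon> = (\<Sum>\<tau>\<in>cube n. (1 / 2 ^ n) *\<^sub>R f (flip U \<tau> \<epsilon>))"
    if \<epsilon>: "\<epsilon> \<in> cube n" for \<epsilon>
  proof -
    have "(\<Sum>\<tau>\<in>cube n. (1 / 2 ^ n) *\<^sub>R f (flip U \<tau> \<epsilon>))
        = (\<Sum>\<tau>\<in>cube n. (1 / 2 ^ n) *\<^sub>R (\<Sum>A\<in>Pow {1..n}. walsh A (flip U \<tau> \<epsilon>) *\<^sub>R walsh_coeff n f A))"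
      using bij_betwE[OF flip_bij[OF U]] \<epsilon> by (intro sum.cong) (simp_all add: walsh_expansion del: One_nat_def)
    also have "\<dots> = (\<Sum>A\<in>Pow {1..n}. ((1 / 2 ^ n) * (\<Sum>\<tau>\<in>cube n. walsh (A \<inter> U) \<tau>)) *\<^sub>R walsh A \<epsilon> *\<^sub>R walsh_coeff n f A)"
      unfolding scaleR_sum_right sum_distrib_left scaleR_sum_left
      by (subst sum.swap) (auto intro!: sum.cong simp: walsh_flip finite_subset)
    also have "\<dots> = (\<Sum>A\<in>Pow {1..n}. avoids U A *\<^sub>C walsh A \<epsilon> *\<^sub>R walsh_coeff n f A)"
    proof (rule sum.cong)
      fix A assume "A \<in> Pow {1..n}"
      then have "A \<inter> U \<subseteq> {1..n}" by auto
      from sum_walsh[OF this] show "((1 / 2 ^ n) * (\<Sum>\<tau>\<in>cube n. walsh (A \<inter> U) \<tau>)) *\<^sub>R walsh A \<epsilon> *\<^sub>R walsh_coeff n f A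
          = avoids U A *\<^sub>C walsh A \<epsilon> *\<^sub>R walsh_coeff n f A"
        by (simp add: avoids_def)
    qed simp
    finally show ?thesis by (simp add: walsh_multiplier_def)
  qed
  have "Lp_norm n p (walsh_multiplier n (avoids U) f)
      = Lp_norm n p (\<lambda>\<epsilon>. \<Sum>\<tau>\<in>cube n. (1 / 2 ^ n) *\<^sub>R f (flip U \<tau> \<epsilon>))"
    by (intro Lp_norm_cong) (simp add: eq)
  also have "\<dots> \<le> (\<Sum>\<tau>\<in>cube n. Lp_norm n p (\<lambda>\<epsilon>. (1 / 2 ^ n) *\<^sub>R f (flip U \<tau> \<epsilon>)))"
    by (rule Lp_norm_sum_le[OF p])
  also have "\<dots> = (\<Sum>\<tau>\<in>cube n. 1 / 2 ^ n * Lp_norm n p f)"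
  proof (rule sum.cong)
    fix \<tau> assume "\<tau> \<in> cube n"
    have "Lp_norm n p (\<lambda>\<epsilon>. (1 / 2 ^ n) *\<^sub>R f (flip U \<tau> \<epsilon>))
        = 1 / 2 ^ n * Lp_norm n p (\<lambda>\<epsilon>. f (flip U \<tau> \<epsilon>))"
      by (intro Lp_norm_scale p) auto
    then show "Lp_norm n p (\<lambda>\<epsilon>. (1 / 2 ^ n) *\<^sub>R f (flip U \<tau> \<epsilon>)) = 1 / 2 ^ n * Lp_norm n p f"
      unfolding Lp_norm_flip[OF U \<open>\<tau> \<in> cube n\<close>] .
  qed simp
  also have "\<dots> = Lp_norm n p f" by (simp add: card_cube)
  finally show ?thesis .
qed

lemma avoids_Un: "avoids U A * avoids V A = avoids (U \<union> V) A"
  by (auto simp: avoids_def)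

lemma prod_avoids: "finite B \<Longrightarrow> (\<Prod>j\<in>B. avoids (U j) A) = avoids (\<Union>j\<in>B. U j) A"
  by (induction B rule: finite_induct) (auto simp: avoids_Un, simp add: avoids_def)

text \<open>
  Expand the product as $\sum_B y_B$ with $y_B = (-1)^{|B|} E_B$, where $E_B$ averages over the union of the
  sets \<open>U j\<close>, $j \in B$. Choose signs \<open>s\<close> for which $\sum_j s_j E_j f$ is short, let \<open>D\<close> be the set of
  indices with negative sign, and apply $E_D$. The result is, up to a sign,
  $\sum_j y_{D \cup \{j\}} f$: these are \<open>N\<close> terms of the expansion whose sum is shorter than \<open>N\<close>.
  Writing \<open>N\<close> copies of the expansion as this sum and \<open>N * (2 ^ N - 1)\<close> further
  contractions gives the gap.
\<close>

lemma product_of_complements_gap: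
  fixes f :: "(nat \<Rightarrow> real) \<Rightarrow> 'a::complex_banach"
  assumes p: "1 < p" and N: "1 \<le> N"
    and deficient: "Lp_sign_deficient TYPE('a) p N \<delta>"
    and U: "\<And>j. j \<in> {1..N} \<Longrightarrow> U j \<subseteq> {1..n}"
  shows "Lp_norm n p (walsh_multiplier n (\<lambda>A. \<Prod>j\<in>{1..N}. 1 - avoids (U j) A) f)
    \<le> (2 ^ N - \<delta>) * Lp_norm n p f"
proof -
  define F where "F = Lp_norm n p f"
  define G where "G \<mu> = Lp_norm n p (walsh_multiplier n \<mu> f)" for \<mu>
  define V where "V B = (\<Union>j\<in>B. U j)" for B
  define y where "y B A = (-1) ^ card B * avoids (V B) A" for B A
  have F: "0 \<le> F" by (simp add: F_def Lp_norm_nonneg)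
  have V: "V B \<subseteq> {1..n}" if "B \<subseteq> {1..N}" for B
    unfolding V_def by (rule UN_least) (use U that in blast)
  have y_le: "G (y B) \<le> F" if "B \<subseteq> {1..N}" for B
    unfolding G_def y_def Lp_norm_walsh_multiplier_scale[OF p]
    using conditional_expectation_contractive[OF V[OF that] p] by (simp add: norm_power F_def)
  have expand: "(\<Prod>j\<in>{1..N}. 1 - avoids (U j) A) = (\<Sum>B\<in>Pow {1..N}. y B A)" for A
  proof -
    have "(\<Prod>j\<in>{1..N}. 1 - avoids (U j) A) = (\<Prod>j\<in>{1..N}. - avoids (U j) A + 1)" by simp
    also have "\<dots> = (\<Sum>B\<in>Pow {1..N}. (\<Prod>j\<in>B. - avoids (U j) A) * (\<Prod>j\<in>{1..N} - B. 1))"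
      by (rule prod_add) simp
    also have "\<dots> = (\<Sum>B\<in>Pow {1..N}. y B A)"
    proof (rule sum.cong)
      fix B assume "B \<in> Pow {1..N}"
      then have "finite B" by (auto intro: finite_subset)
      then show "(\<Prod>j\<in>B. - avoids (U j) A) * (\<Prod>j\<in>{1..N} - B. 1) = y B A"
        using prod.distrib[of "\<lambda>_. -1" "\<lambda>j. avoids (U j) A" B]
        by (simp add: y_def V_def prod_avoids)
    qed simp
    finally show ?thesis .
  qed
  have "\<forall>i\<in>{1..N}. Lp_norm n p (walsh_multiplier n (avoids (U i)) f) \<le> F"
    unfolding F_def using conditional_expectation_contractive[OF U p] by blast
  then obtain s where s: "s \<in> cube N"
    and s_le: "Lp_norm n p (\<lambda>\<epsilon>. \<Sum>i\<in>{1..N}. s i *\<^sub>R walsh_multiplier n (avoids (U i)) f \<epsilon>) \<le> N * (1 - \<delta>) * F"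
    using deficient[unfolded Lp_sign_deficient_def, THEN spec, THEN spec, THEN spec, THEN mp,
        of n "\<lambda>i. walsh_multiplier n (avoids (U i)) f" F] by blast
  define D where "D = {j \<in> {1..N}. s j = -1}"
  have D: "D \<subseteq> {1..N}" "finite D" by (auto simp: D_def)
  \<comment> \<open>Signs: for \<open>j \<in> D\<close> inserting \<open>j\<close> changes nothing and \<open>s j = -1\<close>; for \<open>j \<notin> D\<close> it changes the parity and \<open>s j = 1\<close>.\<close>
  have y_insert: "y (insert j D) A = - ((-1) ^ card D) * (avoids (V D) A * (complex_of_real (s j) * avoids (U j) A))"
    if j: "j \<in> {1..N}" for j A
  proof (cases "j \<in> D")
    case True
    have "avoids (V D) A * avoids (U j) A = avoids (V D) A"
      unfolding avoids_Un using True by (auto simp: V_def intro!: arg_cong2[of _ _ _ _ avoids])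
    then show ?thesis using True by (simp add: y_def insert_absorb D_def)
  next
    case False
    then have "s j = 1" using j cubeD[OF s j] by (auto simp: D_def)
    then show ?thesis using False D(2)
      by (simp add: y_def V_def avoids_Un Un_commute)
  qed
  have W: "G (\<lambda>A. \<Sum>j\<in>{1..N}. y (insert j D) A) \<le> N * (1 - \<delta>) * F"
  proof -
    define g where "g = walsh_multiplier n (\<lambda>A. \<Sum>j\<in>{1..N}. complex_of_real (s j) * avoids (U j) A) f"
    have g: "g \<epsilon> = (\<Sum>i\<in>{1..N}. s i *\<^sub>R walsh_multiplier n (avoids (U i)) f \<epsilon>)" for \<epsilon>
      unfolding g_def walsh_multiplier_sum walsh_multiplier_scale scaleC_of_real ..
    have "(\<lambda>A. \<Sum>j\<in>{1..N}. y (insert j D) A) = (\<lambda>A. - ((-1) ^ card D) *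
        (avoids (V D) A * (\<Sum>j\<in>{1..N}. complex_of_real (s j) * avoids (U j) A)))"
      unfolding sum_distrib_left by (intro ext sum.cong) (simp_all only: y_insert)
    then have "G (\<lambda>A. \<Sum>j\<in>{1..N}. y (insert j D) A) = Lp_norm n p (walsh_multiplier n (avoids (V D)) g)"
      unfolding G_def g_def walsh_multiplier_compose by (simp only: Lp_norm_walsh_multiplier_scale[OF p]) (simp add: norm_power)
    also have "\<dots> \<le> Lp_norm n p g" by (rule conditional_expectation_contractive[OF V[OF D(1)] p])
    also have "\<dots> \<le> N * (1 - \<delta>) * F" using s_le by (simp add: g[abs_def])
    finally show ?thesis .
  qed
  define Y where "Y A = (\<Sum>B\<in>Pow {1..N}. y B A)" for A
  have Y_split: "Y A = y (insert j D) A + (\<Sum>B\<in>Pow {1..N} - {insert j D}. y B A)" if "j \<in> {1..N}" for j A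
    unfolding Y_def using that D by (intro sum.remove) auto
  have "real N * G Y = G (\<lambda>A. of_nat N * Y A)"
    unfolding G_def by (simp add: Lp_norm_walsh_multiplier_scale[OF p])
  also have "(\<lambda>A. of_nat N * Y A)
      = (\<lambda>A. (\<Sum>j\<in>{1..N}. y (insert j D) A) + (\<Sum>j\<in>{1..N}. \<Sum>B\<in>Pow {1..N} - {insert j D}. y B A))"
  proof
    fix A
    have "of_nat N * Y A = (\<Sum>j\<in>{1..N}. Y A)" by simp
    also have "\<dots> = (\<Sum>j\<in>{1..N}. y (insert j D) A + (\<Sum>B\<in>Pow {1..N} - {insert j D}. y B A))"
      by (intro sum.cong Y_split) auto
    finally show "of_nat N * Y A = (\<Sum>j\<in>{1..N}. y (insert j D) A)
        + (\<Sum>j\<in>{1..N}. \<Sum>B\<in>Pow {1..N} - {insert j D}. y B A)"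
      by (simp only: sum.distrib)
  qed
  also have "G \<dots> \<le> G (\<lambda>A. \<Sum>j\<in>{1..N}. y (insert j D) A)
      + G (\<lambda>A. \<Sum>j\<in>{1..N}. \<Sum>B\<in>Pow {1..N} - {insert j D}. y B A)"
    unfolding G_def
    using Lp_norm_triangle[OF p, of n "walsh_multiplier n (\<lambda>A. \<Sum>j\<in>{1..N}. y (insert j D) A) f"
        "walsh_multiplier n (\<lambda>A. \<Sum>j\<in>{1..N}. \<Sum>B\<in>Pow {1..N} - {insert j D}. y B A) f"]
    by (simp only: walsh_multiplier_add[symmetric])
  also have "G (\<lambda>A. \<Sum>j\<in>{1..N}. \<Sum>B\<in>Pow {1..N} - {insert j D}. y B A)
      \<le> (\<Sum>j\<in>{1..N}. \<Sum>B\<in>Pow {1..N} - {insert j D}. G (y B))"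
  proof -
    have "G (\<lambda>A. \<Sum>j\<in>{1..N}. \<Sum>B\<in>Pow {1..N} - {insert j D}. y B A)
        \<le> (\<Sum>j\<in>{1..N}. G (\<lambda>A. \<Sum>B\<in>Pow {1..N} - {insert j D}. y B A))"
      unfolding G_def
      using Lp_norm_walsh_multiplier_sum_le[OF p, of n "\<lambda>_. 1"
          "\<lambda>j A. \<Sum>B\<in>Pow {1..N} - {insert j D}. y B A" "{1..N}" f] by simp
    also have "\<dots> \<le> (\<Sum>j\<in>{1..N}. \<Sum>B\<in>Pow {1..N} - {insert j D}. G (y B))"
      unfolding G_def
      using Lp_norm_walsh_multiplier_sum_le[OF p, of n "\<lambda>_. 1" y _ f] by (intro sum_mono) simp
    finally show ?thesis .
  qed
  also have "\<dots> \<le> (\<Sum>j\<in>{1..N}. \<Sum>B\<in>Pow {1..N} - {insert j D}. F)"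
    by (intro sum_mono y_le) auto
  also have "\<dots> = (\<Sum>j\<in>{1..N}. (2 ^ N - 1) * F)"
  proof (rule sum.cong)
    fix j assume "j \<in> {1..N}"
    then have "insert j D \<in> Pow {1..N}" using D by auto
    then have "card (Pow {1..N} - {insert j D}) = 2 ^ N - 1"
      by (simp add: card_Diff_singleton card_Pow)
    then show "(\<Sum>B\<in>Pow {1..N} - {insert j D}. F) = (2 ^ N - 1) * F" by (simp add: of_nat_diff)
  qed simp
  also note W
  finally have "real N * G Y \<le> N * ((2 ^ N - \<delta>) * F)" by (simp add: algebra_simps)
  then have "G Y \<le> (2 ^ N - \<delta>) * F" using N by simp
  then show ?thesis unfolding G_def F_def expand Y_def .
qed

text \<open>
  The heat semigroup is a mixture of conditional expectations: with $q = e^{-t}$, average over the random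
  set that contains each coordinate independently with probability \<open>1 - q\<close>.
\<close>

lemma heat_multiplier_mixture:
  assumes A: "A \<subseteq> {1..n}"
  shows "(\<Sum>U\<in>Pow {1..n}. complex_of_real ((1 - q) ^ card U * q ^ card ({1..n} - U)) * avoids U A)
    = complex_of_real (q ^ card A)"
proof -
  have "(\<Sum>U\<in>Pow {1..n}. complex_of_real ((1 - q) ^ card U * q ^ card ({1..n} - U)) * avoids U A)
      = (\<Sum>U\<in>Pow {1..n}. (\<Prod>i\<in>U. complex_of_real (1 - q) * avoids {i} A) * (\<Prod>i\<in>{1..n} - U. complex_of_real q))"
  proof (rule sum.cong)
    fix U assume "U \<in> Pow {1..n}"
    then have "finite U" by (auto intro: finite_subset)
    then have "(\<Prod>i\<in>U. avoids {i} A) = avoids U A" by (subst prod_avoids) auto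
    then show "complex_of_real ((1 - q) ^ card U * q ^ card ({1..n} - U)) * avoids U A
        = (\<Prod>i\<in>U. complex_of_real (1 - q) * avoids {i} A) * (\<Prod>i\<in>{1..n} - U. complex_of_real q)"
      by (simp add: prod.distrib)
  qed simp
  also have "\<dots> = (\<Prod>i\<in>{1..n}. complex_of_real (1 - q) * avoids {i} A + complex_of_real q)"
    by (rule prod_add[symmetric]) simp
  also have "\<dots> = (\<Prod>i\<in>{1..n}. if i \<in> A then complex_of_real q else 1)"
    by (intro prod.cong) (auto simp: avoids_def)
  also have "\<dots> = complex_of_real (q ^ card A)"
    using A by (simp add: prod.If_cases Int_absorb1 del: One_nat_def)
  finally show ?thesis .
qed

lemma mixture_weights_sum:
  fixes q :: real and n :: nat
  shows "(\<Sum>U\<in>Pow {1..n}. (1 - q) ^ card U * q ^ card ({1..n} - U)) = 1"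
proof -
  have "complex_of_real (\<Sum>U\<in>Pow {1..n}. (1 - q) ^ card U * q ^ card ({1..n} - U)) = 1"
    using heat_multiplier_mixture[of "{}" n q] by (simp add: avoids_def)
  then show ?thesis by (simp only: of_real_eq_1_iff)
qed

lemma heat_contractive:
  fixes f :: "(nat \<Rightarrow> real) \<Rightarrow> 'a::complex_banach"
  assumes p: "1 < p" and q: "0 \<le> q" "q \<le> 1"
  shows "Lp_norm n p (walsh_multiplier n (\<lambda>A. complex_of_real (q ^ card A)) f) \<le> Lp_norm n p f"
proof -
  define w where "w U = (1 - q) ^ card U * q ^ card ({1..n} - U)" for U
  have w: "0 \<le> w U" for U using q by (simp add: w_def)
  have "walsh_multiplier n (\<lambda>A. complex_of_real (q ^ card A)) f
      = walsh_multiplier n (\<lambda>A. \<Sum>U\<in>Pow {1..n}. complex_of_real (w U) * avoids U A) f"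
    unfolding w_def by (intro walsh_multiplier_cong) (simp only: heat_multiplier_mixture)
  then have "Lp_norm n p (walsh_multiplier n (\<lambda>A. complex_of_real (q ^ card A)) f)
      = Lp_norm n p (walsh_multiplier n (\<lambda>A. \<Sum>U\<in>Pow {1..n}. complex_of_real (w U) * avoids U A) f)"
    by (rule arg_cong)
  also have "\<dots> \<le> (\<Sum>U\<in>Pow {1..n}. cmod (complex_of_real (w U)) * Lp_norm n p (walsh_multiplier n (avoids U) f))"
    by (rule Lp_norm_walsh_multiplier_sum_le[OF p])
  also have "\<dots> \<le> (\<Sum>U\<in>Pow {1..n}. w U * Lp_norm n p f)"
    using w p by (intro sum_mono mult_mono conditional_expectation_contractive) (auto simp: Lp_norm_nonneg)
  also have "\<dots> = Lp_norm n p f"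
    unfolding sum_distrib_right[symmetric] w_def mixture_weights_sum by simp
  finally show ?thesis .
qed

text \<open>
  Expand each of the \<open>N\<close> factors $I - T_t$ as an average over independent random sets; every term is a product
  of complements of commuting conditional expectations.
\<close>

lemma heat_difference_gap:
  fixes f :: "(nat \<Rightarrow> real) \<Rightarrow> 'a::complex_banach"
  assumes p: "1 < p" and N: "1 \<le> N" and q: "0 \<le> q" "q \<le> 1"
    and deficient: "Lp_sign_deficient TYPE('a) p N \<delta>"
  shows "Lp_norm n p (walsh_multiplier n (\<lambda>A. (1 - complex_of_real (q ^ card A)) ^ N) f)
    \<le> (2 ^ N - \<delta>) * Lp_norm n p f"
proof -
  define w where "w U = (1 - q) ^ card U * q ^ card ({1..n} - U)" for U
  have w: "0 \<le> w U" for U using q by (simp add: w_def)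
  define \<G> where "\<G> = (\<Pi>\<^sub>E j\<in>{1..N}. Pow {1..n})"
  have mult: "(1 - complex_of_real (q ^ card A)) ^ N
      = (\<Sum>g\<in>\<G>. complex_of_real (\<Prod>j\<in>{1..N}. w (g j)) * (\<Prod>j\<in>{1..N}. 1 - avoids (g j) A))"
    if A: "A \<subseteq> {1..n}" for A
  proof -
    have "1 - complex_of_real (q ^ card A)
        = complex_of_real (\<Sum>U\<in>Pow {1..n}. w U) - (\<Sum>U\<in>Pow {1..n}. complex_of_real (w U) * avoids U A)"
      unfolding w_def heat_multiplier_mixture[OF A] mixture_weights_sum by simp
    also have "\<dots> = (\<Sum>U\<in>Pow {1..n}. complex_of_real (w U) * (1 - avoids U A))"
      by (simp add: right_diff_distrib sum_subtractf)
    finally have "(1 - complex_of_real (q ^ card A)) ^ N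
        = (\<Prod>j\<in>{1..N}. \<Sum>U\<in>Pow {1..n}. complex_of_real (w U) * (1 - avoids U A))" by simp
    also have "\<dots> = (\<Sum>g\<in>\<G>. \<Prod>j\<in>{1..N}. complex_of_real (w (g j)) * (1 - avoids (g j) A))"
      unfolding \<G>_def by (rule prod_sum_PiE) auto
    finally show ?thesis by (simp add: prod.distrib)
  qed
  have total: "(\<Sum>g\<in>\<G>. \<Prod>j\<in>{1..N}. w (g j)) = 1"
  proof -
    have "(\<Sum>g\<in>\<G>. \<Prod>j\<in>{1..N}. w (g j)) = (\<Prod>j\<in>{1..N}. \<Sum>U\<in>Pow {1..n}. w U)"
      unfolding \<G>_def by (rule prod_sum_PiE[symmetric]) auto
    then show ?thesis unfolding w_def mixture_weights_sum by simp
  qed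
  have "walsh_multiplier n (\<lambda>A. (1 - complex_of_real (q ^ card A)) ^ N) f
      = walsh_multiplier n (\<lambda>A. \<Sum>g\<in>\<G>. complex_of_real (\<Prod>j\<in>{1..N}. w (g j)) * (\<Prod>j\<in>{1..N}. 1 - avoids (g j) A)) f"
    by (intro walsh_multiplier_cong mult)
  then have "Lp_norm n p (walsh_multiplier n (\<lambda>A. (1 - complex_of_real (q ^ card A)) ^ N) f)
      = Lp_norm n p (walsh_multiplier n (\<lambda>A. \<Sum>g\<in>\<G>. complex_of_real (\<Prod>j\<in>{1..N}. w (g j)) * (\<Prod>j\<in>{1..N}. 1 - avoids (g j) A)) f)"
    by (rule arg_cong)
  also have "\<dots> \<le> (\<Sum>g\<in>\<G>. cmod (complex_of_real (\<Prod>j\<in>{1..N}. w (g j)))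
      * Lp_norm n p (walsh_multiplier n (\<lambda>A. \<Prod>j\<in>{1..N}. 1 - avoids (g j) A) f))"
    by (rule Lp_norm_walsh_multiplier_sum_le[OF p])
  also have "\<dots> \<le> (\<Sum>g\<in>\<G>. (\<Prod>j\<in>{1..N}. w (g j)) * ((2 ^ N - \<delta>) * Lp_norm n p f))"
  proof (rule sum_mono, rule mult_mono)
    fix g assume "g \<in> \<G>"
    then have "g j \<subseteq> {1..n}" if "j \<in> {1..N}" for j using that by (auto simp: \<G>_def PiE_iff)
    then show "Lp_norm n p (walsh_multiplier n (\<lambda>A. \<Prod>j\<in>{1..N}. 1 - avoids (g j) A) f) \<le> (2 ^ N - \<delta>) * Lp_norm n p f"
      by (intro product_of_complements_gap p N deficient)
    show "cmod (complex_of_real (\<Prod>j\<in>{1..N}. w (g j))) \<le> (\<Prod>j\<in>{1..N}. w (g j))"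
      unfolding norm_of_real using w by (simp add: prod_nonneg)
  qed (auto simp: Lp_norm_nonneg w prod_nonneg)
  also have "\<dots> = (2 ^ N - \<delta>) * Lp_norm n p f"
    unfolding sum_distrib_right[symmetric] total by simp
  finally show ?thesis .
qed

section \<open>Lower bounds for the heat semigroup\<close>

context gapped_semigroup
begin

text \<open>
  Test against a functional \<open>c\<close> norming \<open>a\<close>. On the image of the sector the polynomial with coefficients
  $c_k e^{-tk} a_k$ is controlled by $T_t a$, and its value at $e^t$ is \<open>N a\<close>.
\<close>

lemma semigroup_bounded_below:
  fixes t :: real
  assumes t: "0 < t"
  defines "q \<equiv> (1 - exp (- t)) powr (pi / (2 * (pi - arctan (sector_slope m \<rho>))))"
  shows "N a \<le> 2 * N (\<lambda>k. exp (- complex_of_real (t * real k)) * a k) * ((1 + q) / (1 - q)) ^ n"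
proof -
  define b where "b k = exp (- complex_of_real (t * real k)) * a k" for k
  obtain c where c: "\<And>a. cmod (\<Sum>k\<le>n. c k * a k) \<le> N a"
      "(\<Sum>k\<le>n. c k * a k) = complex_of_real (N a)"
    by (rule norming_functional[of N n a])
      (rule subadditive, rule homogeneous, rule finitely_determined, blast, blast)
  have "cmod (\<Sum>k\<le>n. (c k * b k) * exp (complex_of_real t * k)) \<le> 2 * N b * ((1 + q) / (1 - q)) ^ n"
    unfolding q_def
  proof (rule polynomial_growth_from_sector[OF sector_slope_pos[OF \<rho>] t])
    fix z assume "\<bar>Im z\<bar> \<le> sector_slope m \<rho> * Re z"
    from mult_boundD[OF mult_bound_sector[OF this], of b]
    have "N (\<lambda>k. exp (- z * k) * b k) \<le> 2 * N b" .
    then show "cmod (\<Sum>k\<le>n. (c k * b k) * exp (- z * k)) \<le> 2 * N b"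
      using c(1)[of "\<lambda>k. exp (- z * k) * b k"] by (simp add: mult_ac)
  qed
  also have "(\<Sum>k\<le>n. (c k * b k) * exp (complex_of_real t * k)) = (\<Sum>k\<le>n. c k * a k)"
    by (intro sum.cong) (simp_all add: b_def exp_minus)
  also have "cmod \<dots> = N a" unfolding c(2) norm_of_real using N_nonneg by simp
  finally show ?thesis by (simp add: b_def)
qed

end

text \<open>
  The degree of \<open>f\<close> enters here: it limits the number of relevant coordinates of the seminorm, which is the degree of
  the polynomials to be estimated.
\<close>

lemma gapped_semigroup_of_degree:
  fixes f :: "(nat \<Rightarrow> real) \<Rightarrow> 'a::complex_banach"
  assumes p: "1 < p" and N: "1 \<le> N" and \<delta>: "0 < \<delta>"
    and deficient: "Lp_sign_deficient TYPE('a) p N \<delta>"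
    and deg: "degree_at_most n d f"
  shows "gapped_semigroup (\<lambda>a. Lp_norm n p (walsh_multiplier n (\<lambda>A. a (card A)) f)) d N (2 ^ N - \<delta>)"
proof -
  interpret multiplier_seminorm "\<lambda>a. Lp_norm n p (walsh_multiplier n (\<lambda>A. a (card A)) f)" d
  proof
    show "Lp_norm n p (walsh_multiplier n (\<lambda>A. a (card A) + b (card A)) f)
        \<le> Lp_norm n p (walsh_multiplier n (\<lambda>A. a (card A)) f) + Lp_norm n p (walsh_multiplier n (\<lambda>A. b (card A)) f)"
      for a b
      using Lp_norm_triangle[OF p, of n "walsh_multiplier n (\<lambda>A. a (card A)) f" "walsh_multiplier n (\<lambda>A. b (card A)) f"]
      by (simp only: walsh_multiplier_add[symmetric])
    show "Lp_norm n p (walsh_multiplier n (\<lambda>A. z * a (card A)) f)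
        = cmod z * Lp_norm n p (walsh_multiplier n (\<lambda>A. a (card A)) f)" for z a
      by (rule Lp_norm_walsh_multiplier_scale[OF p])
    show "Lp_norm n p (walsh_multiplier n (\<lambda>A. a (card A)) f) = Lp_norm n p (walsh_multiplier n (\<lambda>A. b (card A)) f)"
      if "\<And>k. k \<le> d \<Longrightarrow> a k = b k" for a b
    proof -
      have "a (card A) *\<^sub>C walsh A \<epsilon> *\<^sub>R walsh_coeff n f A = b (card A) *\<^sub>C walsh A \<epsilon> *\<^sub>R walsh_coeff n f A"
        if A: "A \<subseteq> {1..n}" for A \<epsilon>
        using that \<open>\<And>k. k \<le> d \<Longrightarrow> a k = b k\<close> deg unfolding degree_at_most_def
        by (cases "card A \<le> d") auto
      then show ?thesis unfolding walsh_multiplier_def by (intro Lp_norm_cong arg_cong[of _ _ norm] sum.cong) auto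
    qed
  qed
  have q: "0 \<le> exp (- t)" "exp (- t) \<le> 1" "exp (- complex_of_real (t * real k)) = complex_of_real (exp (- t) ^ k)"
    if "0 \<le> t" for t :: real and k
    using that exp_of_nat_mult[of k "- complex_of_real t"] by (auto simp: mult.commute simp flip: exp_of_real)
  show ?thesis
  proof
    fix t :: real assume t: "0 \<le> t"
    define g where "g a = walsh_multiplier n (\<lambda>A. a (card A)) f" for a :: "nat \<Rightarrow> complex"
    show "mult_bound (\<lambda>k. exp (- complex_of_real (t * real k))) 1"
      unfolding mult_bound_def q(3)[OF t]
    proof
      fix a
      show "Lp_norm n p (walsh_multiplier n (\<lambda>A. complex_of_real (exp (- t) ^ card A) * a (card A)) f)
          \<le> 1 * Lp_norm n p (walsh_multiplier n (\<lambda>A. a (card A)) f)"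
        using heat_contractive[OF p q(1,2)[OF t], where n = n and f = "g a"]
        by (simp only: g_def walsh_multiplier_compose mult_1)
    qed
    show "mult_bound (\<lambda>k. (1 - exp (- complex_of_real (t * real k))) ^ N) (2 ^ N - \<delta>)"
      unfolding mult_bound_def q(3)[OF t]
    proof
      fix a
      show "Lp_norm n p (walsh_multiplier n (\<lambda>A. (1 - complex_of_real (exp (- t) ^ card A)) ^ N * a (card A)) f)
          \<le> (2 ^ N - \<delta>) * Lp_norm n p (walsh_multiplier n (\<lambda>A. a (card A)) f)"
        using heat_difference_gap[OF p N q(1,2)[OF t] deficient, where n = n and f = "g a"]
        by (simp only: g_def walsh_multiplier_compose)
    qed
  next
    show "2 ^ N - \<delta> < 2 ^ N" using \<delta> by simp
  qed
qed

theorem theorem7: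
  fixes p :: real
  assumes "K_convex TYPE('a::complex_banach)"
    and "1 < p"
  shows "\<exists>c C \<eta> :: real. 0 < c \<and> 0 < C \<and> 1 / 2 < \<eta> \<and> \<eta> \<le> 1 \<and>
    (\<forall>(n::nat) (d::nat) (f :: (nat \<Rightarrow> real) \<Rightarrow> 'a).
       d \<in> {1..n} \<longrightarrow> degree_at_most n d f \<longrightarrow>
       (\<forall>t\<ge>0. Lp_norm n p (heat n t f) \<ge>
          c * exp (- C * real d * max t (t powr \<eta>)) * Lp_norm n p f))"
proof -
  note p = \<open>1 < p\<close>
  obtain N \<delta> where N: "1 \<le> N" and \<delta>: "0 < \<delta>" "\<delta> < 1" and def: "sign_deficient TYPE('a) N \<delta>"
    using K_convex_imp_sign_deficient[OF assms(1)] by blast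
  obtain \<delta>' where \<delta>': "0 < \<delta>'" and deficient: "Lp_sign_deficient TYPE('a) p N \<delta>'"
    using sign_deficient_Lp[OF def N \<delta> p] by blast
  define \<theta> where "\<theta> = arctan (sector_slope N (2 ^ N - \<delta>'))"
  have "0 < sector_slope N (2 ^ N - \<delta>')" using \<delta>' by (intro sector_slope_pos) simp
  then have \<theta>: "0 < \<theta>" by (simp add: \<theta>_def)
  have \<theta>2: "\<theta> < pi / 2" unfolding \<theta>_def by (rule arctan_ubound)
  define \<eta> where "\<eta> = pi / (2 * (pi - \<theta>))"
  have "\<theta> < pi" using \<theta>2 pi_gt_zero by linarith
  then have \<eta>: "1 / 2 < \<eta>" "\<eta> \<le> 1"
    unfolding \<eta>_def using \<theta> \<theta>2 by (simp_all add: pos_less_divide_eq pos_divide_le_eq)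
  define C where "C = 2 * exp 1 / \<eta>"
  have C: "0 < C" using \<eta> by (simp add: C_def)
  have main: "1 / 2 * exp (- C * real d * max t (t powr \<eta>)) * Lp_norm n p f \<le> Lp_norm n p (heat n t f)"
    if deg: "degree_at_most n d f" and t: "0 \<le> t" for n d t and f :: "(nat \<Rightarrow> real) \<Rightarrow> 'a"
  proof -
    have f_eq: "Lp_norm n p (walsh_multiplier n (\<lambda>_. 1) f) = Lp_norm n p f"
      by (intro Lp_norm_cong) (simp add: walsh_multiplier_one)
    show ?thesis
    proof (cases "t = 0")
      case True
      then have "Lp_norm n p (heat n t f) = Lp_norm n p f"
        using f_eq by (simp add: heat_eq_walsh_multiplier)
      then show ?thesis using True Lp_norm_nonneg[of n p f] by simp
    next
      case False
      with t have t: "0 < t" by simp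
      define q where "q = (1 - exp (- t)) powr \<eta>"
      interpret gapped_semigroup "\<lambda>a. Lp_norm n p (walsh_multiplier n (\<lambda>A. a (card A)) f)" d N "2 ^ N - \<delta>'"
        by (rule gapped_semigroup_of_degree[OF p N \<delta>' deficient deg])
      have "Lp_norm n p f \<le> 2 * Lp_norm n p (heat n t f) * ((1 + q) / (1 - q)) ^ d"
        using semigroup_bounded_below[OF t, of "\<lambda>_. 1"]
        by (simp add: f_eq heat_eq_walsh_multiplier q_def \<eta>_def \<theta>_def)
      also have "\<dots> \<le> 2 * Lp_norm n p (heat n t f) * exp (C * max t (t powr \<eta>)) ^ d"
      proof (intro mult_left_mono power_mono)
        show "(1 + q) / (1 - q) \<le> exp (C * max t (t powr \<eta>))"
          unfolding q_def C_def using t \<eta> by (intro growth_factor_le) auto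
        have "q \<le> 1" unfolding q_def using t \<eta> by (intro powr_le1) auto
        then show "0 \<le> (1 + q) / (1 - q)" by (simp add: q_def)
      qed (simp add: Lp_norm_nonneg)
      also have "exp (C * max t (t powr \<eta>)) ^ d = exp (C * real d * max t (t powr \<eta>))"
        by (simp add: mult_ac flip: exp_of_nat_mult)
      finally show ?thesis by (simp add: exp_minus field_simps)
    qed
  qed
  show ?thesis
    by (rule exI[of _ "1 / 2"], rule exI[of _ C], rule exI[of _ \<eta>]) (use C \<eta> main in auto)
qed

end
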